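(* Let $K$ be a field, $A$ an s-unital $K$-algebra and $E$ a row-finite graph such that (i) every nonzero right ideal in every quotient of $A$ contains a nonzero idempotent; (ii) the only hereditary and saturated subsets of $E^0$ are $\emptyset$ and $E^0$; (iii) every cycle in $E$ has an exit; (iv) every vertex in $E$ connects to a cycle. Then the algebra $R=A\otimes_K L_K(E)$ is properly purely infinite.
   Context: Rings and algebras are associative and not necessarily unital. A ring $R$ is s-unital if for each $x\in R$ there exist $u,v\in R$ with $ux=xv=x$. An element $a$ of a ring $R$ is properly infinite if $a\neq 0$ and there exist $\alpha_1,\alpha_2,\beta_1,\beta_2\in R$ with $\alpha_i a\beta_j=\delta_{ij}a$ for all $i,j\in\{1,2\}$. A ring is properly purely infinite if every nonzero element of it is properly infinite. A (directed) graph $E=(E^0,E^1,r,s)$ consists of two countable sets $E^0$ (vertices) and $E^1$ (edges) with maps $r,s:E^1\to E^0$ (range and source). $E$ is row-finite if $s^{-1}(v)$ is finite for every $v\in E^0$. A sink is a vertex emitting no edges. A path $\mu=e_1\cdots e_n$ is a sequence of edges with $r(e_i)=s(e_{i+1})$; $s(\mu)=s(e_1)$, $r(\mu)=r(e_n)$; vertices are also regarded as (trivial) paths of length $0$. A cycle is a path $\mu=e_1\cdots e_n$ of positive length with $s(\mu)=r(\mu)$ and $s(e_i)\neq s(e_j)$ for all $i\neq j$. An edge $e$ is an exit for $\mu=e_1\cdots e_n$ if there is $i$ with $s(e)=s(e_i)$ and $e\neq e_i$. Write $v\ge w$ if there is a path from $v$ to $w$; $v$ connects to a cycle if $v\ge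 w$ for some vertex $w$ on the cycle. $H\subseteq E^0$ is hereditary if $v\ge w$ and $v\in H$ imply $w\in H$, and saturated if $s^{-1}(v)\neq\emptyset$ and $r(s^{-1}(v))\subseteq H$ imply $v\in H$. The Leavitt path algebra $L_K(E)$ is the (not necessarily unital) $K$-algebra generated by $E^0\cup E^1\cup\{e^*\mid e\in E^1\}$ with relations: (1) $vw=\delta_{v,w}v$ for $v,w\in E^0$; (2) $s(e)e=er(e)=e$ for $e\in E^1$; (3) $r(e)e^*=e^*s(e)=e^*$ for $e\in E^1$; (4) $e^*f=\delta_{e,f}r(e)$ for $e,f\in E^1$; (5) $v=\sum_{e\in s^{-1}(v)}ee^*$ for every $v\in E^0$ that is not a sink. *)

theory Defs
  imports
    "HOL-Library.Countable_Set"
    "HOL-Algebra.Module"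
    "HOL-Algebra.QuotRing"
    "Graph_Theory.Arc_Walk"
begin

section \<open>Rings and algebras, not necessarily unital\<close>

text \<open>
  The records of HOL-Algebra are used for rings and algebras without unit; their field
  \<^const>\<open>one\<close> is ignored throughout and carries junk values in the constructions below.
\<close>

locale nonunital_ring = abelian_group R for R (structure) +
  assumes m_closed [simp, intro]:
      "\<lbrakk>x \<in> carrier R; y \<in> carrier R\<rbrakk> \<Longrightarrow> x \<otimes> y \<in> carrier R"
    and m_assoc:
      "\<lbrakk>x \<in> carrier R; y \<in> carrier R; z \<in> carrier R\<rbrakk> \<Longrightarrow> (x \<otimes> y) \<otimes> z = x \<otimes> (y \<otimes> z)"
    and l_distr:
      "\<lbrakk>x \<in> carrier R; y \<in> carrier R; z \<in> carrier R\<rbrakk> \<Longrightarrow> (x \<oplus> y) \<otimes> z = x \<otimes> z \<oplus> y \<otimes> z"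
    and r_distr:
      "\<lbrakk>x \<in> carrier R; y \<in> carrier R; z \<in> carrier R\<rbrakk> \<Longrightarrow> z \<otimes> (x \<oplus> y) = z \<otimes> x \<oplus> z \<otimes> y"

locale nonunital_algebra = Module.module K A + nonunital_ring A for K and A (structure) +
  assumes smult_mult_left:
      "\<lbrakk>c \<in> carrier K; x \<in> carrier A; y \<in> carrier A\<rbrakk> \<Longrightarrow> (c \<odot> x) \<otimes> y = c \<odot> (x \<otimes> y)"
    and smult_mult_right:
      "\<lbrakk>c \<in> carrier K; x \<in> carrier A; y \<in> carrier A\<rbrakk> \<Longrightarrow> x \<otimes> (c \<odot> y) = c \<odot> (x \<otimes> y)"

definition s_unital :: "('a, 'm) ring_scheme \<Rightarrow> bool" where
  "s_unital R \<longleftrightarrow>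
     (\<forall>x\<in>carrier R. \<exists>u\<in>carrier R. \<exists>v\<in>carrier R. u \<otimes>\<^bsub>R\<^esub> x = x \<and> x \<otimes>\<^bsub>R\<^esub> v = x)"

definition properly_infinite :: "('a, 'm) ring_scheme \<Rightarrow> 'a \<Rightarrow> bool" where
  "properly_infinite R a \<longleftrightarrow> a \<noteq> \<zero>\<^bsub>R\<^esub> \<and>
     (\<exists>\<alpha> \<beta> :: nat \<Rightarrow> 'a.
        (\<forall>i\<in>{1, 2}. \<alpha> i \<in> carrier R \<and> \<beta> i \<in> carrier R) \<and>
        (\<forall>i\<in>{1, 2}. \<forall>j\<in>{1, 2}.
           \<alpha> i \<otimes>\<^bsub>R\<^esub> a \<otimes>\<^bsub>R\<^esub> \<beta> j = (if i = j then a else \<zero>\<^bsub>R\<^esub>)))"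

definition properly_purely_infinite :: "('a, 'm) ring_scheme \<Rightarrow> bool" where
  "properly_purely_infinite R \<longleftrightarrow> (\<forall>a\<in>carrier R - {\<zero>\<^bsub>R\<^esub>}. properly_infinite R a)"

definition right_ideal :: "'a set \<Rightarrow> ('a, 'm) ring_scheme \<Rightarrow> bool" where
  "right_ideal J R \<longleftrightarrow> additive_subgroup J R \<and>
     (\<forall>a\<in>J. \<forall>x\<in>carrier R. a \<otimes>\<^bsub>R\<^esub> x \<in> J)"

definition two_sided_ideal :: "'a set \<Rightarrow> ('a, 'm) ring_scheme \<Rightarrow> bool" where
  "two_sided_ideal I R \<longleftrightarrow> additive_subgroup I R \<and>
     (\<forall>a\<in>I. \<forall>x\<in>carrier R. x \<otimes>\<^bsub>R\<^esub> a \<in> I \<and> a \<otimes>\<^bsub>R\<^esub> x \<in> I)"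

definition right_ideals_contain_idempotents :: "('a, 'm) ring_scheme \<Rightarrow> bool" where
  "right_ideals_contain_idempotents R \<longleftrightarrow>
     (\<forall>J. right_ideal J R \<and> J \<noteq> {\<zero>\<^bsub>R\<^esub>} \<longrightarrow>
        (\<exists>e\<in>J. e \<noteq> \<zero>\<^bsub>R\<^esub> \<and> e \<otimes>\<^bsub>R\<^esub> e = e))"


section \<open>Algebras given by generators and relations\<close>

definition span_of ::
    "('k, 'm) ring_scheme \<Rightarrow> ('k, 'a, 'n) module_scheme \<Rightarrow> 'a set \<Rightarrow> 'a set" where
  "span_of K M S = \<Inter>{N. submodule N K M \<and> S \<subseteq> N}"

definition algebra_ideal ::
    "'a set \<Rightarrow> ('k, 'm) ring_scheme \<Rightarrow> ('k, 'a, 'n) module_scheme \<Rightarrow> bool" where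
  "algebra_ideal I K A \<longleftrightarrow> submodule I K A \<and> two_sided_ideal I A"

definition algebra_ideal_of ::
    "('k, 'm) ring_scheme \<Rightarrow> ('k, 'a, 'n) module_scheme \<Rightarrow> 'a set \<Rightarrow> 'a set" where
  "algebra_ideal_of K A S = \<Inter>{I. algebra_ideal I K A \<and> S \<subseteq> I}"

text \<open>The quotient \<^const>\<open>FactRing\<close> of the underlying rings, together with scalars.\<close>

definition quotient_algebra :: "('k, 'a, 'n) module_scheme \<Rightarrow> 'a set \<Rightarrow> ('k, 'a set) module" where
  "quotient_algebra A I =
     \<lparr>carrier = a_rcosets\<^bsub>A\<^esub> I, mult = rcoset_mult A I,
      one = I +>\<^bsub>A\<^esub> \<one>\<^bsub>A\<^esub>, zero = I, add = set_add A,
      smult = (\<lambda>c X. \<Union>x\<in>X. I +>\<^bsub>A\<^esub> (c \<odot>\<^bsub>A\<^esub> x))\<rparr>"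

text \<open>
  The algebra \<open>K[S]\<close> of a semigroup \<open>S\<close>: the free module on \<open>S\<close>, realised by finitely supported
  functions, with the bilinear extension of the product of \<open>S\<close>.
\<close>

definition semigroup_algebra ::
    "('k, 'm) ring_scheme \<Rightarrow> ('s, 'n) monoid_scheme \<Rightarrow> ('k, 's \<Rightarrow> 'k) module" where
  "semigroup_algebra K S =
     \<lparr>carrier = {f. (\<forall>s\<in>carrier S. f s \<in> carrier K) \<and> (\<forall>s. s \<notin> carrier S \<longrightarrow> f s = \<zero>\<^bsub>K\<^esub>) \<and>
                    finite {s. f s \<noteq> \<zero>\<^bsub>K\<^esub>}},
      mult = (\<lambda>f g s. \<Oplus>\<^bsub>K\<^esub>p\<in>{(t, u). f t \<noteq> \<zero>\<^bsub>K\<^esub> \<and> g u \<noteq> \<zero>\<^bsub>K\<^esub> \<and> t \<otimes>\<^bsub>S\<^esub> u = s}.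
                        f (fst p) \<otimes>\<^bsub>K\<^esub> g (snd p)),
      one = undefined,
      zero = (\<lambda>s. \<zero>\<^bsub>K\<^esub>),
      add = (\<lambda>f g s. f s \<oplus>\<^bsub>K\<^esub> g s),
      smult = (\<lambda>c f s. c \<otimes>\<^bsub>K\<^esub> f s)\<rparr>"

definition basis_elem :: "('k, 'm) ring_scheme \<Rightarrow> 's \<Rightarrow> 's \<Rightarrow> 'k" where
  "basis_elem K s = (\<lambda>t. if t = s then \<one>\<^bsub>K\<^esub> else \<zero>\<^bsub>K\<^esub>)"

text \<open>The empty word is excluded, so the free algebra has no unit.\<close>

definition free_semigroup :: "'x set \<Rightarrow> 'x list monoid" where
  "free_semigroup X = \<lparr>carrier = lists X - {[]}, mult = (@), one = undefined\<rparr>"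

definition free_algebra :: "('k, 'm) ring_scheme \<Rightarrow> 'x set \<Rightarrow> ('k, 'x list \<Rightarrow> 'k) module" where
  "free_algebra K X = semigroup_algebra K (free_semigroup X)"


section \<open>Tensor products of algebras\<close>

text \<open>
  The product of the free module on \<open>A \<times> B\<close> is determined by
  \<open>(a, b) (a', b') = (a a', b b')\<close>, so it is the algebra of the multiplicative semigroup
  of \<open>A \<times> B\<close>. The span of the bilinearity relations is an ideal for this product.
\<close>

definition tensor_relations ::
    "('k, 'm) ring_scheme \<Rightarrow> ('k, 'a, 'n) module_scheme \<Rightarrow> ('k, 'b, 'p) module_scheme
      \<Rightarrow> ('a \<times> 'b \<Rightarrow> 'k) set" where
  "tensor_relations K A B =
     (let F = semigroup_algebra K (A \<times>\<times> B); d = basis_elem K in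
       {d (a \<oplus>\<^bsub>A\<^esub> a', b) \<ominus>\<^bsub>F\<^esub> (d (a, b) \<oplus>\<^bsub>F\<^esub> d (a', b)) | a a' b.
          a \<in> carrier A \<and> a' \<in> carrier A \<and> b \<in> carrier B} \<union>
       {d (a, b \<oplus>\<^bsub>B\<^esub> b') \<ominus>\<^bsub>F\<^esub> (d (a, b) \<oplus>\<^bsub>F\<^esub> d (a, b')) | a b b'.
          a \<in> carrier A \<and> b \<in> carrier B \<and> b' \<in> carrier B} \<union>
       {d (c \<odot>\<^bsub>A\<^esub> a, b) \<ominus>\<^bsub>F\<^esub> c \<odot>\<^bsub>F\<^esub> d (a, b) | c a b.
          c \<in> carrier K \<and> a \<in> carrier A \<and> b \<in> carrier B} \<union>
       {d (a, c \<odot>\<^bsub>B\<^esub> b) \<ominus>\<^bsub>F\<^esub> c \<odot>\<^bsub>F\<^esub> d (a, b) | c a b.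
          c \<in> carrier K \<and> a \<in> carrier A \<and> b \<in> carrier B})"

definition tensor_algebra ::
    "('k, 'm) ring_scheme \<Rightarrow> ('k, 'a, 'n) module_scheme \<Rightarrow> ('k, 'b, 'p) module_scheme
      \<Rightarrow> ('k, ('a \<times> 'b \<Rightarrow> 'k) set) module" where
  "tensor_algebra K A B =
     (let F = semigroup_algebra K (A \<times>\<times> B)
      in quotient_algebra F (span_of K F (tensor_relations K A B)))"


section \<open>Graphs\<close>

text \<open>
  Source and range of an edge are \<^const>\<open>tail\<close> and \<^const>\<open>head\<close>. Loops and parallel edges are
  allowed in \<^locale>\<open>wf_digraph\<close>, and \<^const>\<open>pre_digraph.cycle\<close> includes loops.
\<close>

definition row_finite :: "('v, 'e) pre_digraph \<Rightarrow> bool" where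
  "row_finite E \<longleftrightarrow> (\<forall>v\<in>verts E. finite (out_arcs E v))"

definition hereditary :: "('v, 'e) pre_digraph \<Rightarrow> 'v set \<Rightarrow> bool" where
  "hereditary E H \<longleftrightarrow> (\<forall>v w. v \<rightarrow>\<^sup>*\<^bsub>E\<^esub> w \<and> v \<in> H \<longrightarrow> w \<in> H)"

definition saturated :: "('v, 'e) pre_digraph \<Rightarrow> 'v set \<Rightarrow> bool" where
  "saturated E H \<longleftrightarrow>
     (\<forall>v\<in>verts E. out_arcs E v \<noteq> {} \<and> head E ` out_arcs E v \<subseteq> H \<longrightarrow> v \<in> H)"

definition is_exit :: "('v, 'e) pre_digraph \<Rightarrow> 'e \<Rightarrow> 'e list \<Rightarrow> bool" where
  "is_exit E e p \<longleftrightarrow> e \<in> arcs E \<and> (\<exists>i<length p. tail E e = tail E (p ! i) \<and> e \<noteq> p ! i)"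

text \<open>The vertices on a cycle are the sources of its edges.\<close>

definition connects_to_cycle :: "('v, 'e) pre_digraph \<Rightarrow> 'v \<Rightarrow> bool" where
  "connects_to_cycle E v \<longleftrightarrow>
     (\<exists>p. pre_digraph.cycle E p \<and> (\<exists>e\<in>set p. v \<rightarrow>\<^sup>*\<^bsub>E\<^esub> tail E e))"


section \<open>Leavitt path algebras\<close>

datatype ('v, 'e) leavitt_gen = Vertex 'v | Edge 'e | Ghost 'e

definition leavitt_gens :: "('v, 'e) pre_digraph \<Rightarrow> ('v, 'e) leavitt_gen set" where
  "leavitt_gens E = Vertex ` verts E \<union> Edge ` arcs E \<union> Ghost ` arcs E"

definition leavitt_relations ::
    "('k, 'm) ring_scheme \<Rightarrow> ('v, 'e) pre_digraph \<Rightarrow> (('v, 'e) leavitt_gen list \<Rightarrow> 'k) set" where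
  "leavitt_relations K E =
     (let F = free_algebra K (leavitt_gens E);
          vx = (\<lambda>v. basis_elem K [Vertex v]);
          ed = (\<lambda>e. basis_elem K [Edge e]);
          gh = (\<lambda>e. basis_elem K [Ghost e]) in
       {vx v \<otimes>\<^bsub>F\<^esub> vx w \<ominus>\<^bsub>F\<^esub> (if v = w then vx v else \<zero>\<^bsub>F\<^esub>) | v w. v \<in> verts E \<and> w \<in> verts E} \<union>
       {vx (tail E e) \<otimes>\<^bsub>F\<^esub> ed e \<ominus>\<^bsub>F\<^esub> ed e | e. e \<in> arcs E} \<union>
       {ed e \<otimes>\<^bsub>F\<^esub> vx (head E e) \<ominus>\<^bsub>F\<^esub> ed e | e. e \<in> arcs E} \<union>
       {vx (head E e) \<otimes>\<^bsub>F\<^esub> gh e \<ominus>\<^bsub>F\<^esub> gh e | e. e \<in> arcs E} \<union>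
       {gh e \<otimes>\<^bsub>F\<^esub> vx (tail E e) \<ominus>\<^bsub>F\<^esub> gh e | e. e \<in> arcs E} \<union>
       {gh e \<otimes>\<^bsub>F\<^esub> ed f \<ominus>\<^bsub>F\<^esub> (if e = f then vx (head E e) else \<zero>\<^bsub>F\<^esub>) | e f. e \<in> arcs E \<and> f \<in> arcs E} \<union>
       {vx v \<ominus>\<^bsub>F\<^esub> (\<Oplus>\<^bsub>F\<^esub>e\<in>out_arcs E v. ed e \<otimes>\<^bsub>F\<^esub> gh e) | v. v \<in> verts E \<and> out_arcs E v \<noteq> {}})"

definition leavitt_path_algebra ::
    "('k, 'm) ring_scheme \<Rightarrow> ('v, 'e) pre_digraph
      \<Rightarrow> ('k, (('v, 'e) leavitt_gen list \<Rightarrow> 'k) set) module" where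
  "leavitt_path_algebra K E =
     (let F = free_algebra K (leavitt_gens E)
      in quotient_algebra F (algebra_ideal_of K F (leavitt_relations K E)))"

end

theory Submission
  imports Defs
begin

text \<open>
  Fix \<open>x \<in> R = A \<otimes> L\<^sub>K(E)\<close> and let \<open>J\<close> be the set of all \<open>y\<close> for which the diagonal matrix
  \<open>diag(x, y)\<close> has the form \<open>\<alpha> x \<beta>\<close> with a column \<open>\<alpha>\<close> and a row \<open>\<beta>\<close>. By definition a nonzero \<open>x\<close>
  is properly infinite exactly when \<open>x \<in> J\<close>. The set \<open>J\<close> is an ideal (\<open>two_sided_ideal_absorbed\<close>):
  once \<open>x\<close> can split off \<open>y\<close> without being used up, it can afterwards also split off \<open>z\<close>. For the
  same reason a compression \<open>\<alpha> x \<beta>\<close> of \<open>x\<close> may be corrected freely by elements of \<open>J\<close>, so that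
  compressions need only be computed in \<open>R/J\<close>.

  Suppose that \<open>x \<notin> J\<close>. It then suffices to find an idempotent of \<open>R/J\<close> that is nonzero, infinite,
  and a compression of \<open>x\<close>. Such an idempotent \<open>h\<close> contains two orthogonal copies of itself, one
  of which can replace \<open>h\<close> inside \<open>x\<close> while the other is set free. So \<open>h\<close> is absorbed by \<open>x\<close>, that
  is, \<open>h \<in> J\<close> (\<open>absorbs_idempotent_modulo_absorbed\<close>), which is a contradiction.

  The idempotent comes from the graph. The hypotheses on \<open>E\<close> yield a vertex \<open>w\<close> that emits two
  different edges and is reached from every vertex (\<open>branching_vertex_reached_from_everywhere\<close>),
  and two closed paths at \<open>w\<close> with different first edges are two orthogonal copies of \<open>w\<close>.
  Moreover, as there are no proper nonempty hereditary and saturated sets, for \<open>a \<in> A\<close> either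
  every \<open>a \<otimes> v\<close> or no \<open>a \<otimes> v\<close> lies in \<open>J\<close>, where \<open>v\<close> runs through the vertices. Write \<open>x\<close> as a sum
  of terms \<open>a \<otimes> m\<close> with monomials \<open>m\<close>. Multiplication by a long path from the right removes all
  ghost edges without entering \<open>J\<close>; multiplication by \<open>p\<^sup>*\<close> from the left, where \<open>p\<close> is the
  shortest path whose term is not in \<open>J\<close>, leaves \<open>a \<otimes> v\<close> plus terms with closed paths; and these
  are removed by \<open>r\<^sup>* \<cdot> r\<close> for a path \<open>r\<close> from \<open>v\<close> to \<open>w\<close> that runs along none of them
  (\<open>reduce_to_branching_vertex\<close>). So \<open>x\<close> compresses modulo \<open>J\<close> to some \<open>a \<otimes> w \<notin> J\<close>. Finally
  \<open>{a. a \<otimes> w \<in> J}\<close> is an ideal of \<open>A\<close>, and an idempotent in a right ideal of the quotient by it replaces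
  \<open>a\<close> by a multiple \<open>d\<close> that is idempotent modulo this ideal; \<open>h = d \<otimes> w\<close> is the idempotent that
  was sought (\<open>element_absorbs_itself\<close>).

  All of this takes place in a ring that is generated by elements \<open>a \<otimes> m\<close> with the expected
  products, which is the locale \<open>leavitt_tensor\<close>. The last sections show that the tensor product
  of algebras given by generators and relations is such a ring.
\<close>

section \<open>Nonunital rings and their quotients\<close>

context nonunital_ring
begin

lemma l_null [simp]:
  assumes "x \<in> carrier R" shows "\<zero> \<otimes> x = \<zero>"
proof -
  have "\<zero> \<otimes> x \<oplus> \<zero> \<otimes> x = \<zero> \<otimes> x \<oplus> \<zero>"
    using l_distr[of \<zero> \<zero> x] assms by simp
  then show ?thesis
    using assms by (metis add.l_cancel_one' m_closed zero_closed r_zero)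
qed

lemma r_null [simp]:
  assumes "x \<in> carrier R" shows "x \<otimes> \<zero> = \<zero>"
proof -
  have "x \<otimes> \<zero> \<oplus> x \<otimes> \<zero> = x \<otimes> \<zero> \<oplus> \<zero>"
    using r_distr[of \<zero> \<zero> x] assms by simp
  then show ?thesis
    using assms by (metis add.l_cancel_one' m_closed zero_closed r_zero)
qed

lemma l_minus:
  assumes "x \<in> carrier R" "y \<in> carrier R" shows "\<ominus> x \<otimes> y = \<ominus> (x \<otimes> y)"
  using assms l_distr[of "\<ominus> x" x y] by (simp add: l_neg minus_equality)

lemma r_minus:
  assumes "x \<in> carrier R" "y \<in> carrier R" shows "x \<otimes> \<ominus> y = \<ominus> (x \<otimes> y)"
  using assms r_distr[of "\<ominus> y" y x] by (simp add: l_neg minus_equality)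

lemmas ring_expand = m_assoc l_distr r_distr l_minus r_minus minus_eq minus_add a_assoc

end

lemma two_sided_idealI:
  assumes "abelian_group R" "I \<subseteq> carrier R" "\<zero>\<^bsub>R\<^esub> \<in> I"
    and "\<And>a b. \<lbrakk>a \<in> I; b \<in> I\<rbrakk> \<Longrightarrow> a \<oplus>\<^bsub>R\<^esub> b \<in> I"
    and "\<And>a. a \<in> I \<Longrightarrow> \<ominus>\<^bsub>R\<^esub> a \<in> I"
    and "\<And>a x. \<lbrakk>a \<in> I; x \<in> carrier R\<rbrakk> \<Longrightarrow> x \<otimes>\<^bsub>R\<^esub> a \<in> I"
    and "\<And>a x. \<lbrakk>a \<in> I; x \<in> carrier R\<rbrakk> \<Longrightarrow> a \<otimes>\<^bsub>R\<^esub> x \<in> I"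
  shows "two_sided_ideal I R"
proof -
  interpret abelian_group R by fact
  have "additive_subgroup I R"
    using assms by (intro additive_subgroupI add.subgroupI) (auto simp: a_inv_def)
  then show ?thesis using assms by (auto simp: two_sided_ideal_def)
qed

text \<open>
  One description covers the rings \<^term>\<open>R Quot I\<close> and the algebras \<^const>\<open>quotient_algebra\<close>:
  they share the ring operations and differ in the junk unit and in the presence of scalars.
\<close>

locale ideal_quotient = nonunital_ring R for R (structure) +
  fixes I and Q (structure)
  assumes ideal: "two_sided_ideal I R"
    and carrier_Q: "carrier Q = a_rcosets\<^bsub>R\<^esub> I"
    and mult_Q: "mult Q = rcoset_mult R I"
    and zero_Q: "\<zero>\<^bsub>Q\<^esub> = I"
    and add_Q: "add Q = set_add R"
begin

abbreviation proj where "proj x \<equiv> I +>\<^bsub>R\<^esub> x"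

sublocale abelian_subgroup I R
  using ideal by (intro abelian_subgroupI3) (auto simp: two_sided_ideal_def abelian_group_axioms)

lemma ideal_mult_closed [simp, intro]:
  assumes "x \<in> carrier R" "i \<in> I" shows "x \<otimes>\<^bsub>R\<^esub> i \<in> I" "i \<otimes>\<^bsub>R\<^esub> x \<in> I"
  using ideal assms by (auto simp: two_sided_ideal_def)

lemma proj_closed [simp]: "x \<in> carrier R \<Longrightarrow> proj x \<in> carrier Q"
  by (simp add: carrier_Q a_rcosetsI[OF a_subset])

lemma proj_surj: "X \<in> carrier Q \<Longrightarrow> \<exists>x\<in>carrier R. X = proj x"
  by (auto simp: carrier_Q A_RCOSETS_def')

lemma proj_add: "\<lbrakk>x \<in> carrier R; y \<in> carrier R\<rbrakk> \<Longrightarrow> proj x \<oplus>\<^bsub>Q\<^esub> proj y = proj (x \<oplus>\<^bsub>R\<^esub> y)"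
  by (simp add: add_Q a_rcos_sum)

lemma proj_zero: "proj \<zero>\<^bsub>R\<^esub> = \<zero>\<^bsub>Q\<^esub>"
  by (simp add: zero_Q a_rcos_const)

lemma proj_eq_iff:
  assumes "x \<in> carrier R" "y \<in> carrier R" shows "proj x = proj y \<longleftrightarrow> x \<ominus>\<^bsub>R\<^esub> y \<in> I"
proof -
  have "proj x = proj y \<longleftrightarrow> x \<in> proj y"
    using assms a_rcos_self[of x] a_repr_independence'[of x y] by auto
  then show ?thesis using assms a_rcos_module[of y x] by (simp add: minus_eq)
qed

lemma proj_eq_zero_iff: "x \<in> carrier R \<Longrightarrow> proj x = \<zero>\<^bsub>Q\<^esub> \<longleftrightarrow> x \<in> I"
  using a_rcos_self[of x] a_rcos_const[of x] by (auto simp: zero_Q)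

lemma proj_mult:
  assumes [simp]: "x \<in> carrier R" "y \<in> carrier R"
  shows "proj x \<otimes>\<^bsub>Q\<^esub> proj y = proj (x \<otimes>\<^bsub>R\<^esub> y)"
proof -
  have *: "proj (a \<otimes>\<^bsub>R\<^esub> b) = proj (x \<otimes>\<^bsub>R\<^esub> y)" if a: "a \<in> proj x" and b: "b \<in> proj y" for a b
  proof -
    obtain i j where ij: "i \<in> I" "j \<in> I" "a = i \<oplus>\<^bsub>R\<^esub> x" "b = j \<oplus>\<^bsub>R\<^esub> y"
      using a b by (auto simp: a_r_coset_def')
    then have [simp]: "i \<in> carrier R" "j \<in> carrier R" by auto
    have "a \<otimes>\<^bsub>R\<^esub> b = (i \<otimes>\<^bsub>R\<^esub> (j \<oplus>\<^bsub>R\<^esub> y) \<oplus>\<^bsub>R\<^esub> x \<otimes>\<^bsub>R\<^esub> j) \<oplus>\<^bsub>R\<^esub> x \<otimes>\<^bsub>R\<^esub> y"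
      by (simp add: ij l_distr r_distr add.m_ac)
    also have "\<dots> \<in> proj (x \<otimes>\<^bsub>R\<^esub> y)"
      using ij by (auto simp: a_r_coset_def')
    finally show ?thesis using a_repr_independence'[of _ "x \<otimes>\<^bsub>R\<^esub> y"] by simp
  qed
  have "x \<in> proj x" "y \<in> proj y" by (simp_all add: a_rcos_self)
  moreover have "(\<Union>a\<in>proj x. \<Union>b\<in>proj y. proj (a \<otimes>\<^bsub>R\<^esub> b))
      = (\<Union>a\<in>proj x. \<Union>b\<in>proj y. proj (x \<otimes>\<^bsub>R\<^esub> y))"
    by (intro SUP_cong refl *)
  ultimately show ?thesis unfolding mult_Q rcoset_mult_def by auto
qed

lemma quotient_nonunital_ring: "nonunital_ring Q"
proof -
  have gr: "abelian_group Q"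
  proof (rule abelian_groupI)
    fix X Y Z assume "X \<in> carrier Q" "Y \<in> carrier Q" "Z \<in> carrier Q"
    then obtain x y z where "x \<in> carrier R" "y \<in> carrier R" "z \<in> carrier R"
      "X = proj x" "Y = proj y" "Z = proj z"
      using proj_surj[of X] proj_surj[of Y] proj_surj[of Z] by blast
    then show "X \<oplus>\<^bsub>Q\<^esub> Y \<oplus>\<^bsub>Q\<^esub> Z = X \<oplus>\<^bsub>Q\<^esub> (Y \<oplus>\<^bsub>Q\<^esub> Z)" "X \<oplus>\<^bsub>Q\<^esub> Y = Y \<oplus>\<^bsub>Q\<^esub> X"
      "X \<oplus>\<^bsub>Q\<^esub> Y \<in> carrier Q"
      by (simp_all add: proj_add add.m_ac)
  next
    have z: "\<zero>\<^bsub>Q\<^esub> = proj \<zero>\<^bsub>R\<^esub>" by (simp add: proj_zero)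
    then show "\<zero>\<^bsub>Q\<^esub> \<in> carrier Q" by simp
    fix X assume "X \<in> carrier Q"
    then obtain x where x: "x \<in> carrier R" "X = proj x" using proj_surj[of X] by blast
    then show "\<zero>\<^bsub>Q\<^esub> \<oplus>\<^bsub>Q\<^esub> X = X" by (simp add: z proj_add)
    show "\<exists>Y\<in>carrier Q. Y \<oplus>\<^bsub>Q\<^esub> X = \<zero>\<^bsub>Q\<^esub>"
      using x by (intro bexI[of _ "proj (\<ominus>\<^bsub>R\<^esub> x)"]) (simp_all add: z proj_add l_neg)
  qed
  show ?thesis
  proof (intro nonunital_ring.intro nonunital_ring_axioms.intro gr)
    fix X Y assume "X \<in> carrier Q" "Y \<in> carrier Q"
    then show "X \<otimes>\<^bsub>Q\<^esub> Y \<in> carrier Q"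
      using proj_surj[of X] proj_surj[of Y] proj_mult by force
  next
    fix X Y Z assume "X \<in> carrier Q" "Y \<in> carrier Q" "Z \<in> carrier Q"
    then obtain x y z where "x \<in> carrier R" "y \<in> carrier R" "z \<in> carrier R"
      "X = proj x" "Y = proj y" "Z = proj z"
      using proj_surj[of X] proj_surj[of Y] proj_surj[of Z] by blast
    then show "X \<otimes>\<^bsub>Q\<^esub> Y \<otimes>\<^bsub>Q\<^esub> Z = X \<otimes>\<^bsub>Q\<^esub> (Y \<otimes>\<^bsub>Q\<^esub> Z)"
      "(X \<oplus>\<^bsub>Q\<^esub> Y) \<otimes>\<^bsub>Q\<^esub> Z = X \<otimes>\<^bsub>Q\<^esub> Z \<oplus>\<^bsub>Q\<^esub> Y \<otimes>\<^bsub>Q\<^esub> Z"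
      "Z \<otimes>\<^bsub>Q\<^esub> (X \<oplus>\<^bsub>Q\<^esub> Y) = Z \<otimes>\<^bsub>Q\<^esub> X \<oplus>\<^bsub>Q\<^esub> Z \<otimes>\<^bsub>Q\<^esub> Y"
      by (simp_all add: proj_mult proj_add m_assoc l_distr r_distr)
  qed
qed

lemma proj_uminus:
  assumes "x \<in> carrier R" shows "proj (\<ominus>\<^bsub>R\<^esub> x) = \<ominus>\<^bsub>Q\<^esub> proj x"
proof -
  interpret S: nonunital_ring Q by (rule quotient_nonunital_ring)
  have "proj (\<ominus>\<^bsub>R\<^esub> x) \<oplus>\<^bsub>Q\<^esub> proj x = \<zero>\<^bsub>Q\<^esub>"
    using assms by (simp add: proj_add l_neg proj_zero)
  then show ?thesis using assms S.minus_equality by simp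
qed

lemma proj_minus:
  "\<lbrakk>x \<in> carrier R; y \<in> carrier R\<rbrakk> \<Longrightarrow> proj (x \<ominus>\<^bsub>R\<^esub> y) = proj x \<ominus>\<^bsub>Q\<^esub> proj y"
  by (simp add: a_minus_def proj_uminus flip: proj_add)

end

lemma ideal_quotient_FactRing:
  assumes "nonunital_ring R" "two_sided_ideal I R"
  shows "ideal_quotient R I (R Quot I)"
  using assms by (simp add: ideal_quotient_def ideal_quotient_axioms_def FactRing_def)

section \<open>Comparison of matrices and proper infiniteness\<close>

text \<open>This is Cuntz comparison of a two-by-two matrix with the one-by-one matrix \<open>x\<close>. The matrix \<open>M\<close> is
  read at the indices 1 and 2 only.\<close>

definition compressible_to :: "('a, 'm) ring_scheme \<Rightarrow> (nat \<Rightarrow> nat \<Rightarrow> 'a) \<Rightarrow> 'a \<Rightarrow> bool" where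
  "compressible_to R M x \<longleftrightarrow>
     (\<exists>\<alpha> \<beta>. (\<forall>i\<in>{1, 2}. \<alpha> i \<in> carrier R \<and> \<beta> i \<in> carrier R) \<and>
        (\<forall>i\<in>{1, 2}. \<forall>j\<in>{1, 2}. \<alpha> i \<otimes>\<^bsub>R\<^esub> x \<otimes>\<^bsub>R\<^esub> \<beta> j = M i j))"

lemma compressible_to_cong:
  assumes "\<And>i j. \<lbrakk>i \<in> {1, 2}; j \<in> {1, 2}\<rbrakk> \<Longrightarrow> M i j = N i j"
  shows "compressible_to R M x \<longleftrightarrow> compressible_to R N x"
  unfolding compressible_to_def
  by (intro ex_cong1 conj_cong ball_cong refl) (simp only: assms)

definition diag :: "('a, 'm) ring_scheme \<Rightarrow> 'a \<Rightarrow> 'a \<Rightarrow> nat \<Rightarrow> nat \<Rightarrow> 'a" where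
  "diag R x y = (\<lambda>i j. if i = j then if i = 1 then x else y else \<zero>\<^bsub>R\<^esub>)"

definition absorbed :: "('a, 'm) ring_scheme \<Rightarrow> 'a \<Rightarrow> 'a set" where
  "absorbed R x = {y \<in> carrier R. compressible_to R (diag R x y) x}"

lemma properly_infinite_iff:
  assumes "x \<in> carrier R"
  shows "properly_infinite R x \<longleftrightarrow> x \<noteq> \<zero>\<^bsub>R\<^esub> \<and> x \<in> absorbed R x"
proof -
  have *: "diag R x x i j = (if i = j then x else \<zero>\<^bsub>R\<^esub>)" for i j :: nat
    by (simp add: diag_def)
  show ?thesis
    unfolding properly_infinite_def absorbed_def compressible_to_def * mem_Collect_eq
    by (simp only: assms simp_thms)
qed

lemma compressible_toI:
  assumes "a \<in> carrier R" "b \<in> carrier R" "c \<in> carrier R" "d \<in> carrier R"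
    and "a \<otimes>\<^bsub>R\<^esub> x \<otimes>\<^bsub>R\<^esub> c = M 1 1" "a \<otimes>\<^bsub>R\<^esub> x \<otimes>\<^bsub>R\<^esub> d = M 1 2"
    and "b \<otimes>\<^bsub>R\<^esub> x \<otimes>\<^bsub>R\<^esub> c = M 2 1" "b \<otimes>\<^bsub>R\<^esub> x \<otimes>\<^bsub>R\<^esub> d = M 2 2"
  shows "compressible_to R M x"
  unfolding compressible_to_def
  using assms
  by (intro exI[of _ "\<lambda>i. if i = 1 then a else b"] exI[of _ "\<lambda>i. if i = 1 then c else d"]) auto

lemma absorbedE:
  assumes "y \<in> absorbed R x"
  obtains a b c d where "a \<in> carrier R" "b \<in> carrier R" "c \<in> carrier R" "d \<in> carrier R"
    "a \<otimes>\<^bsub>R\<^esub> x \<otimes>\<^bsub>R\<^esub> c = x" "a \<otimes>\<^bsub>R\<^esub> x \<otimes>\<^bsub>R\<^esub> d = \<zero>\<^bsub>R\<^esub>"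
    "b \<otimes>\<^bsub>R\<^esub> x \<otimes>\<^bsub>R\<^esub> c = \<zero>\<^bsub>R\<^esub>" "b \<otimes>\<^bsub>R\<^esub> x \<otimes>\<^bsub>R\<^esub> d = y"
proof -
  from assms have "compressible_to R (diag R x y) x" by (simp add: absorbed_def)
  then obtain \<alpha> \<beta> where \<alpha>\<beta>: "\<forall>i\<in>{1, 2}. \<alpha> i \<in> carrier R \<and> \<beta> i \<in> carrier R"
     "\<forall>i\<in>{1, 2}. \<forall>j\<in>{1, 2}. \<alpha> i \<otimes>\<^bsub>R\<^esub> x \<otimes>\<^bsub>R\<^esub> \<beta> j = diag R x y i j"
    unfolding compressible_to_def by (elim exE conjE)
  show ?thesis
    by (rule that[of "\<alpha> 1" "\<alpha> 2" "\<beta> 1" "\<beta> 2"]) (use \<alpha>\<beta> in \<open>simp_all add: diag_def\<close>)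
qed

context nonunital_ring
begin

text \<open>
  Since \<open>diag(x, y)\<close> is compressible to \<open>x\<close>, one first splits off a copy of \<open>y\<close> orthogonal to \<open>x\<close>,
  then produces \<open>M\<close> from \<open>x\<close> and adds the copy of \<open>y\<close> to the row \<open>k\<close> and the column \<open>l\<close>.
\<close>

lemma compressible_to_add_absorbed:
  assumes x: "x \<in> carrier R" and M: "compressible_to R M x" and y: "y \<in> absorbed R x"
    and kl: "k \<in> {1, 2}" "l \<in> {1, 2}"
  shows "compressible_to R (\<lambda>i j. M i j \<oplus> (if i = k \<and> j = l then y else \<zero>)) x"
proof -
  obtain \<alpha> \<beta> where ab: "\<forall>i\<in>{1, 2}. \<alpha> i \<in> carrier R \<and> \<beta> i \<in> carrier R"
     "\<forall>i\<in>{1, 2}. \<forall>j\<in>{1, 2}. \<alpha> i \<otimes> x \<otimes> \<beta> j = M i j"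
    using M unfolding compressible_to_def by (elim exE conjE)
  have \<alpha>\<beta>: "\<alpha> i \<in> carrier R" "\<beta> i \<in> carrier R" if "i \<in> {1, 2}" for i
    using ab(1) that by blast+
  have M: "\<alpha> i \<otimes> x \<otimes> \<beta> j = M i j" if "i \<in> {1, 2}" "j \<in> {1, 2}" for i j
    using ab(2) that by blast
  obtain a b c d where abcd [simp]: "a \<in> carrier R" "b \<in> carrier R" "c \<in> carrier R" "d \<in> carrier R"
    and eq: "a \<otimes> x \<otimes> c = x" "a \<otimes> x \<otimes> d = \<zero>" "b \<otimes> x \<otimes> c = \<zero>" "b \<otimes> x \<otimes> d = y"
    using y by (rule absorbedE)
  let ?\<alpha> = "\<lambda>i. \<alpha> i \<otimes> a \<oplus> (if i = k then b else \<zero>)"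
  let ?\<beta> = "\<lambda>j. c \<otimes> \<beta> j \<oplus> (if j = l then d else \<zero>)"
  have entries: "?\<alpha> i \<otimes> x \<otimes> ?\<beta> j = M i j \<oplus> (if i = k \<and> j = l then y else \<zero>)"
    if ij: "i \<in> {1, 2}" "j \<in> {1, 2}" for i j
  proof -
    define s where "s = (if i = k then b else \<zero>)"
    define t where "t = (if j = l then d else \<zero>)"
    have [simp]: "s \<in> carrier R" "t \<in> carrier R" "\<alpha> i \<in> carrier R" "\<beta> j \<in> carrier R" "x \<in> carrier R"
      using \<alpha>\<beta>[OF ij(1)] \<alpha>\<beta>[OF ij(2)] x by (simp_all add: s_def t_def)
    have s: "s \<otimes> x \<otimes> c = \<zero>" "a \<otimes> x \<otimes> t = \<zero>" "s \<otimes> x \<otimes> t = (if i = k \<and> j = l then y else \<zero>)"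
      using x by (auto simp: s_def t_def eq)
    have "(\<alpha> i \<otimes> a \<oplus> s) \<otimes> x \<otimes> (c \<otimes> \<beta> j \<oplus> t)
        = \<alpha> i \<otimes> (a \<otimes> x \<otimes> c) \<otimes> \<beta> j \<oplus> \<alpha> i \<otimes> (a \<otimes> x \<otimes> t) \<oplus> (s \<otimes> x \<otimes> c) \<otimes> \<beta> j \<oplus> s \<otimes> x \<otimes> t"
      by (simp add: ring_expand add.m_ac)
    also have "\<dots> = \<alpha> i \<otimes> x \<otimes> \<beta> j \<oplus> s \<otimes> x \<otimes> t"
      using M[OF ij] \<alpha>\<beta>(1)[OF ij(1)] \<alpha>\<beta>(2)[OF ij(2)] x by (simp add: s(1,2) eq flip: M[OF ij])
    finally show ?thesis
      using M[OF ij] s(3) by (simp add: s_def t_def)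
  qed
  have closed: "?\<alpha> i \<in> carrier R \<and> ?\<beta> i \<in> carrier R" if "i \<in> {1, 2}" for i
    using \<alpha>\<beta>[OF that] by simp
  show ?thesis
    unfolding compressible_to_def
  proof (rule exI[of _ ?\<alpha>], rule exI[of _ ?\<beta>], intro conjI ballI)
  qed (use closed entries in simp_all)
qed

text \<open>Whether \<open>M\<close> is compressible to \<open>x\<close> depends only on the entries of \<open>M\<close> modulo the absorbed
  elements: the four entries are corrected one after the other.\<close>

lemma compressible_to_cong_absorbed:
  assumes x: "x \<in> carrier R" and M: "compressible_to R M x"
    and D: "\<And>i j. \<lbrakk>i \<in> {1, 2}; j \<in> {1, 2}\<rbrakk> \<Longrightarrow> N i j \<ominus> M i j \<in> absorbed R x"
    and cl: "\<And>i j. \<lbrakk>i \<in> {1, 2}; j \<in> {1, 2}\<rbrakk> \<Longrightarrow> M i j \<in> carrier R \<and> N i j \<in> carrier R"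
  shows "compressible_to R N x"
proof -
  have *: "M i j \<oplus> (N i j \<ominus> M i j) = N i j" if "i \<in> {1, 2}" "j \<in> {1, 2}" for i j
  proof -
    have "M i j \<oplus> (N i j \<oplus> \<ominus> M i j) = (M i j \<oplus> \<ominus> M i j) \<oplus> N i j"
      using cl[OF that] by (simp add: add.m_ac del: r_neg)
    then show ?thesis using cl[OF that] by (simp add: minus_eq r_neg)
  qed
  have cl': "N i j \<ominus> M i j \<in> carrier R" if "i \<in> {1, 2}" "j \<in> {1, 2}" for i j
    using cl[OF that] by simp
  let ?d = "\<lambda>k l i j. if i = k \<and> j = l then N k l \<ominus> M k l else \<zero>"
  have "compressible_to R (\<lambda>i j. M i j \<oplus> ?d 1 1 i j \<oplus> ?d 1 2 i j \<oplus> ?d 2 1 i j \<oplus> ?d 2 2 i j) x"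
    by (intro compressible_to_add_absorbed x M D) simp_all
  also have "?this \<longleftrightarrow> ?thesis"
  proof (rule compressible_to_cong)
    fix i j :: nat assume ij: "i \<in> {1, 2}" "j \<in> {1, 2}"
    show "M i j \<oplus> ?d 1 1 i j \<oplus> ?d 1 2 i j \<oplus> ?d 2 1 i j \<oplus> ?d 2 2 i j = N i j"
      using ij *[OF ij] cl[OF ij] cl'[OF ij] by auto
  qed
  finally show ?thesis .
qed

lemma absorbedI:
  assumes "x \<in> carrier R" "a \<in> carrier R" "b \<in> carrier R" "c \<in> carrier R" "d \<in> carrier R"
    and "a \<otimes> x \<otimes> c = x" "a \<otimes> x \<otimes> d = \<zero>" "b \<otimes> x \<otimes> c = \<zero>" "b \<otimes> x \<otimes> d = y"
  shows "y \<in> absorbed R x"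
proof -
  have "compressible_to R (diag R x y) x"
    using assms by (intro compressible_toI[of a R b c d]) (simp_all add: diag_def)
  then show ?thesis using assms by (auto simp: absorbed_def)
qed

text \<open>Sums are obtained by adding the second absorbed element in the lower right corner. For multiples
  the second row of the compression, or its second column, is multiplied accordingly. The local units
  of \<open>x\<close> show that \<open>0\<close> is absorbed.\<close>

lemma two_sided_ideal_absorbed:
  assumes x [simp]: "x \<in> carrier R"
    and uv: "u \<in> carrier R" "v \<in> carrier R" "u \<otimes> x = x" "x \<otimes> v = x"
  shows "two_sided_ideal (absorbed R x) R"
proof (rule two_sided_idealI)
  show "absorbed R x \<subseteq> carrier R" by (auto simp: absorbed_def)
  show "\<zero> \<in> absorbed R x"
    using uv by (intro absorbedI[of x u \<zero> v \<zero>]) simp_all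
next
  fix y z assume y: "y \<in> absorbed R x" and z: "z \<in> absorbed R x"
  then have [simp]: "y \<in> carrier R" "z \<in> carrier R" by (auto simp: absorbed_def)
  have "compressible_to R (\<lambda>i j. diag R x y i j \<oplus> (if i = 2 \<and> j = 2 then z else \<zero>)) x"
    using y z by (intro compressible_to_add_absorbed) (simp_all add: absorbed_def)
  also have "?this \<longleftrightarrow> compressible_to R (diag R x (y \<oplus> z)) x"
    by (rule compressible_to_cong) (auto simp: diag_def)
  finally have "compressible_to R (diag R x (y \<oplus> z)) x" .
  then show "y \<oplus> z \<in> absorbed R x" by (simp add: absorbed_def)
next
  fix y assume "y \<in> absorbed R x"
  then obtain a b c d where [simp]: "a \<in> carrier R" "b \<in> carrier R" "c \<in> carrier R" "d \<in> carrier R"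
    and eq: "a \<otimes> x \<otimes> c = x" "a \<otimes> x \<otimes> d = \<zero>" "b \<otimes> x \<otimes> c = \<zero>" "b \<otimes> x \<otimes> d = y"
    by (rule absorbedE)
  show "\<ominus> y \<in> absorbed R x"
    by (rule absorbedI[of x a "\<ominus> b" c d]) (simp_all add: l_minus eq)
  fix s assume [simp]: "s \<in> carrier R"
  have sb: "s \<otimes> b \<otimes> x \<otimes> t = s \<otimes> (b \<otimes> x \<otimes> t)" "t \<otimes> x \<otimes> (d \<otimes> s) = (t \<otimes> x \<otimes> d) \<otimes> s"
    if "t \<in> carrier R" for t
    using that by (simp_all add: m_assoc)
  show "s \<otimes> y \<in> absorbed R x"
    by (rule absorbedI[of x a "s \<otimes> b" c d]) (simp_all add: sb eq)
  show "y \<otimes> s \<in> absorbed R x"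
    by (rule absorbedI[of x a b c "d \<otimes> s"]) (simp_all add: sb eq)
qed (rule abelian_group_axioms)


text \<open>
  Suppose that \<open>x\<close> compresses to an idempotent \<open>f\<close> which is itself the sum of two orthogonal copies
  of \<open>f\<close> and a remainder. Put \<open>q = x w u\<close> and \<open>p = w u x\<close>. These are idempotents with
  \<open>q x = x p\<close>, and \<open>q x\<close> is a copy of \<open>f\<close>. The corner of \<open>x\<close> complementary to \<open>q x\<close> is left
  alone, and \<open>q x\<close> is replaced by the first copy of \<open>f\<close>; this frees the second copy.
\<close>

lemma split_off_idempotent:
  assumes [simp]: "x \<in> carrier R" "u \<in> carrier R" "w \<in> carrier R" "f \<in> carrier R"
      "s1 \<in> carrier R" "t1 \<in> carrier R" "s2 \<in> carrier R" "t2 \<in> carrier R"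
      "l \<in> carrier R" "r \<in> carrier R"
    and units: "l \<otimes> x = x" "x \<otimes> r = x"
    and f: "u \<otimes> x \<otimes> w = f" "f \<otimes> u = u" "w \<otimes> f = w"
    and st: "s1 \<otimes> f \<otimes> t1 = f" "s2 \<otimes> f \<otimes> t2 = f" "s1 \<otimes> f \<otimes> t2 = \<zero>" "s2 \<otimes> f \<otimes> t1 = \<zero>"
    and \<alpha>: "\<alpha> = l \<oplus> (x \<otimes> w \<otimes> s1 \<otimes> u \<ominus> x \<otimes> w \<otimes> u)"
    and \<beta>: "\<beta> = r \<oplus> (w \<otimes> t1 \<otimes> u \<otimes> x \<ominus> w \<otimes> u \<otimes> x)"
  shows "\<alpha> \<otimes> x \<otimes> \<beta> = x" "\<alpha> \<otimes> x \<otimes> (w \<otimes> t2) = \<zero>"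
    "(s2 \<otimes> u) \<otimes> x \<otimes> \<beta> = \<zero>" "(s2 \<otimes> u) \<otimes> x \<otimes> (w \<otimes> t2) = f"
proof -
  define y where "y = u \<otimes> x"
  define z where "z = x \<otimes> w"
  have [simp]: "y \<in> carrier R" "z \<in> carrier R" by (simp_all add: y_def z_def)
  have yw: "y \<otimes> w = f" and zf: "z \<otimes> f = z" and fy: "f \<otimes> y = y"
    using f by (simp_all add: y_def z_def m_assoc) (simp_all flip: m_assoc)
  have \<alpha>x: "\<alpha> \<otimes> x = x \<oplus> (z \<otimes> (s1 \<otimes> y) \<ominus> z \<otimes> y)"
    by (simp add: \<alpha> y_def z_def ring_expand units)
  have [simp]: "\<alpha> \<in> carrier R" "\<beta> \<in> carrier R" by (simp_all add: \<alpha> \<beta>)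
  have \<alpha>xw: "\<alpha> \<otimes> x \<otimes> w = z \<otimes> (s1 \<otimes> f)"
  proof -
    have "\<alpha> \<otimes> x \<otimes> w = z \<oplus> (z \<otimes> (s1 \<otimes> (y \<otimes> w)) \<ominus> z \<otimes> (y \<otimes> w))"
      by (simp add: \<alpha>x ring_expand flip: z_def)
    also have "\<dots> = z \<otimes> (s1 \<otimes> f)"
      by (simp add: yw zf minus_eq add.m_ac r_neg r_neg1 r_neg2)
    finally show ?thesis .
  qed
  have yx: "y \<otimes> \<beta> = f \<otimes> (t1 \<otimes> y)"
  proof -
    have "y \<otimes> \<beta> = y \<oplus> (y \<otimes> w \<otimes> (t1 \<otimes> y) \<ominus> y \<otimes> w \<otimes> y)"
      using units by (simp add: \<beta> y_def ring_expand)
    also have "\<dots> = f \<otimes> (t1 \<otimes> y)"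
      by (simp add: yw fy minus_eq add.m_ac r_neg r_neg1 r_neg2)
    finally show ?thesis .
  qed
  have "\<alpha> \<otimes> x \<otimes> \<beta> = \<alpha> \<otimes> x \<oplus> (\<alpha> \<otimes> x \<otimes> w \<otimes> (t1 \<otimes> y) \<ominus> \<alpha> \<otimes> x \<otimes> w \<otimes> y)"
    using units by (simp add: \<beta> y_def ring_expand)
  also have "\<alpha> \<otimes> x \<otimes> w \<otimes> (t1 \<otimes> y) = z \<otimes> (s1 \<otimes> f \<otimes> t1) \<otimes> y"
    by (simp add: \<alpha>xw m_assoc)
  also have "\<alpha> \<otimes> x \<otimes> w \<otimes> y = z \<otimes> (s1 \<otimes> y)"
    by (simp add: \<alpha>xw m_assoc fy)
  finally show "\<alpha> \<otimes> x \<otimes> \<beta> = x"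
    by (simp add: \<alpha>x st zf minus_eq add.m_ac r_neg r_neg1 r_neg2)
  have "\<alpha> \<otimes> x \<otimes> (w \<otimes> t2) = z \<otimes> (s1 \<otimes> f \<otimes> t2)"
    by (simp add: \<alpha>xw m_assoc flip: m_assoc[of _ w])
  then show "\<alpha> \<otimes> x \<otimes> (w \<otimes> t2) = \<zero>" by (simp add: st)
  have "(s2 \<otimes> u) \<otimes> x \<otimes> \<beta> = s2 \<otimes> (y \<otimes> \<beta>)" by (simp add: y_def m_assoc)
  also have "\<dots> = (s2 \<otimes> f \<otimes> t1) \<otimes> y" by (simp add: yx m_assoc)
  finally show "(s2 \<otimes> u) \<otimes> x \<otimes> \<beta> = \<zero>" by (simp add: st)
  have "(s2 \<otimes> u) \<otimes> x \<otimes> (w \<otimes> t2) = s2 \<otimes> (u \<otimes> x \<otimes> w) \<otimes> t2" by (simp add: m_assoc)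
  then show "(s2 \<otimes> u) \<otimes> x \<otimes> (w \<otimes> t2) = f" by (simp add: f st)
qed

text \<open>The previous lemma applies in the quotient \<open>R/J\<close> by the ideal \<open>J\<close> of absorbed elements. Lifting its
  coefficients to \<open>R\<close> yields \<open>diag(x, f)\<close> up to entries in \<open>J\<close>, and these can be corrected.\<close>

lemma absorbs_idempotent_modulo_absorbed:
  assumes [simp]: "x \<in> carrier R" "u \<in> carrier R" "w \<in> carrier R" "f \<in> carrier R"
      "s1 \<in> carrier R" "t1 \<in> carrier R" "s2 \<in> carrier R" "t2 \<in> carrier R"
      "l \<in> carrier R" "r \<in> carrier R"
    and units: "l \<otimes> x = x" "x \<otimes> r = x"
    and f: "u \<otimes> x \<otimes> w \<ominus> f \<in> absorbed R x" "f \<otimes> u \<ominus> u \<in> absorbed R x" "w \<otimes> f \<ominus> w \<in> absorbed R x"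
    and st: "s1 \<otimes> f \<otimes> t1 \<ominus> f \<in> absorbed R x" "s2 \<otimes> f \<otimes> t2 \<ominus> f \<in> absorbed R x"
      "s1 \<otimes> f \<otimes> t2 \<in> absorbed R x" "s2 \<otimes> f \<otimes> t1 \<in> absorbed R x"
  shows "f \<in> absorbed R x"
proof -
  let ?J = "absorbed R x"
  define Q where "Q = R Quot ?J"
  interpret Q: ideal_quotient R ?J Q
    unfolding Q_def
    by (intro ideal_quotient_FactRing two_sided_ideal_absorbed[of x l r] units nonunital_ring_axioms) simp_all
  interpret S: nonunital_ring Q by (rule Q.quotient_nonunital_ring)
  let ?p = Q.proj
  have eqs: "?p u \<otimes>\<^bsub>Q\<^esub> ?p x \<otimes>\<^bsub>Q\<^esub> ?p w = ?p f" "?p f \<otimes>\<^bsub>Q\<^esub> ?p u = ?p u" "?p w \<otimes>\<^bsub>Q\<^esub> ?p f = ?p w"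
    "?p s1 \<otimes>\<^bsub>Q\<^esub> ?p f \<otimes>\<^bsub>Q\<^esub> ?p t1 = ?p f" "?p s2 \<otimes>\<^bsub>Q\<^esub> ?p f \<otimes>\<^bsub>Q\<^esub> ?p t2 = ?p f"
    "?p s1 \<otimes>\<^bsub>Q\<^esub> ?p f \<otimes>\<^bsub>Q\<^esub> ?p t2 = \<zero>\<^bsub>Q\<^esub>" "?p s2 \<otimes>\<^bsub>Q\<^esub> ?p f \<otimes>\<^bsub>Q\<^esub> ?p t1 = \<zero>\<^bsub>Q\<^esub>"
    "?p l \<otimes>\<^bsub>Q\<^esub> ?p x = ?p x" "?p x \<otimes>\<^bsub>Q\<^esub> ?p r = ?p x"
    using f st units by (simp_all add: Q.proj_mult Q.proj_eq_iff Q.proj_eq_zero_iff)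
  define \<alpha> where "\<alpha> = l \<oplus> (x \<otimes> w \<otimes> s1 \<otimes> u \<ominus> x \<otimes> w \<otimes> u)"
  define \<beta> where "\<beta> = r \<oplus> (w \<otimes> t1 \<otimes> u \<otimes> x \<ominus> w \<otimes> u \<otimes> x)"
  have [simp]: "\<alpha> \<in> carrier R" "\<beta> \<in> carrier R" by (simp_all add: \<alpha>_def \<beta>_def)
  have \<alpha>': "?p \<alpha> = ?p l \<oplus>\<^bsub>Q\<^esub> (?p x \<otimes>\<^bsub>Q\<^esub> ?p w \<otimes>\<^bsub>Q\<^esub> ?p s1 \<otimes>\<^bsub>Q\<^esub> ?p u \<ominus>\<^bsub>Q\<^esub> ?p x \<otimes>\<^bsub>Q\<^esub> ?p w \<otimes>\<^bsub>Q\<^esub> ?p u)"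
    and \<beta>': "?p \<beta> = ?p r \<oplus>\<^bsub>Q\<^esub> (?p w \<otimes>\<^bsub>Q\<^esub> ?p t1 \<otimes>\<^bsub>Q\<^esub> ?p u \<otimes>\<^bsub>Q\<^esub> ?p x \<ominus>\<^bsub>Q\<^esub> ?p w \<otimes>\<^bsub>Q\<^esub> ?p u \<otimes>\<^bsub>Q\<^esub> ?p x)"
    by (simp_all add: \<alpha>_def \<beta>_def Q.proj_mult Q.proj_add flip: Q.proj_minus)
  note split = S.split_off_idempotent[OF _ _ _ _ _ _ _ _ _ _ eqs(8,9,1-7) \<alpha>' \<beta>', simplified]
  have split': "?p (\<alpha> \<otimes> x \<otimes> \<beta>) = ?p x" "?p (\<alpha> \<otimes> x \<otimes> (w \<otimes> t2)) = \<zero>\<^bsub>Q\<^esub>"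
    "?p ((s2 \<otimes> u) \<otimes> x \<otimes> \<beta>) = \<zero>\<^bsub>Q\<^esub>" "?p ((s2 \<otimes> u) \<otimes> x \<otimes> (w \<otimes> t2)) = ?p f"
    using split by (simp_all add: Q.proj_mult)
  let ?a = "\<lambda>i::nat. if i = 1 then \<alpha> else s2 \<otimes> u"
  let ?b = "\<lambda>i::nat. if i = 1 then \<beta> else w \<otimes> t2"
  have M: "compressible_to R (\<lambda>i j. ?a i \<otimes> x \<otimes> ?b j) x"
    unfolding compressible_to_def by (intro exI[of _ ?a] exI[of _ ?b]) simp
  have "compressible_to R (diag R x f) x"
  proof (rule compressible_to_cong_absorbed[OF _ M])
    fix i j :: nat assume "i \<in> {1, 2}" "j \<in> {1, 2}"
    then have "?p (diag R x f i j) = ?p (?a i \<otimes> x \<otimes> ?b j)"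
      by (elim insertE emptyE) (simp_all add: diag_def Q.proj_zero split')
    moreover have "diag R x f i j \<in> carrier R" "?a i \<otimes> x \<otimes> ?b j \<in> carrier R"
      by (simp_all add: diag_def)
    ultimately show "diag R x f i j \<ominus> ?a i \<otimes> x \<otimes> ?b j \<in> ?J"
      by (simp only: Q.proj_eq_iff)
  qed (auto simp: diag_def)
  then show ?thesis unfolding absorbed_def using \<open>f \<in> carrier R\<close> by blast
qed

end

section \<open>Sums and local units in nonunital rings\<close>

context nonunital_ring
begin

text \<open>Units for single elements combine to units for finite sets.\<close>

lemma common_left_unit:
  assumes "s_unital R" "finite S" "S \<subseteq> carrier R"
  shows "\<exists>u\<in>carrier R. \<forall>x\<in>S. u \<otimes> x = x"
  using assms(2,3)
proof (induction rule: finite_induct)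
  case empty
  show ?case by (intro bexI[of _ \<zero>]) simp_all
next
  case (insert y S)
  then obtain u where u [simp]: "u \<in> carrier R" and uS: "\<forall>x\<in>S. u \<otimes> x = x" by auto
  have y [simp]: "y \<in> carrier R" using insert by simp
  obtain u' where u' [simp]: "u' \<in> carrier R" and u'y: "u' \<otimes> (y \<ominus> u \<otimes> y) = y \<ominus> u \<otimes> y"
    using assms(1)[unfolded s_unital_def, rule_format, of "y \<ominus> u \<otimes> y"] by auto
  \<comment> \<open>\<open>1 - (1 - u') (1 - u)\<close> fixes what \<open>u\<close> fixes, and it fixes \<open>y\<close>.\<close>
  let ?v = "u \<oplus> (u' \<ominus> u' \<otimes> u)"
  have "?v \<otimes> x = u \<otimes> x \<oplus> u' \<otimes> (x \<ominus> u \<otimes> x)" if "x \<in> carrier R" for x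
    using that by (simp add: ring_expand)
  moreover have "u \<otimes> y \<oplus> (y \<ominus> u \<otimes> y) = y"
    by (simp add: minus_eq add.m_ac r_neg r_neg1 r_neg2)
  ultimately have "?v \<otimes> x = x" if "x \<in> insert y S" for x
    using that insert uS u'y by (auto simp: minus_eq r_neg)
  then show ?case by (intro bexI[of _ ?v]) auto
qed

lemma common_right_unit:
  assumes "s_unital R" "finite S" "S \<subseteq> carrier R"
  shows "\<exists>u\<in>carrier R. \<forall>x\<in>S. x \<otimes> u = x"
  using assms(2,3)
proof (induction rule: finite_induct)
  case empty
  show ?case by (intro bexI[of _ \<zero>]) simp_all
next
  case (insert y S)
  then obtain u where u [simp]: "u \<in> carrier R" and uS: "\<forall>x\<in>S. x \<otimes> u = x" by auto
  have y [simp]: "y \<in> carrier R" using insert by simp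
  obtain u' where u' [simp]: "u' \<in> carrier R" and u'y: "(y \<ominus> y \<otimes> u) \<otimes> u' = y \<ominus> y \<otimes> u"
    using assms(1)[unfolded s_unital_def, rule_format, of "y \<ominus> y \<otimes> u"] by auto
  let ?v = "u \<oplus> (u' \<ominus> u \<otimes> u')"
  have "x \<otimes> ?v = x \<otimes> u \<oplus> (x \<ominus> x \<otimes> u) \<otimes> u'" if "x \<in> carrier R" for x
    using that by (simp add: ring_expand)
  moreover have "y \<otimes> u \<oplus> (y \<ominus> y \<otimes> u) = y"
    by (simp add: minus_eq add.m_ac r_neg r_neg1 r_neg2)
  ultimately have "x \<otimes> ?v = x" if "x \<in> insert y S" for x
    using that insert uS u'y by (auto simp: minus_eq r_neg)
  then show ?case by (intro bexI[of _ ?v]) auto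
qed

primrec list_sum :: "('i \<Rightarrow> 'a) \<Rightarrow> 'i list \<Rightarrow> 'a" where
  "list_sum h [] = \<zero>"
| "list_sum h (i # ks) = h i \<oplus> list_sum h ks"

lemma list_sum_closed [simp]:
  "(\<And>i. i \<in> set ks \<Longrightarrow> h i \<in> carrier R) \<Longrightarrow> list_sum h ks \<in> carrier R"
  by (induction "ks") auto

lemma list_sum_zero: "(\<And>i. i \<in> set ks \<Longrightarrow> h i = \<zero>) \<Longrightarrow> list_sum h ks = \<zero>"
  by (induction "ks") auto

lemma list_sum_append:
  "\<lbrakk>\<And>i. i \<in> set ks \<union> set ks' \<Longrightarrow> h i \<in> carrier R\<rbrakk>
    \<Longrightarrow> list_sum h (ks @ ks') = list_sum h ks \<oplus> list_sum h ks'"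
  by (induction ks) (auto simp: a_assoc)

lemma list_sum_mult_right:
  "\<lbrakk>\<And>i. i \<in> set ks \<Longrightarrow> h i \<in> carrier R; y \<in> carrier R\<rbrakk>
    \<Longrightarrow> list_sum h ks \<otimes> y = list_sum (\<lambda>i. h i \<otimes> y) ks"
  by (induction "ks") (auto simp: l_distr)

lemma list_sum_mult_left:
  "\<lbrakk>\<And>i. i \<in> set ks \<Longrightarrow> h i \<in> carrier R; y \<in> carrier R\<rbrakk>
    \<Longrightarrow> y \<otimes> list_sum h ks = list_sum (\<lambda>i. y \<otimes> h i) ks"
  by (induction "ks") (auto simp: r_distr)

lemma finsum_in_closed_set:
  assumes "\<zero> \<in> N" "N \<subseteq> carrier R" "\<And>x y. \<lbrakk>x \<in> N; y \<in> N\<rbrakk> \<Longrightarrow> x \<oplus> y \<in> N"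
    and "finite F" "\<And>i. i \<in> F \<Longrightarrow> h i \<in> N"
  shows "finsum R h F \<in> N"
  using assms(4,5)
proof (induction rule: finite_induct)
  case empty
  then show ?case using assms(1) by simp
next
  case (insert i F)
  have "h j \<in> carrier R" if "j \<in> insert i F" for j using insert.prems that assms(2) by blast
  then show ?case using insert assms(3) by (subst finsum_insert) auto
qed

end

section \<open>A branching vertex reached from everywhere\<close>

text \<open>
  A cycle has an exit, so some vertex \<open>w\<close> on it emits two edges. The vertices from which \<open>w\<close> cannot be
  reached form a hereditary set, and a saturated one because \<open>w\<close> itself can return to \<open>w\<close> along the
  cycle. It does not contain \<open>w\<close>, hence it is empty.
\<close>

lemma (in wf_digraph) branching_vertex_reached_from_everywhere:
  assumes "verts G \<noteq> {}"
    and minimal: "\<forall>H. H \<subseteq> verts G \<and> hereditary G H \<and> saturated G H \<longrightarrow> H = {} \<or> H = verts G"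
    and exits: "\<forall>p. cycle p \<longrightarrow> (\<exists>e. is_exit G e p)"
    and connects: "\<forall>v\<in>verts G. connects_to_cycle G v"
  shows "\<exists>w e f. w \<in> verts G \<and> e \<in> out_arcs G w \<and> f \<in> out_arcs G w \<and> e \<noteq> f \<and>
    (\<forall>v\<in>verts G. v \<rightarrow>\<^sup>* w)"
proof -
  obtain p where p: "cycle p"
    using assms(1) connects by (auto simp: connects_to_cycle_def)
  then obtain f i where f: "f \<in> arcs G" "i < length p" "tail G f = tail G (p ! i)" "f \<noteq> p ! i"
    using exits by (auto simp: is_exit_def)
  let ?e = "p ! i" and ?w = "tail G (p ! i)"
  obtain u where u: "awalk u p u" using p by (auto simp: cycle_def)
  have p_split: "p = take i p @ ?e # drop (Suc i) p" using f(2) by (simp add: id_take_nth_drop)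
  have "awalk u (take i p @ ?e # drop (Suc i) p) u" using u p_split by simp
  then have walks: "awalk u (take i p) ?w" "awalk (head G ?e) (drop (Suc i) p) u" "?e \<in> arcs G"
    by (auto simp: awalk_Cons_iff simp del: append_take_drop_id)
  then have returns: "head G ?e \<rightarrow>\<^sup>* ?w" by (meson awalk_appendI reachable_awalk)
  have w: "?w \<in> verts G" using walks by simp
  let ?H = "{v \<in> verts G. \<not> v \<rightarrow>\<^sup>* ?w}"
  have "hereditary G ?H"
    unfolding hereditary_def by (auto intro: reachable_trans dest: reachable_in_verts)
  moreover have "saturated G ?H"
    unfolding saturated_def
  proof (intro ballI impI)
    fix v assume v: "v \<in> verts G" and vH: "out_arcs G v \<noteq> {} \<and> head G ` out_arcs G v \<subseteq> ?H"
    have "\<not> v \<rightarrow>\<^sup>* ?w"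
    proof
      assume "v \<rightarrow>\<^sup>* ?w"
      then obtain q where q: "awalk v q ?w" by (auto simp: reachable_awalk)
      \<comment> \<open>If the walk is trivial then \<open>v\<close> lies on the cycle and \<open>?e\<close> is the first step back to it.\<close>
      have "\<exists>a\<in>out_arcs G v. head G a \<rightarrow>\<^sup>* ?w"
      proof (cases q)
        case Nil
        then show ?thesis using q walks returns by (auto simp: awalk_Nil_iff)
      next
        case (Cons a q')
        then show ?thesis using q by (auto simp: awalk_Cons_iff reachable_awalk)
      qed
      then show False using vH by auto
    qed
    then show "v \<in> ?H" using v by simp
  qed
  moreover have "?w \<notin> ?H" using w by simp
  ultimately have "?H = {}" using minimal[rule_format, of ?H] w by auto
  then have "\<forall>v\<in>verts G. v \<rightarrow>\<^sup>* ?w" by blast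
  moreover have "?e \<in> out_arcs G ?w" "f \<in> out_arcs G ?w" using f(1,3) walks(3) by simp_all
  ultimately show ?thesis using w f(4) by metis
qed

section \<open>Leavitt path algebras with coefficients\<close>

text \<open>Only nonempty words denote monomials, since there is no unit to serve as the empty product.\<close>

fun monomial :: "('l, 'm) ring_scheme \<Rightarrow> ('x \<Rightarrow> 'l) \<Rightarrow> 'x list \<Rightarrow> 'l" where
  "monomial L g [] = \<zero>\<^bsub>L\<^esub>"
| "monomial L g [x] = g x"
| "monomial L g (x # y # ys) = g x \<otimes>\<^bsub>L\<^esub> monomial L g (y # ys)"

text \<open>The locale describes a ring \<open>R\<close> with a biadditive and multiplicative map \<open>\<tau>\<close> (the tensors
  \<open>a \<otimes> l\<close>) from \<open>A\<close> and a ring \<open>L\<close> which contains the vertices, edges and ghost edges of \<open>E\<close>. Induction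
  over \<open>R\<close> says that the tensors of coefficients with monomials generate \<open>R\<close> additively; the scalars of
  the field have been absorbed into the coefficients.\<close>

locale leavitt_tensor = wf_digraph E + A: nonunital_ring A + L: nonunital_ring L + R: nonunital_ring R
  for E :: "('v, 'e) pre_digraph" and A :: "('a, 'm) ring_scheme"
    and L :: "('l, 'n) ring_scheme" and R :: "('r, 'p) ring_scheme" +
  fixes g :: "('v, 'e) leavitt_gen \<Rightarrow> 'l" and \<tau> :: "'a \<Rightarrow> 'l \<Rightarrow> 'r"
  assumes gen_closed: "x \<in> leavitt_gens E \<Longrightarrow> g x \<in> carrier L"
    and vertex_vertex: "\<lbrakk>v \<in> verts E; w \<in> verts E\<rbrakk> \<Longrightarrow>
      g (Vertex v) \<otimes>\<^bsub>L\<^esub> g (Vertex w) = (if v = w then g (Vertex v) else \<zero>\<^bsub>L\<^esub>)"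
    and tail_edge: "e \<in> arcs E \<Longrightarrow> g (Vertex (tail E e)) \<otimes>\<^bsub>L\<^esub> g (Edge e) = g (Edge e)"
    and edge_head: "e \<in> arcs E \<Longrightarrow> g (Edge e) \<otimes>\<^bsub>L\<^esub> g (Vertex (head E e)) = g (Edge e)"
    and head_ghost: "e \<in> arcs E \<Longrightarrow> g (Vertex (head E e)) \<otimes>\<^bsub>L\<^esub> g (Ghost e) = g (Ghost e)"
    and ghost_tail: "e \<in> arcs E \<Longrightarrow> g (Ghost e) \<otimes>\<^bsub>L\<^esub> g (Vertex (tail E e)) = g (Ghost e)"
    and ghost_edge: "\<lbrakk>e \<in> arcs E; f \<in> arcs E\<rbrakk> \<Longrightarrow>
      g (Ghost e) \<otimes>\<^bsub>L\<^esub> g (Edge f) = (if e = f then g (Vertex (head E e)) else \<zero>\<^bsub>L\<^esub>)"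
    and vertex_sum: "\<lbrakk>v \<in> verts E; out_arcs E v \<noteq> {}\<rbrakk> \<Longrightarrow>
      g (Vertex v) = (\<Oplus>\<^bsub>L\<^esub>e\<in>out_arcs E v. g (Edge e) \<otimes>\<^bsub>L\<^esub> g (Ghost e))"
    and tensor_closed [simp]: "\<lbrakk>a \<in> carrier A; l \<in> carrier L\<rbrakk> \<Longrightarrow> \<tau> a l \<in> carrier R"
    and tensor_add_left: "\<lbrakk>a \<in> carrier A; b \<in> carrier A; l \<in> carrier L\<rbrakk> \<Longrightarrow>
      \<tau> (a \<oplus>\<^bsub>A\<^esub> b) l = \<tau> a l \<oplus>\<^bsub>R\<^esub> \<tau> b l"
    and tensor_add_right: "\<lbrakk>a \<in> carrier A; l \<in> carrier L; m \<in> carrier L\<rbrakk> \<Longrightarrow>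
      \<tau> a (l \<oplus>\<^bsub>L\<^esub> m) = \<tau> a l \<oplus>\<^bsub>R\<^esub> \<tau> a m"
    and tensor_mult: "\<lbrakk>a \<in> carrier A; b \<in> carrier A; l \<in> carrier L; m \<in> carrier L\<rbrakk> \<Longrightarrow>
      \<tau> a l \<otimes>\<^bsub>R\<^esub> \<tau> b m = \<tau> (a \<otimes>\<^bsub>A\<^esub> b) (l \<otimes>\<^bsub>L\<^esub> m)"
    and tensor_induct: "\<lbrakk>z \<in> carrier R; Q \<zero>\<^bsub>R\<^esub>;
      \<And>a ms. \<lbrakk>a \<in> carrier A; set ms \<subseteq> leavitt_gens E; ms \<noteq> []\<rbrakk> \<Longrightarrow> Q (\<tau> a (monomial L g ms));
      \<And>x y. \<lbrakk>x \<in> carrier R; y \<in> carrier R; Q x; Q y\<rbrakk> \<Longrightarrow> Q (x \<oplus>\<^bsub>R\<^esub> y)\<rbrakk> \<Longrightarrow> Q z"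
begin

abbreviation vx where "vx v \<equiv> g (Vertex v)"

lemma generators_closed [simp]:
  "v \<in> verts E \<Longrightarrow> g (Vertex v) \<in> carrier L"
  "e \<in> arcs E \<Longrightarrow> g (Edge e) \<in> carrier L"
  "e \<in> arcs E \<Longrightarrow> g (Ghost e) \<in> carrier L"
  by (auto intro!: gen_closed simp: leavitt_gens_def)

lemma monomial_closed [simp]:
  "set ms \<subseteq> leavitt_gens E \<Longrightarrow> monomial L g ms \<in> carrier L"
  by (induction ms rule: induct_list012) (auto simp: gen_closed)

lemma tensor_zero_right [simp]: "a \<in> carrier A \<Longrightarrow> \<tau> a \<zero>\<^bsub>L\<^esub> = \<zero>\<^bsub>R\<^esub>"
  using tensor_add_right[of a "\<zero>\<^bsub>L\<^esub>" "\<zero>\<^bsub>L\<^esub>"] R.add.l_cancel_one'[of "\<tau> a \<zero>\<^bsub>L\<^esub>" "\<tau> a \<zero>\<^bsub>L\<^esub>"] by simp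

lemma tensor_zero_left [simp]: "l \<in> carrier L \<Longrightarrow> \<tau> \<zero>\<^bsub>A\<^esub> l = \<zero>\<^bsub>R\<^esub>"
  using tensor_add_left[of "\<zero>\<^bsub>A\<^esub>" "\<zero>\<^bsub>A\<^esub>" l] R.add.l_cancel_one'[of "\<tau> \<zero>\<^bsub>A\<^esub> l" "\<tau> \<zero>\<^bsub>A\<^esub> l"] by simp

lemma tensor_minus_left:
  assumes "a \<in> carrier A" "l \<in> carrier L" shows "\<tau> (\<ominus>\<^bsub>A\<^esub> a) l = \<ominus>\<^bsub>R\<^esub> \<tau> a l"
  using assms R.minus_equality[of "\<tau> (\<ominus>\<^bsub>A\<^esub> a) l" "\<tau> a l"]
  by (simp add: A.l_neg flip: tensor_add_left)

text \<open>The first argument is the starting point, so that the empty list denotes a vertex.\<close>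

primrec path :: "'v \<Rightarrow> 'e list \<Rightarrow> 'l" where
  "path u [] = vx u"
| "path u (e # p) = g (Edge e) \<otimes>\<^bsub>L\<^esub> path (head E e) p"

primrec ghost_path :: "'v \<Rightarrow> 'e list \<Rightarrow> 'l" where
  "ghost_path u [] = vx u"
| "ghost_path u (e # p) = ghost_path (head E e) p \<otimes>\<^bsub>L\<^esub> g (Ghost e)"

lemma path_closed [simp]: "awalk u p v \<Longrightarrow> path u p \<in> carrier L"
  by (induction p arbitrary: u) (auto simp: awalk_simps)

lemma ghost_path_closed [simp]: "awalk u p v \<Longrightarrow> ghost_path u p \<in> carrier L"
  by (induction p arbitrary: u) (auto simp: awalk_simps)

lemma vertex_path:
  assumes "awalk u p v" "w \<in> verts E"
  shows "vx w \<otimes>\<^bsub>L\<^esub> path u p = (if w = u then path u p else \<zero>\<^bsub>L\<^esub>)"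
proof (cases p)
  case Nil
  then show ?thesis using assms by (auto simp: awalk_simps vertex_vertex)
next
  case (Cons e q)
  then have e: "e \<in> arcs E" "tail E e = u" "awalk (head E e) q v"
    using assms by (auto simp: awalk_simps)
  have "vx w \<otimes>\<^bsub>L\<^esub> g (Edge e) = (vx w \<otimes>\<^bsub>L\<^esub> vx u) \<otimes>\<^bsub>L\<^esub> g (Edge e)"
    using e assms tail_edge[of e] by (auto simp: L.m_assoc)
  also have "\<dots> = (if w = u then g (Edge e) else \<zero>\<^bsub>L\<^esub>)"
    using e assms tail_edge[of e] by (auto simp: vertex_vertex)
  finally show ?thesis using e assms Cons by (auto simp flip: L.m_assoc)
qed

lemma path_append:
  "\<lbrakk>awalk u p v; awalk v q w\<rbrakk> \<Longrightarrow> path u p \<otimes>\<^bsub>L\<^esub> path v q = path u (p @ q)"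
proof (induction p arbitrary: u)
  case Nil
  then show ?case using vertex_path[of v q w v] by (auto simp: awalk_simps)
next
  case (Cons e p)
  then have "awalk (head E e) p v" "e \<in> arcs E" by (auto simp: awalk_simps)
  then show ?case using Cons.IH[of "head E e"] Cons.prems by (simp add: L.m_assoc)
qed

lemma ghost_path_append:
  "\<lbrakk>awalk u p v; awalk v q w\<rbrakk> \<Longrightarrow> ghost_path v q \<otimes>\<^bsub>L\<^esub> ghost_path u p = ghost_path u (p @ q)"
proof (induction p arbitrary: u)
  case Nil
  have "ghost_path v q \<otimes>\<^bsub>L\<^esub> vx v = ghost_path v q"
  proof (cases q)
    case Nil
    then show ?thesis using \<open>awalk v q w\<close> by (auto simp: awalk_simps vertex_vertex)
  next
    case (Cons e r)
    then have "e \<in> arcs E" "tail E e = v" "awalk (head E e) r w" "v \<in> verts E"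
      using \<open>awalk v q w\<close> by (auto simp: awalk_simps)
    then show ?thesis using Cons ghost_tail[of e] by (simp add: L.m_assoc)
  qed
  then show ?case using Nil by (auto simp: awalk_simps)
next
  case (Cons e p)
  then have e: "awalk (head E e) p v" "e \<in> arcs E" by (auto simp: awalk_simps)
  have "ghost_path v q \<otimes>\<^bsub>L\<^esub> ghost_path u (e # p)
      = (ghost_path v q \<otimes>\<^bsub>L\<^esub> ghost_path (head E e) p) \<otimes>\<^bsub>L\<^esub> g (Ghost e)"
    using e Cons.prems by (simp add: L.m_assoc)
  then show ?case using Cons.IH[OF e(1)] Cons.prems by simp
qed

lemma path_vertex: "awalk u p v \<Longrightarrow> path u p \<otimes>\<^bsub>L\<^esub> vx v = path u p"
  using path_append[of u p v "[]" v] awalk_last_in_verts[of u p v] by (simp add: awalk_Nil_iff)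

text \<open>The product \<open>p\<^sup>* q\<close> is computed by cancelling edge by edge: \<open>e\<^sup>* f\<close> vanishes for \<open>e \<noteq> f\<close>, and as long
  as the edges agree a vertex remains. If \<open>p\<close> is nonempty then the first edges already detect different
  starting points.\<close>

lemma ghost_path_mult_path:
  "\<lbrakk>awalk u p v; awalk u' q w; length p \<le> length q; p \<noteq> [] \<or> u = u'\<rbrakk> \<Longrightarrow>
    ghost_path u p \<otimes>\<^bsub>L\<^esub> path u' q =
      (if take (length p) q = p then path v (drop (length p) q) else \<zero>\<^bsub>L\<^esub>)"
proof (induction p arbitrary: u u' q)
  case Nil
  then show ?case using vertex_path[of u q w u] by (auto simp: awalk_simps)
next
  case (Cons e p)
  then obtain f q' where q: "q = f # q'" by (cases q) auto
  have e: "e \<in> arcs E" "awalk (head E e) p v" and f: "f \<in> arcs E" "awalk (head E f) q' w"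
    using Cons.prems q by (auto simp: awalk_simps)
  have "ghost_path u (e # p) \<otimes>\<^bsub>L\<^esub> path u' q
      = ghost_path (head E e) p \<otimes>\<^bsub>L\<^esub> ((g (Ghost e) \<otimes>\<^bsub>L\<^esub> g (Edge f)) \<otimes>\<^bsub>L\<^esub> path (head E f) q')"
    using e f q by (simp add: L.m_assoc)
  also have "(g (Ghost e) \<otimes>\<^bsub>L\<^esub> g (Edge f)) \<otimes>\<^bsub>L\<^esub> path (head E f) q'
      = (if e = f then path (head E e) q' else \<zero>\<^bsub>L\<^esub>)"
    using e f vertex_path[OF f(2)] by (simp add: ghost_edge)
  finally show ?case using Cons.IH[OF e(2), of "head E e" q'] e f q Cons.prems(3) by auto
qed

lemma ghost_path_path_self: "awalk u p v \<Longrightarrow> ghost_path u p \<otimes>\<^bsub>L\<^esub> path u p = vx v"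
  using ghost_path_mult_path[of u p v u p v] by simp

text \<open>A generator shortens a path by at most one edge. So a path longer than a monomial is turned by it
  into another real path, or into zero.\<close>

lemma generator_mult_path:
  assumes x: "x \<in> leavitt_gens E" and p: "awalk u p v" "p \<noteq> []"
  shows "g x \<otimes>\<^bsub>L\<^esub> path u p = \<zero>\<^bsub>L\<^esub> \<or>
    (\<exists>u' q. awalk u' q v \<and> length p \<le> Suc (length q) \<and> g x \<otimes>\<^bsub>L\<^esub> path u p = path u' q)"
proof -
  consider w where "x = Vertex w" "w \<in> verts E" | e where "x = Edge e" "e \<in> arcs E"
    | e where "x = Ghost e" "e \<in> arcs E"
    using x by (auto simp: leavitt_gens_def)
  then show ?thesis
  proof cases
    case 1
    then show ?thesis using vertex_path[OF p(1), of w] p(1) by (auto intro!: exI[of _ u] exI[of _ p])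
  next
    case 2
    have "g x \<otimes>\<^bsub>L\<^esub> path u p = g (Edge e) \<otimes>\<^bsub>L\<^esub> (vx (head E e) \<otimes>\<^bsub>L\<^esub> path u p)"
      using 2 p(1) by (simp add: edge_head flip: L.m_assoc)
    also have "\<dots> = (if head E e = u then path (tail E e) (e # p) else \<zero>\<^bsub>L\<^esub>)"
      using 2 p(1) by (auto simp: vertex_path)
    finally have eq: "g x \<otimes>\<^bsub>L\<^esub> path u p = (if head E e = u then path (tail E e) (e # p) else \<zero>\<^bsub>L\<^esub>)" .
    show ?thesis
    proof (cases "head E e = u")
      case True
      then have "awalk (tail E e) (e # p) v" using 2 p(1) by (auto simp: awalk_Cons_iff)
      moreover have "length p \<le> Suc (length (e # p))" by simp
      ultimately show ?thesis using eq True by metis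
    qed (simp add: eq)
  next
    case 3
    obtain f q where f: "p = f # q" using p(2) by (cases p) auto
    then have fq: "f \<in> arcs E" "awalk (head E f) q v" using p by (auto simp: awalk_simps)
    have "g x \<otimes>\<^bsub>L\<^esub> path u p = (g (Ghost e) \<otimes>\<^bsub>L\<^esub> g (Edge f)) \<otimes>\<^bsub>L\<^esub> path (head E f) q"
      using 3 f fq by (simp add: L.m_assoc)
    also have "\<dots> = (if e = f then path (head E f) q else \<zero>\<^bsub>L\<^esub>)"
      using 3 fq by (auto simp: ghost_edge vertex_path)
    finally show ?thesis using fq f by (auto intro!: exI[of _ "head E f"] exI[of _ q])
  qed
qed

lemma monomial_mult_path:
  assumes "set ms \<subseteq> leavitt_gens E" "ms \<noteq> []" "awalk u p v" "length ms < length p"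
  shows "monomial L g ms \<otimes>\<^bsub>L\<^esub> path u p = \<zero>\<^bsub>L\<^esub> \<or>
    (\<exists>u' q. awalk u' q v \<and> length p \<le> length ms + length q \<and> monomial L g ms \<otimes>\<^bsub>L\<^esub> path u p = path u' q)"
  using assms
proof (induction ms)
  case (Cons x ms)
  show ?case
  proof (cases ms)
    case Nil
    then show ?thesis using generator_mult_path[of x u p v] Cons.prems by (cases "p = []") auto
  next
    case (Cons y ys)
    have x: "x \<in> leavitt_gens E" "set ms \<subseteq> leavitt_gens E" using Cons.prems by auto
    have step: "monomial L g (x # ms) \<otimes>\<^bsub>L\<^esub> path u p = g x \<otimes>\<^bsub>L\<^esub> (monomial L g ms \<otimes>\<^bsub>L\<^esub> path u p)"
      using Cons x Cons.prems monomial_closed[of ms] gen_closed by (simp add: L.m_assoc del: monomial_closed)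
    have "monomial L g ms \<otimes>\<^bsub>L\<^esub> path u p = \<zero>\<^bsub>L\<^esub> \<or>
      (\<exists>u' q. awalk u' q v \<and> length p \<le> length ms + length q \<and> monomial L g ms \<otimes>\<^bsub>L\<^esub> path u p = path u' q)"
      using Cons.IH Cons.prems Cons by auto
    then show ?thesis
    proof (elim disjE exE conjE)
      assume "monomial L g ms \<otimes>\<^bsub>L\<^esub> path u p = \<zero>\<^bsub>L\<^esub>"
      then show ?thesis using step gen_closed[OF x(1)] by simp
    next
      fix u' q
      assume q: "awalk u' q v" "length p \<le> length ms + length q"
        "monomial L g ms \<otimes>\<^bsub>L\<^esub> path u p = path u' q"
      then have "q \<noteq> []" using Cons.prems by auto
      from generator_mult_path[OF x(1) q(1) this]
      show ?thesis
      proof (elim disjE exE conjE)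
        assume "g x \<otimes>\<^bsub>L\<^esub> path u' q = \<zero>\<^bsub>L\<^esub>"
        then show ?thesis using step q(3) by simp
      next
        fix u'' r
        assume r: "awalk u'' r v" "length q \<le> Suc (length r)" "g x \<otimes>\<^bsub>L\<^esub> path u' q = path u'' r"
        then have "length p \<le> length (x # ms) + length r" using q(2) by simp
        then show ?thesis using r step q(3) by metis
      qed
    qed
  qed
qed simp

end

subsection \<open>Local units\<close>

context leavitt_tensor
begin

lemma monomial_fixed_by_vertex:
  assumes "set ms \<subseteq> leavitt_gens E" "ms \<noteq> []"
  shows "\<exists>v\<in>verts E. vx v \<otimes>\<^bsub>L\<^esub> monomial L g ms = monomial L g ms"
    "\<exists>v\<in>verts E. monomial L g ms \<otimes>\<^bsub>L\<^esub> vx v = monomial L g ms"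
proof -
  have gen: "(\<exists>v\<in>verts E. vx v \<otimes>\<^bsub>L\<^esub> g x = g x) \<and> (\<exists>v\<in>verts E. g x \<otimes>\<^bsub>L\<^esub> vx v = g x)"
    if x: "x \<in> leavitt_gens E" for x
  proof (cases x)
    case (Vertex v)
    then show ?thesis using x by (auto simp: leavitt_gens_def vertex_vertex)
  next
    case (Edge a)
    then have "a \<in> arcs E" using x by (auto simp: leavitt_gens_def)
    then show ?thesis using Edge tail_edge[of a] edge_head[of a] by (meson head_in_verts tail_in_verts)
  next
    case (Ghost a)
    then have "a \<in> arcs E" using x by (auto simp: leavitt_gens_def)
    then show ?thesis using Ghost head_ghost[of a] ghost_tail[of a] by (meson head_in_verts tail_in_verts)
  qed
  show "\<exists>v\<in>verts E. vx v \<otimes>\<^bsub>L\<^esub> monomial L g ms = monomial L g ms"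
  proof (cases ms)
    case (Cons x ys)
    then obtain v where v: "v \<in> verts E" "vx v \<otimes>\<^bsub>L\<^esub> g x = g x" using gen[of x] assms by auto
    then show ?thesis using Cons assms gen_closed[of x] monomial_closed[of ys]
      by (intro bexI[of _ v]) (cases ys; simp flip: L.m_assoc)+
  qed (use assms in simp)
  show "\<exists>v\<in>verts E. monomial L g ms \<otimes>\<^bsub>L\<^esub> vx v = monomial L g ms"
    using assms
  proof (induction ms rule: induct_list012)
    case (2 x)
    then show ?case using gen[of x] by auto
  next
    case (3 x y ys)
    then obtain v where "v \<in> verts E" "monomial L g (y # ys) \<otimes>\<^bsub>L\<^esub> vx v = monomial L g (y # ys)" by auto
    then show ?case using 3 gen_closed[of x] monomial_closed[of "y # ys"]
      by (intro bexI[of _ v]) (auto simp: L.m_assoc simp del: monomial_closed)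
  qed simp
qed

definition vertex_unit :: "'v set \<Rightarrow> 'l" where
  "vertex_unit F = (\<Oplus>\<^bsub>L\<^esub>v\<in>F. vx v)"

lemma vertex_unit_closed [simp]: "F \<subseteq> verts E \<Longrightarrow> vertex_unit F \<in> carrier L"
  unfolding vertex_unit_def by (intro L.finsum_closed) auto

lemma vertex_unit_insert:
  assumes "finite F" "u \<notin> F" "insert u F \<subseteq> verts E"
  shows "vertex_unit (insert u F) = vx u \<oplus>\<^bsub>L\<^esub> vertex_unit F"
  unfolding vertex_unit_def using assms by (intro L.finsum_insert) auto

lemma vertex_unit_vertex:
  assumes "finite F" "F \<subseteq> verts E" "v \<in> verts E"
  shows "vertex_unit F \<otimes>\<^bsub>L\<^esub> vx v = (if v \<in> F then vx v else \<zero>\<^bsub>L\<^esub>) \<and>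
    vx v \<otimes>\<^bsub>L\<^esub> vertex_unit F = (if v \<in> F then vx v else \<zero>\<^bsub>L\<^esub>)"
  using assms(1,2)
proof (induction F rule: finite_induct)
  case empty
  then show ?case using assms by (simp add: vertex_unit_def)
next
  case (insert u F)
  then show ?case using assms(3)
    by (auto simp: vertex_unit_insert L.l_distr L.r_distr vertex_vertex)
qed

text \<open>
  An element of \<open>R\<close> involves finitely many coefficients \<open>S\<close> and vertices \<open>F\<close>; it is fixed by
  \<open>b \<otimes> \<Sum>F\<close> as soon as \<open>b\<close> fixes \<open>S\<close>. Larger finite sets serve as well, which makes the property
  additive.
\<close>

lemma local_units:
  assumes x: "x \<in> carrier R"
  obtains S F where "finite S" "S \<subseteq> carrier A" "finite F" "F \<subseteq> verts E"
    "\<And>b. \<lbrakk>b \<in> carrier A; \<forall>a\<in>S. b \<otimes>\<^bsub>A\<^esub> a = a\<rbrakk> \<Longrightarrow> \<tau> b (vertex_unit F) \<otimes>\<^bsub>R\<^esub> x = x"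
    "\<And>b. \<lbrakk>b \<in> carrier A; \<forall>a\<in>S. a \<otimes>\<^bsub>A\<^esub> b = a\<rbrakk> \<Longrightarrow> x \<otimes>\<^bsub>R\<^esub> \<tau> b (vertex_unit F) = x"
proof -
  define U where "U x S F \<longleftrightarrow> (\<forall>F'. F \<subseteq> F' \<and> finite F' \<and> F' \<subseteq> verts E \<longrightarrow>
    (\<forall>b\<in>carrier A. (\<forall>a\<in>S. b \<otimes>\<^bsub>A\<^esub> a = a) \<longrightarrow> \<tau> b (vertex_unit F') \<otimes>\<^bsub>R\<^esub> x = x) \<and>
    (\<forall>b\<in>carrier A. (\<forall>a\<in>S. a \<otimes>\<^bsub>A\<^esub> b = a) \<longrightarrow> x \<otimes>\<^bsub>R\<^esub> \<tau> b (vertex_unit F') = x))" for x S F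
  have "\<exists>S F. finite S \<and> S \<subseteq> carrier A \<and> finite F \<and> F \<subseteq> verts E \<and> U x S F"
  proof (induction rule: tensor_induct[OF x])
    case 1
    show ?case by (intro exI[of _ "{}"]) (auto simp: U_def)
  next
    case (2 a ms)
    let ?m = "monomial L g ms"
    from monomial_fixed_by_vertex[OF 2(2,3)] obtain v z where
      v: "v \<in> verts E" "vx v \<otimes>\<^bsub>L\<^esub> ?m = ?m" and z: "z \<in> verts E" "?m \<otimes>\<^bsub>L\<^esub> vx z = ?m" by blast
    have m: "?m \<in> carrier L" using 2 by simp
    have "vertex_unit F \<otimes>\<^bsub>L\<^esub> ?m = ?m \<and> ?m \<otimes>\<^bsub>L\<^esub> vertex_unit F = ?m"
      if F: "{v, z} \<subseteq> F" "finite F" "F \<subseteq> verts E" for F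
    proof
      have "vertex_unit F \<otimes>\<^bsub>L\<^esub> (vx v \<otimes>\<^bsub>L\<^esub> ?m) = (vertex_unit F \<otimes>\<^bsub>L\<^esub> vx v) \<otimes>\<^bsub>L\<^esub> ?m"
        using F v m by (intro L.m_assoc[symmetric]) auto
      also have "\<dots> = vx v \<otimes>\<^bsub>L\<^esub> ?m" using F v vertex_unit_vertex[of F v] by simp
      finally show "vertex_unit F \<otimes>\<^bsub>L\<^esub> ?m = ?m" using v by simp
      have "(?m \<otimes>\<^bsub>L\<^esub> vx z) \<otimes>\<^bsub>L\<^esub> vertex_unit F = ?m \<otimes>\<^bsub>L\<^esub> (vx z \<otimes>\<^bsub>L\<^esub> vertex_unit F)"
        using F z m by (intro L.m_assoc) auto
      also have "\<dots> = ?m \<otimes>\<^bsub>L\<^esub> vx z" using F z vertex_unit_vertex[of F z] by simp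
      finally show "?m \<otimes>\<^bsub>L\<^esub> vertex_unit F = ?m" using z by simp
    qed
    then have "U (\<tau> a ?m) {a} {v, z}"
      using 2(1) m by (auto simp: U_def tensor_mult)
    then show ?case using 2(1) v z by (intro exI[of _ "{a}"] exI[of _ "{v, z}"]) auto
  next
    case (3 x y)
    from 3(3) obtain S F where SF: "finite S" "S \<subseteq> carrier A" "finite F" "F \<subseteq> verts E" "U x S F" by blast
    from 3(4) obtain S' F' where
      SF': "finite S'" "S' \<subseteq> carrier A" "finite F'" "F' \<subseteq> verts E" "U y S' F'" by blast
    have "U (x \<oplus>\<^bsub>R\<^esub> y) (S \<union> S') (F \<union> F')"
      using SF(5) SF'(5) 3(1,2) by (simp add: U_def R.r_distr R.l_distr)
    moreover have "finite (S \<union> S')" "S \<union> S' \<subseteq> carrier A" "finite (F \<union> F')" "F \<union> F' \<subseteq> verts E"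
      using SF SF' by auto
    ultimately show ?case by (intro exI[of _ "S \<union> S'"] exI[of _ "F \<union> F'"] conjI)
  qed
  then obtain S F where SF: "finite S" "S \<subseteq> carrier A" "finite F" "F \<subseteq> verts E" and U: "U x S F" by blast
  show ?thesis
    using U[unfolded U_def, rule_format, of F] SF by (intro that[OF SF]) simp_all
qed

lemma s_unital_R:
  assumes s_unital_A: "s_unital A"
  shows "s_unital R"
  unfolding s_unital_def
proof
  fix x assume "x \<in> carrier R"
  then show "\<exists>u\<in>carrier R. \<exists>v\<in>carrier R. u \<otimes>\<^bsub>R\<^esub> x = x \<and> x \<otimes>\<^bsub>R\<^esub> v = x"
  proof (rule local_units)
    fix S F
    assume SF: "finite S" "S \<subseteq> carrier A" "finite F" "F \<subseteq> verts E"
      and U: "\<And>b. \<lbrakk>b \<in> carrier A; \<forall>a\<in>S. b \<otimes>\<^bsub>A\<^esub> a = a\<rbrakk> \<Longrightarrow> \<tau> b (vertex_unit F) \<otimes>\<^bsub>R\<^esub> x = x"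
        "\<And>b. \<lbrakk>b \<in> carrier A; \<forall>a\<in>S. a \<otimes>\<^bsub>A\<^esub> b = a\<rbrakk> \<Longrightarrow> x \<otimes>\<^bsub>R\<^esub> \<tau> b (vertex_unit F) = x"
    obtain b c where bc: "b \<in> carrier A" "\<forall>a\<in>S. b \<otimes>\<^bsub>A\<^esub> a = a" "c \<in> carrier A" "\<forall>a\<in>S. a \<otimes>\<^bsub>A\<^esub> c = a"
      using A.common_left_unit[OF s_unital_A SF(1,2)] A.common_right_unit[OF s_unital_A SF(1,2)] by blast
    then show ?thesis
      using U(1)[OF bc(1,2)] U(2)[OF bc(3,4)] SF
      by (intro bexI[of _ "\<tau> b (vertex_unit F)"] bexI[of _ "\<tau> c (vertex_unit F)"]) auto
  qed
qed

end

section \<open>Reduction to vertices modulo an ideal\<close>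

text \<open>In the application \<open>J\<close> is the ideal of elements absorbed by a given element of \<open>R\<close>, and \<open>w\<close> is the
  branching vertex with its two edges \<open>e\<close> and \<open>f\<close>.\<close>

locale leavitt_tensor_ideal = leavitt_tensor E A L R g \<tau>
  for E :: "('v, 'e) pre_digraph" and A :: "('a, 'm) ring_scheme"
    and L :: "('l, 'n) ring_scheme" and R :: "('r, 'p) ring_scheme" and g \<tau> +
  fixes J :: "'r set" and w :: 'v and e f :: 'e
  assumes ideal_J: "two_sided_ideal J R"
    and s_unital_A: "s_unital A"
    and finite_out_arcs: "v \<in> verts E \<Longrightarrow> finite (out_arcs E v)"
    and minimal: "\<lbrakk>H \<subseteq> verts E; hereditary E H; saturated E H\<rbrakk> \<Longrightarrow> H = {} \<or> H = verts E"
    and branching: "e \<in> out_arcs E w" "f \<in> out_arcs E w" "e \<noteq> f"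
    and reaches: "v \<in> verts E \<Longrightarrow> v \<rightarrow>\<^sup>*\<^bsub>E\<^esub> w"
begin

lemma w_vertex: "w \<in> verts E" using branching by auto

lemma J_additive: "additive_subgroup J R"
  using ideal_J by (simp add: two_sided_ideal_def)

lemma J_subset: "J \<subseteq> carrier R"
  by (rule additive_subgroup.a_subset[OF J_additive])

lemma J_closed [intro]:
  "\<zero>\<^bsub>R\<^esub> \<in> J"
  "\<lbrakk>x \<in> J; y \<in> J\<rbrakk> \<Longrightarrow> x \<oplus>\<^bsub>R\<^esub> y \<in> J"
  "x \<in> J \<Longrightarrow> \<ominus>\<^bsub>R\<^esub> x \<in> J"
  "\<lbrakk>x \<in> J; y \<in> carrier R\<rbrakk> \<Longrightarrow> y \<otimes>\<^bsub>R\<^esub> x \<in> J"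
  "\<lbrakk>x \<in> J; y \<in> carrier R\<rbrakk> \<Longrightarrow> x \<otimes>\<^bsub>R\<^esub> y \<in> J"
  using ideal_J additive_subgroup.zero_closed[OF J_additive] additive_subgroup.a_closed[OF J_additive]
    R.add.subgroupE(3)[OF additive_subgroup.a_subgroup[OF J_additive]]
  by (auto simp: two_sided_ideal_def a_inv_def)

text \<open>Coefficients can be supplied with one-sided units, so multiplying the second factor of
  \<open>a \<otimes> l\<close> on either side amounts to multiplying in \<open>R\<close>.\<close>

lemma tensor_mult_in_J:
  assumes a: "a \<in> carrier A" and l: "l \<in> carrier L" "\<tau> a l \<in> J" and m: "m \<in> carrier L"
  shows "\<tau> a (m \<otimes>\<^bsub>L\<^esub> l) \<in> J" "\<tau> a (l \<otimes>\<^bsub>L\<^esub> m) \<in> J"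
proof -
  obtain b c where bc: "b \<in> carrier A" "b \<otimes>\<^bsub>A\<^esub> a = a" "c \<in> carrier A" "a \<otimes>\<^bsub>A\<^esub> c = a"
    using s_unital_A a unfolding s_unital_def by blast
  have "\<tau> a (m \<otimes>\<^bsub>L\<^esub> l) = \<tau> b m \<otimes>\<^bsub>R\<^esub> \<tau> a l" "\<tau> a (l \<otimes>\<^bsub>L\<^esub> m) = \<tau> a l \<otimes>\<^bsub>R\<^esub> \<tau> c m"
    using a bc l m by (simp_all add: tensor_mult)
  then show "\<tau> a (m \<otimes>\<^bsub>L\<^esub> l) \<in> J" "\<tau> a (l \<otimes>\<^bsub>L\<^esub> m) \<in> J"
    using bc l m by auto
qed

lemma vertex_in_closed_set:
  assumes "v \<in> verts E" "out_arcs E v \<noteq> {}"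
    and "\<zero>\<^bsub>L\<^esub> \<in> N" "N \<subseteq> carrier L" "\<And>x y. \<lbrakk>x \<in> N; y \<in> N\<rbrakk> \<Longrightarrow> x \<oplus>\<^bsub>L\<^esub> y \<in> N"
    and "\<And>a. a \<in> out_arcs E v \<Longrightarrow> g (Edge a) \<otimes>\<^bsub>L\<^esub> g (Ghost a) \<in> N"
  shows "vx v \<in> N"
  unfolding vertex_sum[OF assms(1,2)]
  using assms finite_out_arcs by (intro L.finsum_in_closed_set) auto

text \<open>The vertices \<open>v\<close> with \<open>a \<otimes> v \<in> J\<close> form a hereditary and saturated set.\<close>

lemma vertex_in_J_everywhere:
  assumes a: "a \<in> carrier A" and v: "v \<in> verts E" "\<tau> a (vx v) \<in> J" and z: "z \<in> verts E"
  shows "\<tau> a (vx z) \<in> J"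
proof -
  let ?H = "{v \<in> verts E. \<tau> a (vx v) \<in> J}"
  have "hereditary E ?H"
    unfolding hereditary_def
  proof (intro allI impI, elim conjE)
    fix x y assume "x \<rightarrow>\<^sup>*\<^bsub>E\<^esub> y" and x: "x \<in> ?H"
    then obtain p where p: "awalk x p y" by (auto simp: reachable_awalk)
    then have y: "y \<in> verts E" by auto
    have "\<tau> a (ghost_path x p \<otimes>\<^bsub>L\<^esub> (vx x \<otimes>\<^bsub>L\<^esub> path x p)) \<in> J"
      using x p a by (intro tensor_mult_in_J) auto
    then have "\<tau> a (vx y) \<in> J"
      using p x by (simp add: vertex_path ghost_path_path_self)
    then show "y \<in> ?H" using y by simp
  qed
  moreover have "saturated E ?H"
    unfolding saturated_def
  proof (intro ballI impI)
    fix x assume x: "x \<in> verts E" and out: "out_arcs E x \<noteq> {} \<and> head E ` out_arcs E x \<subseteq> ?H"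
    have "vx x \<in> {l \<in> carrier L. \<tau> a l \<in> J}"
    proof (rule vertex_in_closed_set[OF x])
      fix b assume b: "b \<in> out_arcs E x"
      then have "head E b \<in> ?H" using out by blast
      with b have "b \<in> arcs E" "\<tau> a (vx (head E b)) \<in> J" "head E b \<in> verts E" by auto
      then have "\<tau> a (g (Edge b) \<otimes>\<^bsub>L\<^esub> (vx (head E b) \<otimes>\<^bsub>L\<^esub> g (Ghost b))) \<in> J"
        using a by (intro tensor_mult_in_J) auto
      then show "g (Edge b) \<otimes>\<^bsub>L\<^esub> g (Ghost b) \<in> {l \<in> carrier L. \<tau> a l \<in> J}"
        using \<open>b \<in> arcs E\<close> by (simp add: head_ghost)
    qed (use a out in \<open>auto simp: tensor_add_right\<close>)
    then show "x \<in> ?H" using x by simp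
  qed
  ultimately have "?H = {} \<or> ?H = verts E" by (intro minimal) auto
  then show ?thesis using v z by auto
qed

lemma path_in_J:
  assumes a: "a \<in> carrier A" and v: "v \<in> verts E" "\<tau> a (vx v) \<in> J" and p: "awalk u p z"
  shows "\<tau> a (path u p) \<in> J"
proof -
  have "u \<in> verts E" using p by auto
  then have "\<tau> a (vx u \<otimes>\<^bsub>L\<^esub> path u p) \<in> J"
    using vertex_in_J_everywhere[OF a v] a p by (intro tensor_mult_in_J(2)) auto
  then show ?thesis using p \<open>u \<in> verts E\<close> by (simp add: vertex_path)
qed

lemma no_sinks:
  assumes "v \<in> verts E" shows "out_arcs E v \<noteq> {}"
proof -
  obtain p where p: "awalk v p w" using reaches[OF assms] by (auto simp: reachable_awalk)
  show ?thesis using p branching by (cases p) (auto simp: awalk_simps)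
qed

end

context leavitt_tensor_ideal
begin

subsection \<open>From arbitrary elements to real paths\<close>

lemma sum_of_tensors:
  assumes "x \<in> carrier R"
  shows "\<exists>ks. (\<forall>(a, ms)\<in>set ks. a \<in> carrier A \<and> set ms \<subseteq> leavitt_gens E \<and> ms \<noteq> []) \<and>
    x = R.list_sum (\<lambda>(a, ms). \<tau> a (monomial L g ms)) ks"
proof (induction rule: tensor_induct[OF assms])
  case 1
  show ?case by (intro exI[of _ "[]"]) simp
next
  case (2 a ms)
  then show ?case by (intro exI[of _ "[(a, ms)]"]) simp
next
  case (3 x y)
  then obtain ks ks' where
    "\<forall>(a, ms)\<in>set ks. a \<in> carrier A \<and> set ms \<subseteq> leavitt_gens E \<and> ms \<noteq> []"
    "\<forall>(a, ms)\<in>set ks'. a \<in> carrier A \<and> set ms \<subseteq> leavitt_gens E \<and> ms \<noteq> []"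
    "x = R.list_sum (\<lambda>(a, ms). \<tau> a (monomial L g ms)) ks"
    "y = R.list_sum (\<lambda>(a, ms). \<tau> a (monomial L g ms)) ks'"
    by blast
  then show ?case
    by (intro exI[of _ "ks @ ks'"] conjI) (auto intro!: R.list_sum_append[symmetric])
qed

lemma mult_tensor_additive:
  assumes "x \<in> carrier R" "b \<in> carrier A" "m \<in> carrier L"
  defines "N \<equiv> {l \<in> carrier L. x \<otimes>\<^bsub>R\<^esub> \<tau> b (m \<otimes>\<^bsub>L\<^esub> l) \<in> J}"
  shows "\<zero>\<^bsub>L\<^esub> \<in> N" "N \<subseteq> carrier L" "\<And>k l. \<lbrakk>k \<in> N; l \<in> N\<rbrakk> \<Longrightarrow> k \<oplus>\<^bsub>L\<^esub> l \<in> N"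
  using assms by (auto simp: L.r_distr tensor_add_right R.r_distr)

text \<open>If \<open>x \<notin> J\<close> then \<open>x (b \<otimes> p) \<notin> J\<close> for some path \<open>p\<close> of any prescribed length, because \<open>x\<close> is a sum of
  elements \<open>x (b \<otimes> v)\<close> and each vertex is a sum of products \<open>e e\<^sup>*\<close>, which prolongs the paths.\<close>

lemma in_J_if_long_path_multiples_in_J:
  assumes x: "x \<in> carrier R"
    and in_J: "\<And>b u p v. \<lbrakk>b \<in> carrier A; awalk u p v; length p = n\<rbrakk> \<Longrightarrow> x \<otimes>\<^bsub>R\<^esub> \<tau> b (path u p) \<in> J"
  shows "x \<in> J"
  using in_J
proof (induction n)
  case 0
  show ?case
  proof (rule local_units[OF x])
    fix S F
    assume SF: "finite S" "S \<subseteq> carrier A" "finite F" "F \<subseteq> verts E"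
      and U: "\<And>b. \<lbrakk>b \<in> carrier A; \<forall>a\<in>S. a \<otimes>\<^bsub>A\<^esub> b = a\<rbrakk> \<Longrightarrow> x \<otimes>\<^bsub>R\<^esub> \<tau> b (vertex_unit F) = x"
    obtain c where c: "c \<in> carrier A" "\<forall>a\<in>S. a \<otimes>\<^bsub>A\<^esub> c = a"
      using A.common_right_unit[OF s_unital_A SF(1,2)] by blast
    let ?N = "{l \<in> carrier L. x \<otimes>\<^bsub>R\<^esub> \<tau> c l \<in> J}"
    have "vertex_unit F \<in> ?N"
      unfolding vertex_unit_def
    proof (rule L.finsum_in_closed_set)
      fix v assume v: "v \<in> F"
      then have "awalk v [] v" using SF by (auto simp: awalk_Nil_iff)
      from "0.prems"[OF c(1) this] show "vx v \<in> ?N" using v SF by auto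
    qed (use c SF x in \<open>auto simp: tensor_add_right R.r_distr\<close>)
    then show "x \<in> J" using U[OF c] by simp
  qed
next
  case (Suc n)
  show ?case
  proof (rule Suc.IH)
    fix b u p v
    assume b: "b \<in> carrier A" and p: "awalk u p v" "length p = n"
    let ?N = "{l \<in> carrier L. x \<otimes>\<^bsub>R\<^esub> \<tau> b (path u p \<otimes>\<^bsub>L\<^esub> l) \<in> J}"
    have v: "v \<in> verts E" using p by auto
    have "vx v \<in> ?N"
    proof (rule vertex_in_closed_set[OF v no_sinks[OF v]])
      fix a assume "a \<in> out_arcs E v"
      then have a: "a \<in> arcs E" "awalk v [a] (head E a)" "tail E a = v" by (auto simp: awalk_simps v)
      obtain c where c: "c \<in> carrier A" "b \<otimes>\<^bsub>A\<^esub> c = b"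
        using s_unital_A b unfolding s_unital_def by blast
      have "path u p \<otimes>\<^bsub>L\<^esub> g (Edge a) = path u (p @ [a])"
        using path_append[OF p(1) a(2)] a(1) edge_head[of a] by simp
      then have "\<tau> b (path u p \<otimes>\<^bsub>L\<^esub> (g (Edge a) \<otimes>\<^bsub>L\<^esub> g (Ghost a)))
          = \<tau> b (path u (p @ [a])) \<otimes>\<^bsub>R\<^esub> \<tau> c (g (Ghost a))"
        using b c a p by (simp add: tensor_mult flip: L.m_assoc)
      moreover have "x \<otimes>\<^bsub>R\<^esub> \<tau> b (path u (p @ [a])) \<in> J"
        using Suc.prems[OF b awalk_appendI[OF p(1) a(2)]] p(2) by simp
      moreover have "path u (p @ [a]) \<in> carrier L"
        by (rule path_closed[OF awalk_appendI[OF p(1) a(2)]])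
      ultimately show "g (Edge a) \<otimes>\<^bsub>L\<^esub> g (Ghost a) \<in> ?N"
        using a b c x by (simp add: J_closed flip: R.m_assoc)
    qed (rule mult_tensor_additive[OF x b path_closed[OF p(1)]]; assumption)+
    then show "x \<otimes>\<^bsub>R\<^esub> \<tau> b (path u p) \<in> J"
      using path_vertex[OF p(1)] by simp
  qed
qed

text \<open>A term \<open>(a, p)\<close> with a nonempty walk \<open>p\<close> ending at \<open>v\<close> stands for \<open>a \<otimes> p\<close>.\<close>

abbreviation path_of :: "'e list \<Rightarrow> 'l" where
  "path_of p \<equiv> path (tail E (hd p)) p"

abbreviation path_sum :: "('a \<times> 'e list) list \<Rightarrow> 'r" where
  "path_sum \<equiv> R.list_sum (\<lambda>(a, p). \<tau> a (path_of p))"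

definition path_terms :: "'v \<Rightarrow> ('a \<times> 'e list) set" where
  "path_terms v = {(a, p). a \<in> carrier A \<and> p \<noteq> [] \<and> awalk (tail E (hd p)) p v}"

lemma path_sum_closed [simp]: "set ts \<subseteq> path_terms v \<Longrightarrow> path_sum ts \<in> carrier R"
  by (intro R.list_sum_closed) (auto simp: path_terms_def)

text \<open>A path that is longer than all words occurring in \<open>x\<close> turns every term of \<open>x\<close> into a real path or
  into zero. All resulting paths end where that path ends.\<close>

lemma multiply_into_path_sum:
  assumes x: "x \<in> carrier R" "x \<notin> J"
  shows "\<exists>y\<in>carrier R. \<exists>v ts. set ts \<subseteq> path_terms v \<and> x \<otimes>\<^bsub>R\<^esub> y = path_sum ts \<and> x \<otimes>\<^bsub>R\<^esub> y \<notin> J"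
proof -
  obtain ks where ks: "\<forall>(a, ms)\<in>set ks. a \<in> carrier A \<and> set ms \<subseteq> leavitt_gens E \<and> ms \<noteq> []"
    and x_eq: "x = R.list_sum (\<lambda>(a, ms). \<tau> a (monomial L g ms)) ks"
    using sum_of_tensors[OF x(1)] by blast
  \<comment> \<open>Any bound for the lengths of the words will do.\<close>
  define n where "n = Suc (sum_list (map (length \<circ> snd) ks))"
  have n: "length ms < n" if "(a, ms) \<in> set ks" for a ms
    using member_le_sum_list[of "length ms" "map (length \<circ> snd) ks"] that by (force simp: n_def)
  obtain b u p v where b: "b \<in> carrier A" and p: "awalk u p v" "length p = n"
    and notin: "x \<otimes>\<^bsub>R\<^esub> \<tau> b (path u p) \<notin> J"
    using in_J_if_long_path_multiples_in_J[OF x(1), of n] x(2) by blast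
  have "x \<otimes>\<^bsub>R\<^esub> \<tau> b (path u p) =
      R.list_sum (\<lambda>k. (case k of (a, ms) \<Rightarrow> \<tau> a (monomial L g ms)) \<otimes>\<^bsub>R\<^esub> \<tau> b (path u p)) ks"
    unfolding x_eq using ks b p by (intro R.list_sum_mult_right) auto
  moreover have "\<exists>ts. set ts \<subseteq> path_terms v \<and>
      R.list_sum (\<lambda>k. (case k of (a, ms) \<Rightarrow> \<tau> a (monomial L g ms)) \<otimes>\<^bsub>R\<^esub> \<tau> b (path u p)) ks' = path_sum ts"
    if "set ks' \<subseteq> set ks" for ks'
    using that
  proof (induction ks')
    case Nil
    show ?case by (intro exI[of _ "[]"]) simp
  next
    case (Cons k ks')
    then obtain ts where ts: "set ts \<subseteq> path_terms v"
      "R.list_sum (\<lambda>k. (case k of (a, ms) \<Rightarrow> \<tau> a (monomial L g ms)) \<otimes>\<^bsub>R\<^esub> \<tau> b (path u p)) ks' = path_sum ts"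
      by auto
    obtain a ms where k: "k = (a, ms)" "(a, ms) \<in> set ks" using Cons.prems by (cases k) auto
    then have a: "a \<in> carrier A" "set ms \<subseteq> leavitt_gens E" "ms \<noteq> []" using ks by auto
    have term_eq: "\<tau> a (monomial L g ms) \<otimes>\<^bsub>R\<^esub> \<tau> b (path u p)
        = \<tau> (a \<otimes>\<^bsub>A\<^esub> b) (monomial L g ms \<otimes>\<^bsub>L\<^esub> path u p)"
      using a b p by (simp add: tensor_mult)
    from monomial_mult_path[OF a(2,3) p(1)] n[OF k(2)] p(2)
    consider "monomial L g ms \<otimes>\<^bsub>L\<^esub> path u p = \<zero>\<^bsub>L\<^esub>"
      | u' q where "awalk u' q v" "n \<le> length ms + length q" "monomial L g ms \<otimes>\<^bsub>L\<^esub> path u p = path u' q"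
      by auto
    then show ?case
    proof cases
      case 1
      then show ?thesis using ts k a b term_eq by (intro exI[of _ ts]) auto
    next
      case (2 u' q)
      then have "q \<noteq> []" using n[OF k(2)] by auto
      then have "u' = tail E (hd q)" using 2(1) by (cases q) (auto simp: awalk_simps)
      then show ?thesis using 2 ts k a b term_eq \<open>q \<noteq> []\<close>
        by (intro exI[of _ "(a \<otimes>\<^bsub>A\<^esub> b, q) # ts"]) (auto simp: path_terms_def)
    qed
  qed
  ultimately obtain ts where "set ts \<subseteq> path_terms v" "x \<otimes>\<^bsub>R\<^esub> \<tau> b (path u p) = path_sum ts"
    by fastforce
  then show ?thesis using notin b p by (intro bexI[of _ "\<tau> b (path u p)"]) auto
qed

lemma collect_path:
  assumes "set ts \<subseteq> path_terms v" "p \<noteq> []" "awalk (tail E (hd p)) p v"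
  shows "\<exists>c\<in>carrier A. path_sum ts =
    \<tau> c (path_of p) \<oplus>\<^bsub>R\<^esub> path_sum (filter (\<lambda>t. snd t \<noteq> p) ts)"
  using assms(1)
proof (induction ts)
  case Nil
  show ?case using assms by (intro bexI[of _ "\<zero>\<^bsub>A\<^esub>"]) auto
next
  case (Cons t ts)
  then obtain c where c: "c \<in> carrier A"
    "path_sum ts = \<tau> c (path_of p) \<oplus>\<^bsub>R\<^esub> path_sum (filter (\<lambda>t. snd t \<noteq> p) ts)" by auto
  obtain a q where t: "t = (a, q)" by force
  then have a: "a \<in> carrier A" "awalk (tail E (hd q)) q v" using Cons.prems by (auto simp: path_terms_def)
  have fl: "path_sum (filter (\<lambda>t. snd t \<noteq> p) ts) \<in> carrier R"
    using Cons.prems by (intro path_sum_closed[of _ v]) auto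
  have pc: "path_of p \<in> carrier L" "path_of q \<in> carrier L" using assms(3) a(2) by (auto intro: path_closed)
  show ?case
  proof (cases "q = p")
    case True
    then show ?thesis using c a t pc fl
      by (intro bexI[of _ "a \<oplus>\<^bsub>A\<^esub> c"]) (simp_all add: tensor_add_left R.add.m_ac)
  next
    case False
    then show ?thesis using c a t pc fl
      by (intro bexI[of _ c]) (simp_all add: R.add.m_ac)
  qed
qed

text \<open>Collect the terms along a shortest path. If the collected term lies in \<open>J\<close>, discard it and continue
  with the remaining terms. This stops, since the whole sum is not in \<open>J\<close>.\<close>

lemma isolate_shortest_path:
  assumes "set ts \<subseteq> path_terms v" "path_sum ts \<notin> J"
  shows "\<exists>c p ys j. (c, p) \<in> path_terms v \<and> \<tau> c (path_of p) \<notin> J \<and> set ys \<subseteq> path_terms v \<and>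
    (\<forall>(a, q)\<in>set ys. q \<noteq> p \<and> length p \<le> length q) \<and> j \<in> J \<and>
    path_sum ts = \<tau> c (path_of p) \<oplus>\<^bsub>R\<^esub> path_sum ys \<oplus>\<^bsub>R\<^esub> j"
  using assms
proof (induction "length ts" arbitrary: ts rule: less_induct)
  case less
  then have "ts \<noteq> []" by auto
  then obtain t where t: "t \<in> set ts" "\<forall>t'\<in>set ts. length (snd t) \<le> length (snd t')"
    using arg_min_if_finite[of "set ts" "length \<circ> snd"]
    by (metis List.finite_set comp_apply not_le_imp_less set_empty)
  let ?p = "snd t" and ?ys = "filter (\<lambda>t'. snd t' \<noteq> snd t) ts"
  have p: "?p \<noteq> []" "awalk (tail E (hd ?p)) ?p v" using t(1) less.prems(1) by (auto simp: path_terms_def)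
  obtain c where c: "c \<in> carrier A" "path_sum ts = \<tau> c (path_of ?p) \<oplus>\<^bsub>R\<^esub> path_sum ?ys"
    using collect_path[OF less.prems(1) p] by blast
  have ys: "set ?ys \<subseteq> path_terms v" using less.prems(1) by auto
  have cl: "\<tau> c (path_of ?p) \<in> carrier R" "path_sum ?ys \<in> carrier R"
    using c p ys by (auto intro: path_closed)
  show ?case
  proof (cases "\<tau> c (path_of ?p) \<in> J")
    case False
    then show ?thesis using c p ys t cl
      by (intro exI[of _ c] exI[of _ ?p] exI[of _ ?ys] exI[of _ "\<zero>\<^bsub>R\<^esub>"]) (auto simp: path_terms_def J_closed)
  next
    case True
    then have "path_sum ?ys \<notin> J" using less.prems(2) c by (auto simp: J_closed)
    moreover have "length ?ys < length ts" using t(1) by (intro length_filter_less) auto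
    ultimately obtain d q zs j where IH: "(d, q) \<in> path_terms v" "\<tau> d (path_of q) \<notin> J"
      "set zs \<subseteq> path_terms v" "\<forall>(a, r)\<in>set zs. r \<noteq> q \<and> length q \<le> length r" "j \<in> J"
      "path_sum ?ys = \<tau> d (path_of q) \<oplus>\<^bsub>R\<^esub> path_sum zs \<oplus>\<^bsub>R\<^esub> j"
      using less.hyps[of ?ys] ys by blast
    have "\<tau> d (path_of q) \<in> carrier R" "path_sum zs \<in> carrier R" "j \<in> carrier R"
      using IH J_subset by (auto simp: path_terms_def intro: path_closed)
    then have "path_sum ts = \<tau> d (path_of q) \<oplus>\<^bsub>R\<^esub> path_sum zs \<oplus>\<^bsub>R\<^esub> (\<tau> c (path_of ?p) \<oplus>\<^bsub>R\<^esub> j)"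
      using c(2) IH(6) cl by (simp add: R.add.m_ac)
    then show ?thesis using IH True
      by (intro exI[of _ d] exI[of _ q] exI[of _ zs] exI[of _ "\<tau> c (path_of ?p) \<oplus>\<^bsub>R\<^esub> j"])
        (auto simp: J_closed)
  qed
qed

end

context leavitt_tensor_ideal
begin

subsection \<open>Removing closed paths\<close>

text \<open>
  If \<open>p\<^sup>* s p \<noteq> 0\<close> then \<open>p\<close> is an initial part of \<open>s p\<close>, hence of \<open>s s s \<dots>\<close>. The walks \<open>q e\<close> and
  \<open>q f\<close>, where \<open>q\<close> leads to the branching vertex, cannot both be of this form.
\<close>

lemma kill_closed_path:
  assumes s: "awalk v s v" "s \<noteq> []"
  shows "\<exists>p z. awalk v p z \<and> ghost_path v p \<otimes>\<^bsub>L\<^esub> (path v s \<otimes>\<^bsub>L\<^esub> path v p) = \<zero>\<^bsub>L\<^esub>"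
proof (rule ccontr)
  assume no: "\<not> ?thesis"
  have "v \<in> verts E" using s by auto
  then obtain q where q: "awalk v q w" using reaches by (auto simp: reachable_awalk)
  have initial: "q @ [a] = take (Suc (length q)) (s @ q)" if a: "a \<in> out_arcs E w" for a
  proof -
    have p: "awalk v (q @ [a]) (head E a)" using q a by (auto simp: awalk_simps)
    then have "ghost_path v (q @ [a]) \<otimes>\<^bsub>L\<^esub> (path v s \<otimes>\<^bsub>L\<^esub> path v (q @ [a])) \<noteq> \<zero>\<^bsub>L\<^esub>"
      using no by blast
    then have "ghost_path v (q @ [a]) \<otimes>\<^bsub>L\<^esub> path v (s @ q @ [a]) \<noteq> \<zero>\<^bsub>L\<^esub>"
      by (simp only: path_append[OF s(1) p] simp_thms)
    then have "take (length (q @ [a])) (s @ q @ [a]) = q @ [a]"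
      using ghost_path_mult_path[OF p awalk_appendI[OF s(1) p]] by (auto split: if_splits)
    moreover have "Suc (length q) \<le> length (s @ q)" using s(2) by (cases s) auto
    ultimately show ?thesis by (simp flip: append_assoc)
  qed
  show False using initial[OF branching(1)] initial[OF branching(2)] branching(3)
    by (metis append1_eq_conv)
qed

lemma awalk_suffix: "\<lbrakk>awalk u p v; awalk u (p @ q) z\<rbrakk> \<Longrightarrow> awalk v q z"
  by simp

text \<open>One path is treated after the other. If \<open>p\<close> removes the paths treated so far then it turns the next
  closed path \<open>s\<close> either into zero or into a closed path at the end of \<open>p\<close>, and in the latter case
  \<open>p\<close> is prolonged by a walk that removes this closed path.\<close>

lemma kill_closed_paths:
  assumes "v \<in> verts E" and "finite Q"
    and "\<And>l. l \<in> Q \<Longrightarrow> l = \<zero>\<^bsub>L\<^esub> \<or> (\<exists>s. awalk v s v \<and> s \<noteq> [] \<and> l = path v s)"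
  shows "\<exists>p z. awalk v p z \<and> (\<forall>l\<in>Q. ghost_path v p \<otimes>\<^bsub>L\<^esub> (l \<otimes>\<^bsub>L\<^esub> path v p) = \<zero>\<^bsub>L\<^esub>)"
  using assms(2,3)
proof (induction Q rule: finite_induct)
  case empty
  show ?case using assms(1) by (intro exI[of _ "[]"] exI[of _ v]) (simp add: awalk_Nil_iff)
next
  case (insert l Q)
  then obtain p z where p: "awalk v p z"
    and Q: "\<forall>l\<in>Q. ghost_path v p \<otimes>\<^bsub>L\<^esub> (l \<otimes>\<^bsub>L\<^esub> path v p) = \<zero>\<^bsub>L\<^esub>" by auto
  have closed: "k \<in> carrier L" if "k \<in> insert l Q" for k using insert.prems[OF that] by auto
  have extend: "ghost_path v (p @ r) \<otimes>\<^bsub>L\<^esub> (k \<otimes>\<^bsub>L\<^esub> path v (p @ r))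
      = ghost_path z r \<otimes>\<^bsub>L\<^esub> ((ghost_path v p \<otimes>\<^bsub>L\<^esub> (k \<otimes>\<^bsub>L\<^esub> path v p)) \<otimes>\<^bsub>L\<^esub> path z r)"
    if r: "awalk z r y" and k: "k \<in> carrier L" for r y k
    using p r k path_append[OF p r] ghost_path_append[OF p r]
    by (simp add: L.m_assoc flip: path_append[OF p r] ghost_path_append[OF p r])
  let ?m = "ghost_path v p \<otimes>\<^bsub>L\<^esub> (l \<otimes>\<^bsub>L\<^esub> path v p)"
  have "?m = \<zero>\<^bsub>L\<^esub> \<or> (\<exists>s. awalk z s z \<and> s \<noteq> [] \<and> ?m = path z s)"
  proof (cases "l = \<zero>\<^bsub>L\<^esub>")
    case True
    then show ?thesis using p by simp
  next
    case False
    then obtain s where s: "awalk v s v" "s \<noteq> []" "l = path v s" using insert.prems[of l] by auto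
    let ?d = "drop (length p) (s @ p)"
    have sp: "awalk v (s @ p) z" using s p by (intro awalk_appendI)
    have m: "?m = (if take (length p) (s @ p) = p then path z ?d else \<zero>\<^bsub>L\<^esub>)"
      using ghost_path_mult_path[OF p sp] path_append[OF s(1) p] s(3) by simp
    show ?thesis
    proof (cases "take (length p) (s @ p) = p")
      case True
      then have "s @ p = p @ ?d" by (metis append_take_drop_id)
      then have "awalk v (p @ ?d) z" using sp by (simp only:)
      then have "awalk z ?d z" by (rule awalk_suffix[OF p])
      moreover have "?d \<noteq> []" using s(2) by (simp del: drop_append)
      moreover have "?m = path z ?d" using m True by (simp only: if_True simp_thms)
      ultimately show ?thesis by blast
    qed (simp add: m)
  qed
  then obtain r y where r: "awalk z r y"
    "ghost_path z r \<otimes>\<^bsub>L\<^esub> (?m \<otimes>\<^bsub>L\<^esub> path z r) = \<zero>\<^bsub>L\<^esub>"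
  proof (elim disjE exE conjE)
    assume "?m = \<zero>\<^bsub>L\<^esub>"
    moreover have "awalk z [] z" using p by (auto simp: awalk_Nil_iff)
    ultimately show thesis using that[of "[]" z] p by auto
  next
    fix s assume "awalk z s z" "s \<noteq> []" "?m = path z s"
    then show thesis using kill_closed_path[of z s] that by auto
  qed
  have "\<forall>k\<in>insert l Q. ghost_path v (p @ r) \<otimes>\<^bsub>L\<^esub> (k \<otimes>\<^bsub>L\<^esub> path v (p @ r)) = \<zero>\<^bsub>L\<^esub>"
    using extend[OF r(1)] closed Q r by auto
  then show ?case using awalk_appendI[OF p r(1)] by blast
qed

text \<open>Multiplying by \<open>p\<^sup>*\<close> for the isolated path \<open>p\<close> turns its term into a vertex. Every other path is at
  least as long as \<open>p\<close> and different from it, so it becomes zero or, as all paths end at the same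
  vertex, a nonempty closed path. Then a walk to \<open>w\<close> which removes all of these is used on both sides.\<close>

lemma reduce_to_branching_vertex:
  assumes x: "x \<in> carrier R" "x \<notin> J"
  shows "\<exists>s\<in>carrier R. \<exists>t\<in>carrier R. \<exists>a\<in>carrier A.
    s \<otimes>\<^bsub>R\<^esub> x \<otimes>\<^bsub>R\<^esub> t \<ominus>\<^bsub>R\<^esub> \<tau> a (vx w) \<in> J \<and> \<tau> a (vx w) \<notin> J"
proof -
  obtain y v ts where y: "y \<in> carrier R" and ts: "set ts \<subseteq> path_terms v" "x \<otimes>\<^bsub>R\<^esub> y = path_sum ts"
    "path_sum ts \<notin> J"
    using multiply_into_path_sum[OF x] by auto
  obtain c p ys j where cp: "(c, p) \<in> path_terms v" "\<tau> c (path_of p) \<notin> J" and ys: "set ys \<subseteq> path_terms v"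
    and longer: "\<forall>(a, q)\<in>set ys. q \<noteq> p \<and> length p \<le> length q" and j: "j \<in> J"
    and xy: "path_sum ts = \<tau> c (path_of p) \<oplus>\<^bsub>R\<^esub> path_sum ys \<oplus>\<^bsub>R\<^esub> j"
    using isolate_shortest_path[OF ts(1,3)] by blast
  let ?u = "tail E (hd p)"
  have c: "c \<in> carrier A" and p: "awalk ?u p v" "p \<noteq> []" using cp(1) by (auto simp: path_terms_def)
  have v: "v \<in> verts E" using p(1) by auto
  have j': "j \<in> carrier R" using j J_subset by auto
  let ?Q = "(\<lambda>(a, q). ghost_path ?u p \<otimes>\<^bsub>L\<^esub> path_of q) ` set ys"
  have "\<exists>r z. awalk v r z \<and> (\<forall>l\<in>?Q. ghost_path v r \<otimes>\<^bsub>L\<^esub> (l \<otimes>\<^bsub>L\<^esub> path v r) = \<zero>\<^bsub>L\<^esub>)"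
  proof (rule kill_closed_paths[OF v])
    fix l assume "l \<in> ?Q"
    then obtain a q where aq: "(a, q) \<in> set ys" "l = ghost_path ?u p \<otimes>\<^bsub>L\<^esub> path_of q" by auto
    then have q: "awalk (tail E (hd q)) q v" "q \<noteq> p" "length p \<le> length q"
      using ys longer by (auto simp: path_terms_def)
    let ?d = "drop (length p) q"
    have l: "l = (if take (length p) q = p then path v ?d else \<zero>\<^bsub>L\<^esub>)"
      using ghost_path_mult_path[OF p(1) q(1,3)] p(2) aq(2) by simp
    show "l = \<zero>\<^bsub>L\<^esub> \<or> (\<exists>s. awalk v s v \<and> s \<noteq> [] \<and> l = path v s)"
    proof (cases "take (length p) q = p")
      case True
      then have q_eq: "q = p @ ?d" by (metis append_take_drop_id)
      then have "hd q = hd p" using hd_append2[OF p(2), of ?d] by simp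
      then have "awalk ?u q v" using q(1) by simp
      then have "awalk ?u (p @ ?d) v" by (subst (asm) q_eq)
      then have "awalk v ?d v" by (rule awalk_suffix[OF p(1)])
      moreover have "?d \<noteq> []" using q_eq q(2) by auto
      moreover have "l = path v ?d" using l True by (simp only: if_True simp_thms)
      ultimately show ?thesis by blast
    qed (simp add: l)
  qed simp
  then obtain r0 z0 where r0: "awalk v r0 z0"
    and kill0: "\<forall>l\<in>?Q. ghost_path v r0 \<otimes>\<^bsub>L\<^esub> (l \<otimes>\<^bsub>L\<^esub> path v r0) = \<zero>\<^bsub>L\<^esub>" by blast
  have "z0 \<in> verts E" using r0 by auto
  then obtain r1 where r1: "awalk z0 r1 w" using reaches by (auto simp: reachable_awalk)
  define r where "r = r0 @ r1"
  have r: "awalk v r w" using awalk_appendI[OF r0 r1] by (simp only: r_def)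
  have q_closed: "path_of q \<in> carrier L" "a \<in> carrier A" if "(a, q) \<in> set ys" for a q
    using that ys by (auto simp: path_terms_def intro: path_closed)
  have kill: "(ghost_path v r \<otimes>\<^bsub>L\<^esub> ghost_path ?u p) \<otimes>\<^bsub>L\<^esub> path_of q \<otimes>\<^bsub>L\<^esub> path v r = \<zero>\<^bsub>L\<^esub>"
    if "(a, q) \<in> set ys" for a q
  proof -
    have "ghost_path v r0 \<otimes>\<^bsub>L\<^esub> ((ghost_path ?u p \<otimes>\<^bsub>L\<^esub> path_of q) \<otimes>\<^bsub>L\<^esub> path v r0) = \<zero>\<^bsub>L\<^esub>"
      using kill0 that by force
    then have "ghost_path z0 r1 \<otimes>\<^bsub>L\<^esub>
      (ghost_path v r0 \<otimes>\<^bsub>L\<^esub> ((ghost_path ?u p \<otimes>\<^bsub>L\<^esub> path_of q) \<otimes>\<^bsub>L\<^esub> path v r0)) \<otimes>\<^bsub>L\<^esub> path z0 r1 = \<zero>\<^bsub>L\<^esub>"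
      using r1 by simp
    then show ?thesis
      using q_closed[OF that] p(1) r0 r1
      by (simp add: r_def L.m_assoc flip: path_append[OF r0 r1] ghost_path_append[OF r0 r1])
  qed
  let ?G = "ghost_path v r \<otimes>\<^bsub>L\<^esub> ghost_path ?u p"
  have G: "?G \<in> carrier L" using r p by simp
  have main: "?G \<otimes>\<^bsub>L\<^esub> path_of p \<otimes>\<^bsub>L\<^esub> path v r = vx w"
  proof -
    have "?G \<otimes>\<^bsub>L\<^esub> path_of p \<otimes>\<^bsub>L\<^esub> path v r
        = ghost_path v r \<otimes>\<^bsub>L\<^esub> ((ghost_path ?u p \<otimes>\<^bsub>L\<^esub> path_of p) \<otimes>\<^bsub>L\<^esub> path v r)"
      using r p by (simp add: L.m_assoc)
    then show ?thesis
      using r v by (simp add: ghost_path_path_self[OF p(1)] ghost_path_path_self[OF r] vertex_path[OF r])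
  qed
  \<comment> \<open>Units for all coefficients involved turn the paths into elements of \<open>R\<close>.\<close>
  let ?S = "insert c (fst ` set ys)"
  have S: "finite ?S" "?S \<subseteq> carrier A" using c q_closed by auto
  obtain a where a: "a \<in> carrier A" "\<forall>b\<in>?S. a \<otimes>\<^bsub>A\<^esub> b = b"
    using A.common_left_unit[OF s_unital_A S] by blast
  obtain b where b: "b \<in> carrier A" "\<forall>a\<in>?S. a \<otimes>\<^bsub>A\<^esub> b = a"
    using A.common_right_unit[OF s_unital_A S] by blast
  let ?s = "\<tau> a ?G" and ?t = "\<tau> b (path v r)"
  have st: "?s \<in> carrier R" "?t \<in> carrier R" using a b G r by auto
  have "?s \<otimes>\<^bsub>R\<^esub> \<tau> c (path_of p) \<otimes>\<^bsub>R\<^esub> ?t = \<tau> c (vx w)"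
    using a b c p G r main by (simp add: tensor_mult)
  moreover have "?s \<otimes>\<^bsub>R\<^esub> path_sum ys \<otimes>\<^bsub>R\<^esub> ?t = \<zero>\<^bsub>R\<^esub>"
  proof -
    have cl: "(case k of (a, q) \<Rightarrow> \<tau> a (path_of q)) \<in> carrier R" if "k \<in> set ys" for k
    proof -
      obtain d q where "k = (d, q)" by (cases k)
      then show ?thesis using that q_closed[of d q] by simp
    qed
    have "?s \<otimes>\<^bsub>R\<^esub> path_sum ys \<otimes>\<^bsub>R\<^esub> ?t
        = R.list_sum (\<lambda>k. ?s \<otimes>\<^bsub>R\<^esub> (case k of (a, q) \<Rightarrow> \<tau> a (path_of q)) \<otimes>\<^bsub>R\<^esub> ?t) ys"
      using cl st by (simp add: R.list_sum_mult_left R.list_sum_mult_right)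
    also have "\<dots> = \<zero>\<^bsub>R\<^esub>"
    proof (rule R.list_sum_zero)
      fix k assume "k \<in> set ys"
      moreover obtain d q where "k = (d, q)" by (cases k)
      ultimately have k: "k = (d, q)" "(d, q) \<in> set ys" by simp_all
      then have "d \<in> ?S" by force
      then show "?s \<otimes>\<^bsub>R\<^esub> (case k of (a, q) \<Rightarrow> \<tau> a (path_of q)) \<otimes>\<^bsub>R\<^esub> ?t = \<zero>\<^bsub>R\<^esub>"
        using k a b G r kill[OF k(2)] q_closed[OF k(2)] by (simp add: tensor_mult)
    qed
    finally show ?thesis .
  qed
  moreover have "?s \<otimes>\<^bsub>R\<^esub> x \<otimes>\<^bsub>R\<^esub> (y \<otimes>\<^bsub>R\<^esub> ?t)
      = ?s \<otimes>\<^bsub>R\<^esub> \<tau> c (path_of p) \<otimes>\<^bsub>R\<^esub> ?t \<oplus>\<^bsub>R\<^esub> ?s \<otimes>\<^bsub>R\<^esub> path_sum ys \<otimes>\<^bsub>R\<^esub> ?t \<oplus>\<^bsub>R\<^esub> ?s \<otimes>\<^bsub>R\<^esub> j \<otimes>\<^bsub>R\<^esub> ?t"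
  proof -
    have "?s \<otimes>\<^bsub>R\<^esub> x \<otimes>\<^bsub>R\<^esub> (y \<otimes>\<^bsub>R\<^esub> ?t) = ?s \<otimes>\<^bsub>R\<^esub> (x \<otimes>\<^bsub>R\<^esub> y) \<otimes>\<^bsub>R\<^esub> ?t"
      using x y st by (simp add: R.m_assoc)
    then show ?thesis
      using st c p j' ys path_closed[OF p(1)] path_sum_closed[OF ys]
      by (simp add: ts(2) xy R.l_distr R.r_distr)
  qed
  moreover have sj: "?s \<otimes>\<^bsub>R\<^esub> j \<otimes>\<^bsub>R\<^esub> ?t \<in> J" using j st by (auto intro: J_closed)
  ultimately have "?s \<otimes>\<^bsub>R\<^esub> x \<otimes>\<^bsub>R\<^esub> (y \<otimes>\<^bsub>R\<^esub> ?t) = ?s \<otimes>\<^bsub>R\<^esub> j \<otimes>\<^bsub>R\<^esub> ?t \<oplus>\<^bsub>R\<^esub> \<tau> c (vx w)"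
    using sj J_subset c w_vertex by (auto simp: R.a_comm)
  then have "?s \<otimes>\<^bsub>R\<^esub> x \<otimes>\<^bsub>R\<^esub> (y \<otimes>\<^bsub>R\<^esub> ?t) \<ominus>\<^bsub>R\<^esub> \<tau> c (vx w) = ?s \<otimes>\<^bsub>R\<^esub> j \<otimes>\<^bsub>R\<^esub> ?t"
    using sj J_subset c w_vertex by (simp add: R.minus_eq R.a_assoc R.r_neg subset_iff)
  moreover have "\<tau> c (vx w) \<notin> J" using path_in_J[OF c w_vertex _ p(1)] cp(2) by auto
  ultimately show ?thesis using sj st y c
    by (intro bexI[of _ ?s] bexI[of _ "y \<otimes>\<^bsub>R\<^esub> ?t"] bexI[of _ c]) auto
qed

end

section \<open>Every element absorbs itself\<close>

lemma right_idealI: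
  assumes "abelian_group R" "D \<subseteq> carrier R" "\<zero>\<^bsub>R\<^esub> \<in> D"
    and "\<And>a b. \<lbrakk>a \<in> D; b \<in> D\<rbrakk> \<Longrightarrow> a \<oplus>\<^bsub>R\<^esub> b \<in> D"
    and "\<And>a. a \<in> D \<Longrightarrow> \<ominus>\<^bsub>R\<^esub> a \<in> D"
    and "\<And>a x. \<lbrakk>a \<in> D; x \<in> carrier R\<rbrakk> \<Longrightarrow> a \<otimes>\<^bsub>R\<^esub> x \<in> D"
  shows "right_ideal D R"
proof -
  interpret abelian_group R by fact
  have "additive_subgroup D R"
    using assms by (intro additive_subgroupI add.subgroupI) (auto simp: a_inv_def)
  then show ?thesis using assms by (auto simp: right_ideal_def)
qed

text \<open>The cosets of the multiples of \<open>a\<close> form a nonzero right ideal of \<open>A/I\<close>.\<close>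

lemma idempotent_multiple_modulo_ideal:
  assumes A: "nonunital_ring A" and "s_unital A" and I: "two_sided_ideal I A"
    and idem: "right_ideals_contain_idempotents (A Quot I)"
    and a: "a \<in> carrier A" "a \<notin> I"
  shows "\<exists>b\<in>carrier A. a \<otimes>\<^bsub>A\<^esub> b \<notin> I \<and>
    (a \<otimes>\<^bsub>A\<^esub> b) \<otimes>\<^bsub>A\<^esub> (a \<otimes>\<^bsub>A\<^esub> b) \<ominus>\<^bsub>A\<^esub> a \<otimes>\<^bsub>A\<^esub> b \<in> I"
proof -
  define Q where "Q = A Quot I"
  interpret nonunital_ring A by fact
  interpret Q: ideal_quotient A I Q unfolding Q_def by (rule ideal_quotient_FactRing[OF A I])
  interpret S: nonunital_ring Q by (rule Q.quotient_nonunital_ring)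
  let ?D = "(\<lambda>b. Q.proj (a \<otimes>\<^bsub>A\<^esub> b)) ` carrier A"
  have "right_ideal ?D Q"
  proof (rule right_idealI[OF S.abelian_group_axioms])
    show "?D \<subseteq> carrier Q" using a by auto
    show "\<zero>\<^bsub>Q\<^esub> \<in> ?D"
      by (rule image_eqI[of _ _ "\<zero>\<^bsub>A\<^esub>"]) (use a in \<open>simp_all add: Q.proj_zero\<close>)
  next
    fix X Y assume "X \<in> ?D" "Y \<in> ?D"
    then obtain b c where "b \<in> carrier A" "c \<in> carrier A" "X = Q.proj (a \<otimes>\<^bsub>A\<^esub> b)" "Y = Q.proj (a \<otimes>\<^bsub>A\<^esub> c)"
      by blast
    then show "X \<oplus>\<^bsub>Q\<^esub> Y \<in> ?D"
      by (intro image_eqI[of _ _ "b \<oplus>\<^bsub>A\<^esub> c"]) (use a in \<open>simp_all add: Q.proj_add r_distr\<close>)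
  next
    fix X assume "X \<in> ?D"
    then obtain b where b: "b \<in> carrier A" "X = Q.proj (a \<otimes>\<^bsub>A\<^esub> b)" by blast
    then show "\<ominus>\<^bsub>Q\<^esub> X \<in> ?D"
      by (intro image_eqI[of _ _ "\<ominus>\<^bsub>A\<^esub> b"]) (use a in \<open>simp_all add: Q.proj_uminus r_minus\<close>)
    fix Y assume "Y \<in> carrier Q"
    then obtain y where "y \<in> carrier A" "Y = Q.proj y" using Q.proj_surj by blast
    then show "X \<otimes>\<^bsub>Q\<^esub> Y \<in> ?D"
      by (intro image_eqI[of _ _ "b \<otimes>\<^bsub>A\<^esub> y"]) (use a b in \<open>simp_all add: Q.proj_mult m_assoc\<close>)
  qed
  moreover have "?D \<noteq> {\<zero>\<^bsub>Q\<^esub>}"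
  proof -
    obtain c where "c \<in> carrier A" "a \<otimes>\<^bsub>A\<^esub> c = a" using \<open>s_unital A\<close> a unfolding s_unital_def by blast
    then have "Q.proj a \<in> ?D" by (intro image_eqI[of _ _ c]) simp_all
    moreover have "Q.proj a \<noteq> \<zero>\<^bsub>Q\<^esub>" using a by (simp add: Q.proj_eq_zero_iff)
    ultimately show ?thesis by blast
  qed
  ultimately have "\<exists>X\<in>?D. X \<noteq> \<zero>\<^bsub>Q\<^esub> \<and> X \<otimes>\<^bsub>Q\<^esub> X = X"
    by (intro idem[folded Q_def, unfolded right_ideals_contain_idempotents_def, rule_format] conjI)
  then obtain X where "X \<in> ?D" and X: "X \<noteq> \<zero>\<^bsub>Q\<^esub>" "X \<otimes>\<^bsub>Q\<^esub> X = X" by blast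
  then obtain b where b: "b \<in> carrier A" "X = Q.proj (a \<otimes>\<^bsub>A\<^esub> b)" by blast
  then show ?thesis using X a
    by (intro bexI[of _ b]) (simp_all add: Q.proj_mult Q.proj_eq_zero_iff Q.proj_eq_iff)
qed

context leavitt_tensor
begin

text \<open>If \<open>x\<close> did not absorb itself, it would compress modulo \<open>J\<close> to an infinite idempotent \<open>h\<close> outside the ideal \<open>J\<close> of absorbed
  elements; but \<open>x\<close> absorbs every such idempotent.\<close>

theorem element_absorbs_itself:
  assumes s_unital_A: "s_unital A"
    and idem: "\<And>I. two_sided_ideal I A \<Longrightarrow> right_ideals_contain_idempotents (A Quot I)"
    and row_finite: "\<And>v. v \<in> verts E \<Longrightarrow> finite (out_arcs E v)"
    and minimal: "\<And>H. \<lbrakk>H \<subseteq> verts E; hereditary E H; saturated E H\<rbrakk> \<Longrightarrow> H = {} \<or> H = verts E"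
    and branching: "e \<in> out_arcs E w" "f \<in> out_arcs E w" "e \<noteq> f"
    and reaches: "\<And>v. v \<in> verts E \<Longrightarrow> v \<rightarrow>\<^sup>*\<^bsub>E\<^esub> w"
    and x: "x \<in> carrier R"
  shows "x \<in> absorbed R x"
proof (rule ccontr)
  assume x_notin: "x \<notin> absorbed R x"
  let ?J = "absorbed R x"
  obtain l r where lr: "l \<in> carrier R" "r \<in> carrier R" "l \<otimes>\<^bsub>R\<^esub> x = x" "x \<otimes>\<^bsub>R\<^esub> r = x"
    using s_unital_R[OF s_unital_A] x unfolding s_unital_def by blast
  have J: "two_sided_ideal ?J R" by (rule R.two_sided_ideal_absorbed[OF x lr])
  interpret J: leavitt_tensor_ideal E A L R g \<tau> ?J w e f
    by unfold_locales (use assms J in auto)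
  note w = J.w_vertex
  obtain s t a where sta: "s \<in> carrier R" "t \<in> carrier R" "a \<in> carrier A"
    and red: "s \<otimes>\<^bsub>R\<^esub> x \<otimes>\<^bsub>R\<^esub> t \<ominus>\<^bsub>R\<^esub> \<tau> a (vx w) \<in> ?J" "\<tau> a (vx w) \<notin> ?J"
    using J.reduce_to_branching_vertex[OF x x_notin] by blast
  define I where "I = {a \<in> carrier A. \<tau> a (vx w) \<in> ?J}"
  have vx_mult: "\<tau> (b \<otimes>\<^bsub>A\<^esub> c) (vx w) = \<tau> b (vx w) \<otimes>\<^bsub>R\<^esub> \<tau> c (vx w)"
    if "b \<in> carrier A" "c \<in> carrier A" for b c
    using that w by (simp add: tensor_mult vertex_vertex)
  have I: "two_sided_ideal I A"
    by (rule two_sided_idealI[OF A.abelian_group_axioms])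
      (use w in \<open>auto simp: I_def vx_mult tensor_add_left tensor_minus_left\<close>)
  have "a \<notin> I" using red(2) by (simp add: I_def)
  from idempotent_multiple_modulo_ideal[OF A.nonunital_ring_axioms s_unital_A I idem[OF I] sta(3) this]
  obtain b where b: "b \<in> carrier A" "a \<otimes>\<^bsub>A\<^esub> b \<notin> I"
    "(a \<otimes>\<^bsub>A\<^esub> b) \<otimes>\<^bsub>A\<^esub> (a \<otimes>\<^bsub>A\<^esub> b) \<ominus>\<^bsub>A\<^esub> a \<otimes>\<^bsub>A\<^esub> b \<in> I" by blast
  define d where "d = a \<otimes>\<^bsub>A\<^esub> b"
  define h where "h = \<tau> d (vx w)"
  have d: "d \<in> carrier A" using sta b by (simp add: d_def)
  have h: "h \<in> carrier R" using d w by (simp add: h_def)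
  have h_notin: "h \<notin> ?J" using b(2) d by (simp add: I_def h_def flip: d_def)
  have hh: "h \<otimes>\<^bsub>R\<^esub> h \<ominus>\<^bsub>R\<^esub> h \<in> ?J"
    using b(3) d w unfolding I_def
    by (simp add: h_def vx_mult a_minus_def tensor_add_left tensor_minus_left flip: d_def)

  define Q where "Q = R Quot ?J"
  interpret Q: ideal_quotient R ?J Q
    unfolding Q_def by (rule ideal_quotient_FactRing[OF R.nonunital_ring_axioms J])
  interpret S: nonunital_ring Q by (rule Q.quotient_nonunital_ring)
  let ?p = "Q.proj"
  \<comment> \<open>Now \<open>s x t' = h\<close> modulo \<open>J\<close>.\<close>
  define t' where "t' = t \<otimes>\<^bsub>R\<^esub> \<tau> b (vx w)"
  have t': "t' \<in> carrier R" using sta b w by (simp add: t'_def)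
  have idem_h: "?p h \<otimes>\<^bsub>Q\<^esub> ?p h = ?p h"
    using hh h by (simp add: Q.proj_mult Q.proj_eq_iff)
  have sxt: "?p s \<otimes>\<^bsub>Q\<^esub> (?p x \<otimes>\<^bsub>Q\<^esub> ?p t') = ?p h"
  proof -
    have "?p s \<otimes>\<^bsub>Q\<^esub> (?p x \<otimes>\<^bsub>Q\<^esub> ?p t') = ?p (s \<otimes>\<^bsub>R\<^esub> x \<otimes>\<^bsub>R\<^esub> t) \<otimes>\<^bsub>Q\<^esub> ?p (\<tau> b (vx w))"
      using sta x b w by (simp add: t'_def Q.proj_mult R.m_assoc)
    also have "?p (s \<otimes>\<^bsub>R\<^esub> x \<otimes>\<^bsub>R\<^esub> t) = ?p (\<tau> a (vx w))"
      using red(1) sta x w by (simp add: Q.proj_eq_iff)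
    finally show ?thesis using sta b w by (simp add: Q.proj_mult h_def d_def vx_mult)
  qed

  \<comment> \<open>Two closed walks at \<open>w\<close> with different first edges make \<open>h\<close> properly infinite modulo \<open>J\<close>.\<close>
  have ef: "e \<in> arcs E" "f \<in> arcs E" "tail E e = w" "tail E f = w" using branching by auto
  obtain p q where pq: "awalk (head E e) p w" "awalk (head E f) q w"
    using reaches ef by (meson head_in_verts reachable_awalk)
  have walks: "awalk w (e # p) w" "awalk w (f # q) w" using pq ef by (auto simp: awalk_Cons_iff)
  have orth: "ghost_path w (a # p') \<otimes>\<^bsub>L\<^esub> path w (b # q') = \<zero>\<^bsub>L\<^esub>"
    if "awalk w (a # p') w" "awalk w (b # q') w" "a \<noteq> b" for a b p' q'
  proof -
    have ab: "a \<in> arcs E" "b \<in> arcs E" "awalk (head E a) p' w" "awalk (head E b) q' w"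
      using that by (auto simp: awalk_Cons_iff)
    have "ghost_path w (a # p') \<otimes>\<^bsub>L\<^esub> path w (b # q') = ghost_path (head E a) p' \<otimes>\<^bsub>L\<^esub>
      ((g (Ghost a) \<otimes>\<^bsub>L\<^esub> g (Edge b)) \<otimes>\<^bsub>L\<^esub> path (head E b) q')"
      using ab by (simp add: L.m_assoc)
    then show ?thesis using ab that(3) by (simp add: ghost_edge)
  qed
  define S' where "S' = (\<lambda>p. \<tau> d (ghost_path w p))"
  define T' where "T' = (\<lambda>p. \<tau> d (path w p))"
  have ST: "S' p \<in> carrier R" "T' p \<in> carrier R" if "awalk w p w" for p
    using that d by (auto simp: S'_def T'_def)
  have S'hT': "S' p \<otimes>\<^bsub>R\<^esub> h \<otimes>\<^bsub>R\<^esub> T' q = \<tau> (d \<otimes>\<^bsub>A\<^esub> d \<otimes>\<^bsub>A\<^esub> d) (ghost_path w p \<otimes>\<^bsub>L\<^esub> path w q)"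
    if "awalk w p w" "awalk w q w" for p q
    using that d w
    by (simp add: S'_def T'_def h_def tensor_mult L.m_assoc vertex_path)
  have cubes: "\<tau> (d \<otimes>\<^bsub>A\<^esub> d \<otimes>\<^bsub>A\<^esub> d) (vx w) = h \<otimes>\<^bsub>R\<^esub> h \<otimes>\<^bsub>R\<^esub> h"
    using d by (simp add: h_def vx_mult)
  have diag_entry: "S' p \<otimes>\<^bsub>R\<^esub> h \<otimes>\<^bsub>R\<^esub> T' p \<ominus>\<^bsub>R\<^esub> h \<in> ?J" if p: "awalk w p w" for p
  proof -
    have "?p (S' p \<otimes>\<^bsub>R\<^esub> h \<otimes>\<^bsub>R\<^esub> T' p) = ?p h"
      using S'hT'[OF p p] h idem_h by (simp add: ghost_path_path_self[OF p] cubes flip: Q.proj_mult)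
    then show ?thesis using ST[OF p] h by (simp add: Q.proj_eq_iff)
  qed
  have "h \<in> ?J"
  proof (rule R.absorbs_idempotent_modulo_absorbed
      [where u = "h \<otimes>\<^bsub>R\<^esub> s" and w = "t' \<otimes>\<^bsub>R\<^esub> h" and l = l and r = r and x = x and f = h
        and ?s1.0 = "S' (e # p)" and ?t1.0 = "T' (e # p)" and ?s2.0 = "S' (f # q)" and ?t2.0 = "T' (f # q)"])
    have "?p (h \<otimes>\<^bsub>R\<^esub> s \<otimes>\<^bsub>R\<^esub> x \<otimes>\<^bsub>R\<^esub> (t' \<otimes>\<^bsub>R\<^esub> h)) = ?p h \<otimes>\<^bsub>Q\<^esub> ((?p s \<otimes>\<^bsub>Q\<^esub> (?p x \<otimes>\<^bsub>Q\<^esub> ?p t')) \<otimes>\<^bsub>Q\<^esub> ?p h)"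
      using sta t' h x by (simp add: S.m_assoc flip: Q.proj_mult)
    then have "?p (h \<otimes>\<^bsub>R\<^esub> s \<otimes>\<^bsub>R\<^esub> x \<otimes>\<^bsub>R\<^esub> (t' \<otimes>\<^bsub>R\<^esub> h)) = ?p h" by (simp add: sxt idem_h)
    then show "h \<otimes>\<^bsub>R\<^esub> s \<otimes>\<^bsub>R\<^esub> x \<otimes>\<^bsub>R\<^esub> (t' \<otimes>\<^bsub>R\<^esub> h) \<ominus>\<^bsub>R\<^esub> h \<in> ?J"
      using sta t' h x by (simp add: Q.proj_eq_iff)
    have "?p (h \<otimes>\<^bsub>R\<^esub> (h \<otimes>\<^bsub>R\<^esub> s)) = ?p (h \<otimes>\<^bsub>R\<^esub> s)" "?p (t' \<otimes>\<^bsub>R\<^esub> h \<otimes>\<^bsub>R\<^esub> h) = ?p (t' \<otimes>\<^bsub>R\<^esub> h)"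
      using sta t' h idem_h by (simp_all add: S.m_assoc flip: Q.proj_mult) (simp flip: S.m_assoc add: idem_h)
    then show "h \<otimes>\<^bsub>R\<^esub> (h \<otimes>\<^bsub>R\<^esub> s) \<ominus>\<^bsub>R\<^esub> h \<otimes>\<^bsub>R\<^esub> s \<in> ?J" "t' \<otimes>\<^bsub>R\<^esub> h \<otimes>\<^bsub>R\<^esub> h \<ominus>\<^bsub>R\<^esub> t' \<otimes>\<^bsub>R\<^esub> h \<in> ?J"
      using sta t' h by (simp_all add: Q.proj_eq_iff)
    have zero: "\<zero>\<^bsub>R\<^esub> \<in> ?J" by (rule J.J_closed)
    show "S' (e # p) \<otimes>\<^bsub>R\<^esub> h \<otimes>\<^bsub>R\<^esub> T' (f # q) \<in> ?J" "S' (f # q) \<otimes>\<^bsub>R\<^esub> h \<otimes>\<^bsub>R\<^esub> T' (e # p) \<in> ?J"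
      using walks d zero orth[OF walks branching(3)] orth[OF walks(2,1) branching(3)[symmetric]]
      by (simp_all only: S'hT' tensor_zero_right A.m_closed)
  qed (use x sta t' h lr ST walks diag_entry in simp_all)
  then show False using h_notin by simp
qed

end

section \<open>Semigroup algebras and quotients of algebras\<close>

lemma semigroup_algebra_simps:
  "carrier (semigroup_algebra K S) =
    {f. (\<forall>s\<in>carrier S. f s \<in> carrier K) \<and> (\<forall>s. s \<notin> carrier S \<longrightarrow> f s = \<zero>\<^bsub>K\<^esub>) \<and>
      finite {s. f s \<noteq> \<zero>\<^bsub>K\<^esub>}}"
  "f \<otimes>\<^bsub>semigroup_algebra K S\<^esub> h =
    (\<lambda>s. \<Oplus>\<^bsub>K\<^esub>p\<in>{(t, u). f t \<noteq> \<zero>\<^bsub>K\<^esub> \<and> h u \<noteq> \<zero>\<^bsub>K\<^esub> \<and> t \<otimes>\<^bsub>S\<^esub> u = s}.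
      f (fst p) \<otimes>\<^bsub>K\<^esub> h (snd p))"
  "\<zero>\<^bsub>semigroup_algebra K S\<^esub> = (\<lambda>s. \<zero>\<^bsub>K\<^esub>)"
  "f \<oplus>\<^bsub>semigroup_algebra K S\<^esub> h = (\<lambda>s. f s \<oplus>\<^bsub>K\<^esub> h s)"
  "c \<odot>\<^bsub>semigroup_algebra K S\<^esub> f = (\<lambda>s. c \<otimes>\<^bsub>K\<^esub> f s)"
  by (simp_all add: semigroup_algebra_def)

locale semigroup_over_cring = K: cring K for K (structure) and S :: "('s, 'n) monoid_scheme" +
  assumes semigroup_closed [simp]: "\<lbrakk>s \<in> carrier S; t \<in> carrier S\<rbrakk> \<Longrightarrow> s \<otimes>\<^bsub>S\<^esub> t \<in> carrier S"
    and semigroup_assoc: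
      "\<lbrakk>s \<in> carrier S; t \<in> carrier S; u \<in> carrier S\<rbrakk> \<Longrightarrow> s \<otimes>\<^bsub>S\<^esub> t \<otimes>\<^bsub>S\<^esub> u = s \<otimes>\<^bsub>S\<^esub> (t \<otimes>\<^bsub>S\<^esub> u)"
begin

abbreviation "F \<equiv> semigroup_algebra K S"
abbreviation "\<delta> \<equiv> basis_elem K"

definition supp :: "('s \<Rightarrow> 'a) \<Rightarrow> 's set" where "supp f = {s. f s \<noteq> \<zero>}"

lemma carrier_F: "f \<in> carrier F \<longleftrightarrow> (\<forall>s. f s \<in> carrier K) \<and> supp f \<subseteq> carrier S \<and> finite (supp f)"
  unfolding semigroup_algebra_simps supp_def by auto

lemma F_value [simp]: "f \<in> carrier F \<Longrightarrow> f s \<in> carrier K"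
  by (simp add: carrier_F)

lemma F_supp: "f \<in> carrier F \<Longrightarrow> finite (supp f)" "f \<in> carrier F \<Longrightarrow> supp f \<subseteq> carrier S"
  by (simp_all add: carrier_F)

lemma add_F: "f \<oplus>\<^bsub>F\<^esub> h = (\<lambda>s. f s \<oplus> h s)"
  by (rule semigroup_algebra_simps)

lemma zero_F: "\<zero>\<^bsub>F\<^esub> = (\<lambda>s. \<zero>)"
  by (rule semigroup_algebra_simps)

lemma smult_F: "c \<odot>\<^bsub>F\<^esub> f = (\<lambda>s. c \<otimes> f s)"
  by (rule semigroup_algebra_simps)

lemma abelian_group_F: "abelian_group F"
proof (rule abelian_groupI)
  fix f h k assume "f \<in> carrier F" "h \<in> carrier F" "k \<in> carrier F"
  then show "f \<oplus>\<^bsub>F\<^esub> h \<oplus>\<^bsub>F\<^esub> k = f \<oplus>\<^bsub>F\<^esub> (h \<oplus>\<^bsub>F\<^esub> k)" "f \<oplus>\<^bsub>F\<^esub> h = h \<oplus>\<^bsub>F\<^esub> f"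
    by (simp_all add: add_F K.add.m_ac)
next
  fix f h assume f: "f \<in> carrier F" and h: "h \<in> carrier F"
  have "supp (f \<oplus>\<^bsub>F\<^esub> h) \<subseteq> supp f \<union> supp h" by (auto simp: supp_def add_F)
  then show "f \<oplus>\<^bsub>F\<^esub> h \<in> carrier F"
    using f h unfolding carrier_F by (auto simp: add_F intro: finite_subset)
next
  show zero: "\<zero>\<^bsub>F\<^esub> \<in> carrier F" by (simp add: carrier_F zero_F supp_def)
  fix f assume f: "f \<in> carrier F"
  show "\<zero>\<^bsub>F\<^esub> \<oplus>\<^bsub>F\<^esub> f = f" using f by (simp add: add_F zero_F)
  have "supp (\<lambda>s. \<ominus> f s) = supp f" using f by (auto simp: supp_def)
  then have "(\<lambda>s. \<ominus> f s) \<in> carrier F" using f by (simp add: carrier_F)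
  moreover have "(\<lambda>s. \<ominus> f s) \<oplus>\<^bsub>F\<^esub> f = \<zero>\<^bsub>F\<^esub>" using f by (simp add: add_F zero_F K.l_neg)
  ultimately show "\<exists>h\<in>carrier F. h \<oplus>\<^bsub>F\<^esub> f = \<zero>\<^bsub>F\<^esub>" by blast
qed

lemma module_F: "Module.module K F"
proof (rule moduleI[OF K.cring_axioms abelian_group_F])
  fix c f assume c: "c \<in> carrier K" and f: "f \<in> carrier F"
  have "supp (c \<odot>\<^bsub>F\<^esub> f) \<subseteq> supp f" using c by (auto simp: supp_def smult_F)
  then show "c \<odot>\<^bsub>F\<^esub> f \<in> carrier F"
    using c f unfolding carrier_F by (auto simp: smult_F intro: finite_subset)
qed (simp_all add: add_F smult_F K.l_distr K.r_distr K.m_assoc)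

interpretation F: Module.module K F by (rule module_F)

lemma mult_F_def: "(f \<otimes>\<^bsub>F\<^esub> h) s =
    (\<Oplus>p\<in>{(t, u). f t \<noteq> \<zero> \<and> h u \<noteq> \<zero> \<and> t \<otimes>\<^bsub>S\<^esub> u = s}. f (fst p) \<otimes> h (snd p))"
  unfolding semigroup_algebra_simps(2) by (rule refl)

text \<open>Summing over a fixed product of finite sets, instead of over the pairs where both functions are
  nonzero, makes the product visibly additive in each factor.\<close>

lemma mult_F:
  assumes "f \<in> carrier F" "h \<in> carrier F" "finite T" "finite U" "supp f \<subseteq> T" "supp h \<subseteq> U"
  shows "(f \<otimes>\<^bsub>F\<^esub> h) s =
    (\<Oplus>p\<in>T \<times> U. if fst p \<otimes>\<^bsub>S\<^esub> snd p = s then f (fst p) \<otimes> h (snd p) else \<zero>)"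
proof -
  let ?P = "{(t, u). f t \<noteq> \<zero> \<and> h u \<noteq> \<zero> \<and> t \<otimes>\<^bsub>S\<^esub> u = s}"
  have "(f \<otimes>\<^bsub>F\<^esub> h) s = (\<Oplus>p\<in>?P. f (fst p) \<otimes> h (snd p))"
    by (rule mult_F_def)
  also have "\<dots> = (\<Oplus>p\<in>T \<times> U. if fst p \<otimes>\<^bsub>S\<^esub> snd p = s then f (fst p) \<otimes> h (snd p) else \<zero>)"
  proof (rule K.add.finprod_mono_neutral_cong_left)
    show "?P \<subseteq> T \<times> U" using assms(5,6) by (auto simp: supp_def)
    fix p assume p: "p \<in> T \<times> U - ?P"
    then show "(if fst p \<otimes>\<^bsub>S\<^esub> snd p = s then f (fst p) \<otimes> h (snd p) else \<zero>) = \<zero>"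
      using assms(1,2) by (cases p) auto
  qed (use assms in auto)
  finally show ?thesis .
qed

lemma mult_F_closed [simp]:
  assumes f: "f \<in> carrier F" and h: "h \<in> carrier F" shows "f \<otimes>\<^bsub>F\<^esub> h \<in> carrier F"
proof -
  let ?P = "\<lambda>s. {(t, u). f t \<noteq> \<zero> \<and> h u \<noteq> \<zero> \<and> t \<otimes>\<^bsub>S\<^esub> u = s}"
  have eq: "(f \<otimes>\<^bsub>F\<^esub> h) s = (\<Oplus>p\<in>?P s. f (fst p) \<otimes> h (snd p))" for s
    by (rule mult_F_def)
  have "supp (f \<otimes>\<^bsub>F\<^esub> h) \<subseteq> (\<lambda>(t, u). t \<otimes>\<^bsub>S\<^esub> u) ` (supp f \<times> supp h)"
  proof
    fix s assume "s \<in> supp (f \<otimes>\<^bsub>F\<^esub> h)"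
    then have "?P s \<noteq> {}" unfolding supp_def eq by (metis (mono_tags, lifting) K.finsum_empty mem_Collect_eq)
    then show "s \<in> (\<lambda>(t, u). t \<otimes>\<^bsub>S\<^esub> u) ` (supp f \<times> supp h)" by (force simp: supp_def)
  qed
  moreover have "\<dots> \<subseteq> carrier S" using subsetD[OF F_supp(2)[OF f]] subsetD[OF F_supp(2)[OF h]] by auto
  moreover have "finite ((\<lambda>(t, u). t \<otimes>\<^bsub>S\<^esub> u) ` (supp f \<times> supp h))"
    using F_supp(1)[OF f] F_supp(1)[OF h] by simp
  moreover have "(f \<otimes>\<^bsub>F\<^esub> h) s \<in> carrier K" for s
    using f h unfolding eq by (intro K.finsum_closed) auto
  ultimately show ?thesis unfolding carrier_F by (meson finite_subset subset_trans)
qed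

lemma mult_F_l_distr:
  assumes f: "f \<in> carrier F" and h: "h \<in> carrier F" and k: "k \<in> carrier F"
  shows "(f \<oplus>\<^bsub>F\<^esub> h) \<otimes>\<^bsub>F\<^esub> k = f \<otimes>\<^bsub>F\<^esub> k \<oplus>\<^bsub>F\<^esub> h \<otimes>\<^bsub>F\<^esub> k"
proof
  fix s
  let ?T = "supp f \<union> supp h \<union> supp (f \<oplus>\<^bsub>F\<^esub> h)"
  have fh: "f \<oplus>\<^bsub>F\<^esub> h \<in> carrier F" using f h by simp
  have T: "finite ?T" "finite (supp k)" using F_supp f h k fh by auto
  have "((f \<oplus>\<^bsub>F\<^esub> h) \<otimes>\<^bsub>F\<^esub> k) s = (\<Oplus>p\<in>?T \<times> supp k.
      (if fst p \<otimes>\<^bsub>S\<^esub> snd p = s then f (fst p) \<otimes> k (snd p) else \<zero>) \<oplus>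
      (if fst p \<otimes>\<^bsub>S\<^esub> snd p = s then h (fst p) \<otimes> k (snd p) else \<zero>))"
    unfolding mult_F[OF fh k T Un_upper2 subset_refl]
    using f h k by (intro K.finsum_cong') (auto simp: add_F K.l_distr)
  also have "\<dots> = (f \<otimes>\<^bsub>F\<^esub> k) s \<oplus> (h \<otimes>\<^bsub>F\<^esub> k) s"
  proof -
    have "(f \<otimes>\<^bsub>F\<^esub> k) s = (\<Oplus>p\<in>?T \<times> supp k. if fst p \<otimes>\<^bsub>S\<^esub> snd p = s then f (fst p) \<otimes> k (snd p) else \<zero>)"
      "(h \<otimes>\<^bsub>F\<^esub> k) s = (\<Oplus>p\<in>?T \<times> supp k. if fst p \<otimes>\<^bsub>S\<^esub> snd p = s then h (fst p) \<otimes> k (snd p) else \<zero>)"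
      by (rule mult_F[OF f k T _ subset_refl], blast) (rule mult_F[OF h k T _ subset_refl], blast)
    then show ?thesis using f h k by (simp only:) (intro K.finsum_addf; auto)
  qed
  finally show "((f \<oplus>\<^bsub>F\<^esub> h) \<otimes>\<^bsub>F\<^esub> k) s = (f \<otimes>\<^bsub>F\<^esub> k \<oplus>\<^bsub>F\<^esub> h \<otimes>\<^bsub>F\<^esub> k) s"
    by (simp add: add_F)
qed

lemma mult_F_r_distr:
  assumes f: "f \<in> carrier F" and h: "h \<in> carrier F" and k: "k \<in> carrier F"
  shows "k \<otimes>\<^bsub>F\<^esub> (f \<oplus>\<^bsub>F\<^esub> h) = k \<otimes>\<^bsub>F\<^esub> f \<oplus>\<^bsub>F\<^esub> k \<otimes>\<^bsub>F\<^esub> h"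
proof
  fix s
  let ?T = "supp f \<union> supp h \<union> supp (f \<oplus>\<^bsub>F\<^esub> h)"
  have fh: "f \<oplus>\<^bsub>F\<^esub> h \<in> carrier F" using f h by simp
  have T: "finite (supp k)" "finite ?T" using F_supp f h k fh by auto
  have "(k \<otimes>\<^bsub>F\<^esub> (f \<oplus>\<^bsub>F\<^esub> h)) s = (\<Oplus>p\<in>supp k \<times> ?T.
      (if fst p \<otimes>\<^bsub>S\<^esub> snd p = s then k (fst p) \<otimes> f (snd p) else \<zero>) \<oplus>
      (if fst p \<otimes>\<^bsub>S\<^esub> snd p = s then k (fst p) \<otimes> h (snd p) else \<zero>))"
    unfolding mult_F[OF k fh T subset_refl Un_upper2]
    using f h k by (intro K.finsum_cong') (auto simp: add_F K.r_distr)
  also have "\<dots> = (k \<otimes>\<^bsub>F\<^esub> f) s \<oplus> (k \<otimes>\<^bsub>F\<^esub> h) s"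
  proof -
    have "(k \<otimes>\<^bsub>F\<^esub> f) s = (\<Oplus>p\<in>supp k \<times> ?T. if fst p \<otimes>\<^bsub>S\<^esub> snd p = s then k (fst p) \<otimes> f (snd p) else \<zero>)"
      "(k \<otimes>\<^bsub>F\<^esub> h) s = (\<Oplus>p\<in>supp k \<times> ?T. if fst p \<otimes>\<^bsub>S\<^esub> snd p = s then k (fst p) \<otimes> h (snd p) else \<zero>)"
      by (rule mult_F[OF k f T subset_refl], blast) (rule mult_F[OF k h T subset_refl], blast)
    then show ?thesis using f h k by (simp only:) (intro K.finsum_addf; auto)
  qed
  finally show "(k \<otimes>\<^bsub>F\<^esub> (f \<oplus>\<^bsub>F\<^esub> h)) s = (k \<otimes>\<^bsub>F\<^esub> f \<oplus>\<^bsub>F\<^esub> k \<otimes>\<^bsub>F\<^esub> h) s"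
    by (simp add: add_F)
qed

lemma mult_F_smult:
  assumes c: "c \<in> carrier K" and f: "f \<in> carrier F" and h: "h \<in> carrier F"
  shows "(c \<odot>\<^bsub>F\<^esub> f) \<otimes>\<^bsub>F\<^esub> h = c \<odot>\<^bsub>F\<^esub> (f \<otimes>\<^bsub>F\<^esub> h)" "f \<otimes>\<^bsub>F\<^esub> (c \<odot>\<^bsub>F\<^esub> h) = c \<odot>\<^bsub>F\<^esub> (f \<otimes>\<^bsub>F\<^esub> h)"
proof -
  have supp: "supp (c \<odot>\<^bsub>F\<^esub> k) \<subseteq> supp k" if "k \<in> carrier F" for k
    using c by (auto simp: supp_def smult_F)
  have fin: "finite (supp f)" "finite (supp h)" using f h by (simp_all add: F_supp)
  have cl: "c \<odot>\<^bsub>F\<^esub> f \<in> carrier F" "c \<odot>\<^bsub>F\<^esub> h \<in> carrier F" using c f h by simp_all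
  let ?t = "\<lambda>s p. if fst p \<otimes>\<^bsub>S\<^esub> snd p = s then f (fst p) \<otimes> h (snd p) else \<zero>"
  have sum: "c \<otimes> (f \<otimes>\<^bsub>F\<^esub> h) s = (\<Oplus>p\<in>supp f \<times> supp h. c \<otimes> ?t s p)" for s
    unfolding mult_F[OF f h fin subset_refl subset_refl]
    using c f h fin by (intro K.finsum_rdistr) auto
  show "(c \<odot>\<^bsub>F\<^esub> f) \<otimes>\<^bsub>F\<^esub> h = c \<odot>\<^bsub>F\<^esub> (f \<otimes>\<^bsub>F\<^esub> h)"
  proof
    fix s
    show "((c \<odot>\<^bsub>F\<^esub> f) \<otimes>\<^bsub>F\<^esub> h) s = (c \<odot>\<^bsub>F\<^esub> (f \<otimes>\<^bsub>F\<^esub> h)) s"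
      unfolding mult_F[OF cl(1) h fin supp[OF f] subset_refl] smult_F[of c "f \<otimes>\<^bsub>F\<^esub> h"] sum
      using c f h by (intro K.finsum_cong') (auto simp: smult_F K.m_assoc)
  qed
  show "f \<otimes>\<^bsub>F\<^esub> (c \<odot>\<^bsub>F\<^esub> h) = c \<odot>\<^bsub>F\<^esub> (f \<otimes>\<^bsub>F\<^esub> h)"
  proof
    fix s
    show "(f \<otimes>\<^bsub>F\<^esub> (c \<odot>\<^bsub>F\<^esub> h)) s = (c \<odot>\<^bsub>F\<^esub> (f \<otimes>\<^bsub>F\<^esub> h)) s"
      unfolding mult_F[OF f cl(2) fin subset_refl supp[OF h]] smult_F[of c "f \<otimes>\<^bsub>F\<^esub> h"] sum
      using c f h by (intro K.finsum_cong') (auto simp: smult_F K.m_lcomm)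
  qed
qed

lemma basis_closed [simp]: "s \<in> carrier S \<Longrightarrow> \<delta> s \<in> carrier F"
  by (auto simp: carrier_F basis_elem_def supp_def)

lemma basis_mult:
  assumes "s \<in> carrier S" "t \<in> carrier S" shows "\<delta> s \<otimes>\<^bsub>F\<^esub> \<delta> t = \<delta> (s \<otimes>\<^bsub>S\<^esub> t)"
proof
  fix u
  have st: "{s} \<times> {t} = {(s, t)}" by auto
  have "(\<delta> s \<otimes>\<^bsub>F\<^esub> \<delta> t) u =
      (\<Oplus>p\<in>{s} \<times> {t}. if fst p \<otimes>\<^bsub>S\<^esub> snd p = u then \<delta> s (fst p) \<otimes> \<delta> t (snd p) else \<zero>)"
    using assms by (intro mult_F basis_closed) (auto simp: supp_def basis_elem_def split: if_splits)
  also have "\<dots> = \<delta> (s \<otimes>\<^bsub>S\<^esub> t) u"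
    unfolding st by (simp add: basis_elem_def)
  finally show "(\<delta> s \<otimes>\<^bsub>F\<^esub> \<delta> t) u = \<delta> (s \<otimes>\<^bsub>S\<^esub> t) u" .
qed

text \<open>Statements that are additive in \<open>f\<close>, such as associativity of the product and membership in ideals,
  reduce to multiples of basis elements.\<close>

lemma F_induct [consumes 1, case_names zero basis add]:
  assumes f: "f \<in> carrier F" and "P \<zero>\<^bsub>F\<^esub>"
    and basis: "\<And>c s. \<lbrakk>c \<in> carrier K; s \<in> carrier S\<rbrakk> \<Longrightarrow> P (c \<odot>\<^bsub>F\<^esub> \<delta> s)"
    and add: "\<And>f h. \<lbrakk>f \<in> carrier F; h \<in> carrier F; P f; P h\<rbrakk> \<Longrightarrow> P (f \<oplus>\<^bsub>F\<^esub> h)"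
  shows "P f"
proof -
  have "P f" if "finite T" "f \<in> carrier F" "supp f \<subseteq> T" for T f
    using that
  proof (induction T arbitrary: f rule: finite_induct)
    case empty
    then have "f = \<zero>\<^bsub>F\<^esub>" by (auto simp: supp_def zero_F)
    then show ?case using assms(2) by simp
  next
    case (insert s T)
    show ?case
    proof (cases "s \<in> carrier S")
      case False
      then have "supp f \<subseteq> T" using F_supp(2)[OF insert.prems(1)] insert.prems(2) by auto
      then show ?thesis using insert by blast
    next
      case True
      define h where "h = f(s := \<zero>)"
      have "supp h \<subseteq> supp f" "supp h \<subseteq> T" using insert.prems by (auto simp: supp_def h_def)
      moreover have "h t \<in> carrier K" for t using insert.prems(1) by (simp add: h_def)
      ultimately have h: "h \<in> carrier F" "P h"
        using insert.IH[of h] F_supp[OF insert.prems(1)] unfolding carrier_F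
        by (meson finite_subset subset_trans)+
      have "f = f s \<odot>\<^bsub>F\<^esub> \<delta> s \<oplus>\<^bsub>F\<^esub> h"
        using insert.prems(1) by (auto simp: add_F smult_F basis_elem_def h_def)
      moreover have "P (f s \<odot>\<^bsub>F\<^esub> \<delta> s \<oplus>\<^bsub>F\<^esub> h)"
        using h basis True insert.prems(1) by (intro add) auto
      ultimately show ?thesis by simp
    qed
  qed
  then show ?thesis using f F_supp(1)[OF f] by blast
qed

lemma mult_F_zero:
  assumes "f \<in> carrier F" shows "\<zero>\<^bsub>F\<^esub> \<otimes>\<^bsub>F\<^esub> f = \<zero>\<^bsub>F\<^esub>" "f \<otimes>\<^bsub>F\<^esub> \<zero>\<^bsub>F\<^esub> = \<zero>\<^bsub>F\<^esub>"
  using assms mult_F_smult[of \<zero> "\<zero>\<^bsub>F\<^esub>" f] mult_F_smult[of \<zero> f "\<zero>\<^bsub>F\<^esub>"] by simp_all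

lemma mult_F_assoc:
  assumes "f \<in> carrier F" "h \<in> carrier F" "k \<in> carrier F"
  shows "f \<otimes>\<^bsub>F\<^esub> h \<otimes>\<^bsub>F\<^esub> k = f \<otimes>\<^bsub>F\<^esub> (h \<otimes>\<^bsub>F\<^esub> k)"
  using assms(1)
proof (induction f rule: F_induct)
  case zero
  show ?case using assms by (simp add: mult_F_zero)
next
  case (add f f')
  then show ?case using assms by (simp add: mult_F_l_distr)
next
  case (basis c s)
  show ?case using assms(2)
  proof (induction h rule: F_induct)
    case zero
    show ?case using assms basis by (simp add: mult_F_zero)
  next
    case (add h h')
    then show ?case using assms basis by (simp add: mult_F_l_distr mult_F_r_distr)
  next
    case (basis d t)
    show ?case using assms(3)
    proof (induction k rule: F_induct)
      case zero
      show ?case using \<open>c \<in> carrier K\<close> \<open>s \<in> carrier S\<close> basis by (simp add: mult_F_zero)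
    next
      case (add k k')
      then show ?case using \<open>c \<in> carrier K\<close> \<open>s \<in> carrier S\<close> basis by (simp add: mult_F_r_distr)
    next
      case (basis b u)
      then show ?case using \<open>c \<in> carrier K\<close> \<open>s \<in> carrier S\<close> \<open>d \<in> carrier K\<close> \<open>t \<in> carrier S\<close>
        by (simp add: mult_F_smult basis_mult semigroup_assoc)
    qed
  qed
qed

lemma nonunital_algebra_F: "nonunital_algebra K F"
proof -
  have "nonunital_ring F"
    by (intro nonunital_ring.intro nonunital_ring_axioms.intro abelian_group_F)
      (simp_all add: mult_F_assoc mult_F_l_distr mult_F_r_distr)
  then show ?thesis
    by (intro nonunital_algebra.intro nonunital_algebra_axioms.intro module_F)
      (simp_all add: mult_F_smult)
qed

end

subsection \<open>Quotients\<close>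

lemma quotient_algebra_simps:
  "carrier (quotient_algebra A I) = a_rcosets\<^bsub>A\<^esub> I" "mult (quotient_algebra A I) = rcoset_mult A I"
  "\<zero>\<^bsub>quotient_algebra A I\<^esub> = I" "add (quotient_algebra A I) = set_add A"
  by (simp_all add: quotient_algebra_def)

lemma ideal_quotient_quotient_algebra:
  assumes "nonunital_ring A" "two_sided_ideal I A"
  shows "ideal_quotient A I (quotient_algebra A I)"
  using assms by (simp add: ideal_quotient_def ideal_quotient_axioms_def quotient_algebra_simps)

text \<open>The union in the definition of the scalar multiple of a coset is taken over equal cosets.\<close>

lemma quotient_algebra_smult:
  assumes A: "nonunital_algebra K A" and I: "algebra_ideal I K A"
    and c: "c \<in> carrier K" and x: "x \<in> carrier A"
  shows "c \<odot>\<^bsub>quotient_algebra A I\<^esub> (I +>\<^bsub>A\<^esub> x) = I +>\<^bsub>A\<^esub> (c \<odot>\<^bsub>A\<^esub> x)"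
proof -
  interpret nonunital_algebra K A by fact
  have ring: "nonunital_ring A" ..
  interpret Q: ideal_quotient A I "quotient_algebra A I"
    using I ring by (intro ideal_quotient_quotient_algebra) (simp_all add: algebra_ideal_def)
  have "I +>\<^bsub>A\<^esub> (c \<odot>\<^bsub>A\<^esub> y) = I +>\<^bsub>A\<^esub> (c \<odot>\<^bsub>A\<^esub> x)" if y: "y \<in> I +>\<^bsub>A\<^esub> x" for y
  proof -
    obtain i where i: "i \<in> I" "y = i \<oplus>\<^bsub>A\<^esub> x" using y by (auto simp: a_r_coset_def')
    have ci: "c \<odot>\<^bsub>A\<^esub> i \<in> I" using I c i by (auto simp: algebra_ideal_def submodule.smult_closed)
    have "c \<odot>\<^bsub>A\<^esub> y = c \<odot>\<^bsub>A\<^esub> i \<oplus>\<^bsub>A\<^esub> c \<odot>\<^bsub>A\<^esub> x" using i c x by (simp add: smult_r_distr)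
    then have "I +>\<^bsub>A\<^esub> (c \<odot>\<^bsub>A\<^esub> y) = Q.proj (c \<odot>\<^bsub>A\<^esub> i) \<oplus>\<^bsub>quotient_algebra A I\<^esub> Q.proj (c \<odot>\<^bsub>A\<^esub> x)"
      using ci c x by (simp add: Q.proj_add)
    also have "Q.proj (c \<odot>\<^bsub>A\<^esub> i) = Q.proj \<zero>\<^bsub>A\<^esub>"
      using ci by (simp add: Q.proj_zero Q.proj_eq_zero_iff)
    finally show ?thesis using c x by (simp add: Q.proj_add)
  qed
  moreover have "x \<in> I +>\<^bsub>A\<^esub> x" using x by (rule Q.a_rcos_self)
  ultimately have "(\<Union>y\<in>I +>\<^bsub>A\<^esub> x. I +>\<^bsub>A\<^esub> (c \<odot>\<^bsub>A\<^esub> y)) = I +>\<^bsub>A\<^esub> (c \<odot>\<^bsub>A\<^esub> x)" by blast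
  then show ?thesis by (simp add: quotient_algebra_def)
qed

lemma nonunital_algebra_quotient:
  assumes A: "nonunital_algebra K A" and I: "algebra_ideal I K A"
  shows "nonunital_algebra K (quotient_algebra A I)"
proof -
  let ?Q = "quotient_algebra A I"
  interpret nonunital_algebra K A by fact
  have ring: "nonunital_ring A" ..
  interpret Q: ideal_quotient A I ?Q
    using I ring by (intro ideal_quotient_quotient_algebra) (simp_all add: algebra_ideal_def)
  interpret QR: nonunital_ring ?Q by (rule Q.quotient_nonunital_ring)
  note smult = quotient_algebra_smult[OF A I]
  have "Module.module K ?Q"
  proof (rule moduleI[OF R.cring_axioms QR.abelian_group_axioms])
    fix c X assume c: "c \<in> carrier K" and "X \<in> carrier ?Q"
    then obtain x where x: "x \<in> carrier A" "X = Q.proj x" using Q.proj_surj by blast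
    then show "c \<odot>\<^bsub>?Q\<^esub> X \<in> carrier ?Q" using c by (simp add: smult)
    fix d assume d: "d \<in> carrier K"
    show "(c \<oplus>\<^bsub>K\<^esub> d) \<odot>\<^bsub>?Q\<^esub> X = c \<odot>\<^bsub>?Q\<^esub> X \<oplus>\<^bsub>?Q\<^esub> d \<odot>\<^bsub>?Q\<^esub> X"
      "(c \<otimes>\<^bsub>K\<^esub> d) \<odot>\<^bsub>?Q\<^esub> X = c \<odot>\<^bsub>?Q\<^esub> (d \<odot>\<^bsub>?Q\<^esub> X)"
      using c d x by (simp_all add: smult Q.proj_add smult_l_distr smult_assoc1)
  next
    fix c X Y assume c: "c \<in> carrier K" and "X \<in> carrier ?Q" "Y \<in> carrier ?Q"
    then obtain x y where "x \<in> carrier A" "y \<in> carrier A" "X = Q.proj x" "Y = Q.proj y"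
      using Q.proj_surj by meson
    then show "c \<odot>\<^bsub>?Q\<^esub> (X \<oplus>\<^bsub>?Q\<^esub> Y) = c \<odot>\<^bsub>?Q\<^esub> X \<oplus>\<^bsub>?Q\<^esub> c \<odot>\<^bsub>?Q\<^esub> Y"
      using c by (simp add: smult Q.proj_add smult_r_distr)
  next
    fix X assume "X \<in> carrier ?Q"
    then obtain x where "x \<in> carrier A" "X = Q.proj x" using Q.proj_surj by blast
    then show "\<one>\<^bsub>K\<^esub> \<odot>\<^bsub>?Q\<^esub> X = X" by (simp add: smult)
  qed
  then show ?thesis
  proof (intro nonunital_algebra.intro nonunital_algebra_axioms.intro QR.nonunital_ring_axioms)
    fix c X Y assume c: "c \<in> carrier K" and "X \<in> carrier ?Q" "Y \<in> carrier ?Q"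
    then obtain x y where "x \<in> carrier A" "y \<in> carrier A" "X = Q.proj x" "Y = Q.proj y"
      using Q.proj_surj by meson
    then show "(c \<odot>\<^bsub>?Q\<^esub> X) \<otimes>\<^bsub>?Q\<^esub> Y = c \<odot>\<^bsub>?Q\<^esub> (X \<otimes>\<^bsub>?Q\<^esub> Y)"
      "X \<otimes>\<^bsub>?Q\<^esub> (c \<odot>\<^bsub>?Q\<^esub> Y) = c \<odot>\<^bsub>?Q\<^esub> (X \<otimes>\<^bsub>?Q\<^esub> Y)"
      using c by (simp_all add: smult Q.proj_mult smult_mult_left smult_mult_right)
  qed
qed

subsection \<open>Ideals and spans\<close>

context nonunital_algebra
begin

lemma algebra_idealI:
  assumes sub: "I \<subseteq> carrier A" and zero: "\<zero> \<in> I"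
    and add: "\<And>x y. \<lbrakk>x \<in> I; y \<in> I\<rbrakk> \<Longrightarrow> x \<oplus> y \<in> I"
    and smult: "\<And>c x. \<lbrakk>c \<in> carrier K; x \<in> I\<rbrakk> \<Longrightarrow> c \<odot> x \<in> I"
    and mult: "\<And>x y. \<lbrakk>x \<in> I; y \<in> carrier A\<rbrakk> \<Longrightarrow> y \<otimes> x \<in> I"
      "\<And>x y. \<lbrakk>x \<in> I; y \<in> carrier A\<rbrakk> \<Longrightarrow> x \<otimes> y \<in> I"
  shows "algebra_ideal I K A"
proof -
  have neg: "\<ominus> x \<in> I" if "x \<in> I" for x
    using smult[OF _ that, of "\<ominus>\<^bsub>K\<^esub> \<one>\<^bsub>K\<^esub>"] that sub smult_l_minus[of "\<one>\<^bsub>K\<^esub>" x] by auto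
  have "submodule I K A" by (rule submoduleI[OF sub zero neg add smult])
  moreover have "two_sided_ideal I A"
    by (rule two_sided_idealI[OF M.abelian_group_axioms sub zero add neg mult])
  ultimately show ?thesis by (simp add: algebra_ideal_def)
qed

lemma submodule_zero: "submodule N K A \<Longrightarrow> \<zero> \<in> N"
  using subgroup.one_closed[OF submodule.axioms(1), of N K A] by simp

lemma algebra_ideal_of_is_ideal:
  assumes "S \<subseteq> carrier A"
  shows "algebra_ideal (algebra_ideal_of K A S) K A" "S \<subseteq> algebra_ideal_of K A S"
proof -
  have top: "algebra_ideal (carrier A) K A" by (rule algebra_idealI) auto
  note D = algebra_ideal_def two_sided_ideal_def
  show "algebra_ideal (algebra_ideal_of K A S) K A"
    unfolding algebra_ideal_of_def
  proof (rule algebra_idealI)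
    show "\<Inter> {I. algebra_ideal I K A \<and> S \<subseteq> I} \<subseteq> carrier A" using top assms by blast
    show "\<zero> \<in> \<Inter> {I. algebra_ideal I K A \<and> S \<subseteq> I}" by (auto simp: D submodule_zero)
  qed (auto simp: D submoduleE submodule.smult_closed)
  show "S \<subseteq> algebra_ideal_of K A S" by (auto simp: algebra_ideal_of_def)
qed

lemma submodule_span_of:
  assumes "S \<subseteq> carrier A"
  shows "submodule (span_of K A S) K A" "S \<subseteq> span_of K A S"
proof -
  have top: "submodule (carrier A) K A" by (rule submoduleI) auto
  show "submodule (span_of K A S) K A"
    unfolding span_of_def
  proof (rule submoduleI)
    show "\<Inter> {N. submodule N K A \<and> S \<subseteq> N} \<subseteq> carrier A" using top assms by blast
    show "\<zero> \<in> \<Inter> {N. submodule N K A \<and> S \<subseteq> N}" by (auto simp: submodule_zero)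
  qed (auto simp: submoduleE submodule.smult_closed)
  show "S \<subseteq> span_of K A S" by (auto simp: span_of_def)
qed

text \<open>The elements all of whose multiples lie in the span form a submodule.\<close>

lemma span_of_is_ideal:
  assumes S: "S \<subseteq> carrier A"
    and left: "\<And>x s. \<lbrakk>x \<in> carrier A; s \<in> S\<rbrakk> \<Longrightarrow> x \<otimes> s \<in> span_of K A S"
    and right: "\<And>x s. \<lbrakk>x \<in> carrier A; s \<in> S\<rbrakk> \<Longrightarrow> s \<otimes> x \<in> span_of K A S"
  shows "algebra_ideal (span_of K A S) K A"
proof -
  let ?N = "span_of K A S"
  have sub: "submodule ?N K A" by (rule submodule_span_of[OF S])
  let ?M = "{y \<in> carrier A. \<forall>x\<in>carrier A. x \<otimes> y \<in> ?N \<and> y \<otimes> x \<in> ?N}"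
  have "submodule ?M K A"
  proof (rule submoduleI)
    show "\<zero> \<in> ?M" using submodule_zero[OF sub] by simp
    fix a assume a: "a \<in> ?M"
    then show "\<ominus> a \<in> ?M" using submoduleE(3)[OF sub] by (simp add: l_minus r_minus)
    fix b assume "b \<in> ?M"
    then show "a \<oplus> b \<in> ?M" using a submoduleE(5)[OF sub] by (simp add: l_distr r_distr)
  next
    fix c a assume "c \<in> carrier K" "a \<in> ?M"
    then show "c \<odot> a \<in> ?M"
      using submoduleE(4)[OF sub] by (simp add: smult_mult_left smult_mult_right)
  qed auto
  moreover have "S \<subseteq> ?M" using S left right by blast
  ultimately have "?N \<subseteq> ?M" unfolding span_of_def by blast
  then show ?thesis
    using sub submoduleE[OF sub] submodule_zero[OF sub] by (intro algebra_idealI) auto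
qed

end

section \<open>Tensor products of algebras\<close>

locale tensor_of_algebras = A: nonunital_algebra K A + B: nonunital_algebra K B
  for K and A (structure) and B
begin

sublocale semigroup_over_cring K "A \<times>\<times> B"
  by unfold_locales (auto simp: A.m_assoc B.m_assoc)

sublocale F: nonunital_algebra K "semigroup_algebra K (A \<times>\<times> B)"
  by (rule nonunital_algebra_F)

abbreviation "relations \<equiv> tensor_relations K A B"

lemma tensor_relation_cases:
  assumes "r \<in> relations"
  obtains (add_left) a a' b where "a \<in> carrier A" "a' \<in> carrier A" "b \<in> carrier B"
      "r = \<delta> (a \<oplus> a', b) \<ominus>\<^bsub>F\<^esub> (\<delta> (a, b) \<oplus>\<^bsub>F\<^esub> \<delta> (a', b))"
    | (add_right) a b b' where "a \<in> carrier A" "b \<in> carrier B" "b' \<in> carrier B"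
      "r = \<delta> (a, b \<oplus>\<^bsub>B\<^esub> b') \<ominus>\<^bsub>F\<^esub> (\<delta> (a, b) \<oplus>\<^bsub>F\<^esub> \<delta> (a, b'))"
    | (smult_left) c a b where "c \<in> carrier K" "a \<in> carrier A" "b \<in> carrier B"
      "r = \<delta> (c \<odot> a, b) \<ominus>\<^bsub>F\<^esub> c \<odot>\<^bsub>F\<^esub> \<delta> (a, b)"
    | (smult_right) c a b where "c \<in> carrier K" "a \<in> carrier A" "b \<in> carrier B"
      "r = \<delta> (a, c \<odot>\<^bsub>B\<^esub> b) \<ominus>\<^bsub>F\<^esub> c \<odot>\<^bsub>F\<^esub> \<delta> (a, b)"
  using assms unfolding tensor_relations_def Let_def
  by (elim UnE CollectE exE conjE) (rule add_left add_right smult_left smult_right; assumption)+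

lemma tensor_relationsI:
  "\<lbrakk>a \<in> carrier A; a' \<in> carrier A; b \<in> carrier B\<rbrakk> \<Longrightarrow>
    \<delta> (a \<oplus> a', b) \<ominus>\<^bsub>F\<^esub> (\<delta> (a, b) \<oplus>\<^bsub>F\<^esub> \<delta> (a', b)) \<in> relations"
  "\<lbrakk>a \<in> carrier A; b \<in> carrier B; b' \<in> carrier B\<rbrakk> \<Longrightarrow>
    \<delta> (a, b \<oplus>\<^bsub>B\<^esub> b') \<ominus>\<^bsub>F\<^esub> (\<delta> (a, b) \<oplus>\<^bsub>F\<^esub> \<delta> (a, b')) \<in> relations"
  "\<lbrakk>c \<in> carrier K; a \<in> carrier A; b \<in> carrier B\<rbrakk> \<Longrightarrow>
    \<delta> (c \<odot> a, b) \<ominus>\<^bsub>F\<^esub> c \<odot>\<^bsub>F\<^esub> \<delta> (a, b) \<in> relations"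
  "\<lbrakk>c \<in> carrier K; a \<in> carrier A; b \<in> carrier B\<rbrakk> \<Longrightarrow>
    \<delta> (a, c \<odot>\<^bsub>B\<^esub> b) \<ominus>\<^bsub>F\<^esub> c \<odot>\<^bsub>F\<^esub> \<delta> (a, b) \<in> relations"
  unfolding tensor_relations_def Let_def by blast+

lemma relations_closed: "relations \<subseteq> carrier F"
proof
  fix r assume "r \<in> relations"
  then show "r \<in> carrier F" by (cases rule: tensor_relation_cases) simp_all
qed

text \<open>As the products of \<open>A\<close> and \<open>B\<close> are bilinear, multiplying a relation by a basis element only
  multiplies the elements of \<open>A\<close> and \<open>B\<close> that occur in it.\<close>

lemma basis_mult_relation:
  assumes r: "r \<in> relations" and s: "s \<in> carrier (A \<times>\<times> B)"
  shows "\<delta> s \<otimes>\<^bsub>F\<^esub> r \<in> relations" "r \<otimes>\<^bsub>F\<^esub> \<delta> s \<in> relations"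
proof -
  obtain x y where s_eq: "s = (x, y)" and xy: "x \<in> carrier A" "y \<in> carrier B" using s by auto
  from r have "\<delta> s \<otimes>\<^bsub>F\<^esub> r \<in> relations \<and> r \<otimes>\<^bsub>F\<^esub> \<delta> s \<in> relations"
  proof (cases rule: tensor_relation_cases)
    case (add_left a a' b)
    then show ?thesis
      using tensor_relationsI(1)[of "x \<otimes> a" "x \<otimes> a'" "y \<otimes>\<^bsub>B\<^esub> b"]
        tensor_relationsI(1)[of "a \<otimes> x" "a' \<otimes> x" "b \<otimes>\<^bsub>B\<^esub> y"] xy
      by (simp add: s_eq F.minus_eq F.r_distr F.l_distr F.r_minus F.l_minus basis_mult A.r_distr A.l_distr)
  next
    case (add_right a b b')
    then show ?thesis
      using tensor_relationsI(2)[of "x \<otimes> a" "y \<otimes>\<^bsub>B\<^esub> b" "y \<otimes>\<^bsub>B\<^esub> b'"]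
        tensor_relationsI(2)[of "a \<otimes> x" "b \<otimes>\<^bsub>B\<^esub> y" "b' \<otimes>\<^bsub>B\<^esub> y"] xy
      by (simp add: s_eq F.minus_eq F.r_distr F.l_distr F.r_minus F.l_minus basis_mult B.r_distr B.l_distr)
  next
    case (smult_left c a b)
    then show ?thesis
      using tensor_relationsI(3)[of c "x \<otimes> a" "y \<otimes>\<^bsub>B\<^esub> b"]
        tensor_relationsI(3)[of c "a \<otimes> x" "b \<otimes>\<^bsub>B\<^esub> y"] xy
      by (simp add: s_eq F.minus_eq F.r_distr F.l_distr F.r_minus F.l_minus basis_mult
          F.smult_mult_left F.smult_mult_right A.smult_mult_left A.smult_mult_right)
  next
    case (smult_right c a b)
    then show ?thesis
      using tensor_relationsI(4)[of c "x \<otimes> a" "y \<otimes>\<^bsub>B\<^esub> b"]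
        tensor_relationsI(4)[of c "a \<otimes> x" "b \<otimes>\<^bsub>B\<^esub> y"] xy
      by (simp add: s_eq F.minus_eq F.r_distr F.l_distr F.r_minus F.l_minus basis_mult
          F.smult_mult_left F.smult_mult_right B.smult_mult_left B.smult_mult_right)
  qed
  then show "\<delta> s \<otimes>\<^bsub>F\<^esub> r \<in> relations" "r \<otimes>\<^bsub>F\<^esub> \<delta> s \<in> relations" by simp_all
qed

abbreviation "N \<equiv> span_of K F relations"
abbreviation "T \<equiv> tensor_algebra K A B"

lemma algebra_ideal_N: "algebra_ideal N K F"
proof (rule F.span_of_is_ideal[OF relations_closed])
  have sub: "submodule N K F" "relations \<subseteq> N" by (rule F.submodule_span_of[OF relations_closed])+
  fix x r assume x: "x \<in> carrier F" and r: "r \<in> relations"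
  then have rF: "r \<in> carrier F" using relations_closed by blast
  from x have "x \<otimes>\<^bsub>F\<^esub> r \<in> N \<and> r \<otimes>\<^bsub>F\<^esub> x \<in> N"
  proof (induction x rule: F_induct)
    case zero
    then show ?case using rF F.submodule_zero[OF sub(1)] by simp
  next
    case (basis c s)
    then show ?case
      using basis_mult_relation[OF r basis(2)] sub(2) F.submoduleE(4)[OF sub(1) basis(1)] rF
      by (auto simp: F.smult_mult_left F.smult_mult_right)
  next
    case (add f h)
    then show ?case using rF F.submoduleE(5)[OF sub(1)] by (simp add: F.l_distr F.r_distr)
  qed
  then show "x \<otimes>\<^bsub>F\<^esub> r \<in> N" "r \<otimes>\<^bsub>F\<^esub> x \<in> N" by simp_all
qed

lemma T_eq: "T = quotient_algebra F N"
  by (simp add: tensor_algebra_def Let_def)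

sublocale Q: ideal_quotient F N T
  unfolding T_eq using algebra_ideal_N
  by (intro ideal_quotient_quotient_algebra F.nonunital_ring_axioms) (simp add: algebra_ideal_def)

definition tensor where "tensor a b = Q.proj (\<delta> (a, b))"

lemma tensor_closed: "\<lbrakk>a \<in> carrier A; b \<in> carrier B\<rbrakk> \<Longrightarrow> tensor a b \<in> carrier T"
  by (simp add: tensor_def)

lemma relation_in_N: "r \<in> relations \<Longrightarrow> r \<in> N"
  using F.submodule_span_of(2)[OF relations_closed] by blast

lemma tensor_add_left:
  "\<lbrakk>a \<in> carrier A; a' \<in> carrier A; b \<in> carrier B\<rbrakk> \<Longrightarrow>
    tensor (a \<oplus> a') b = tensor a b \<oplus>\<^bsub>T\<^esub> tensor a' b"
  using relation_in_N[OF tensor_relationsI(1)[of a a' b]]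
  by (simp add: tensor_def Q.proj_add Q.proj_eq_iff)

lemma tensor_add_right:
  "\<lbrakk>a \<in> carrier A; b \<in> carrier B; b' \<in> carrier B\<rbrakk> \<Longrightarrow>
    tensor a (b \<oplus>\<^bsub>B\<^esub> b') = tensor a b \<oplus>\<^bsub>T\<^esub> tensor a b'"
  using relation_in_N[OF tensor_relationsI(2)[of a b b']]
  by (simp add: tensor_def Q.proj_add Q.proj_eq_iff)

lemma tensor_smult:
  "\<lbrakk>c \<in> carrier K; a \<in> carrier A; b \<in> carrier B\<rbrakk> \<Longrightarrow> tensor (c \<odot> a) b = Q.proj (c \<odot>\<^bsub>F\<^esub> \<delta> (a, b))"
  "\<lbrakk>c \<in> carrier K; a \<in> carrier A; b \<in> carrier B\<rbrakk> \<Longrightarrow> tensor a (c \<odot>\<^bsub>B\<^esub> b) = Q.proj (c \<odot>\<^bsub>F\<^esub> \<delta> (a, b))"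
  using relation_in_N[OF tensor_relationsI(3)[of c a b]] relation_in_N[OF tensor_relationsI(4)[of c a b]]
  by (simp_all add: tensor_def Q.proj_eq_iff)

lemma tensor_mult:
  "\<lbrakk>a \<in> carrier A; a' \<in> carrier A; b \<in> carrier B; b' \<in> carrier B\<rbrakk> \<Longrightarrow>
    tensor a b \<otimes>\<^bsub>T\<^esub> tensor a' b' = tensor (a \<otimes> a') (b \<otimes>\<^bsub>B\<^esub> b')"
  by (simp add: tensor_def Q.proj_mult basis_mult)

lemma tensor_induct:
  assumes x: "x \<in> carrier T" and zero: "P \<zero>\<^bsub>T\<^esub>"
    and tensor: "\<And>a b. \<lbrakk>a \<in> carrier A; b \<in> carrier B\<rbrakk> \<Longrightarrow> P (tensor a b)"
    and add: "\<And>x y. \<lbrakk>x \<in> carrier T; y \<in> carrier T; P x; P y\<rbrakk> \<Longrightarrow> P (x \<oplus>\<^bsub>T\<^esub> y)"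
  shows "P x"
proof -
  obtain f where f: "f \<in> carrier F" "x = Q.proj f" using Q.proj_surj[OF x] by blast
  from f(1) have "P (Q.proj f)"
  proof (induction f rule: F_induct)
    case zero
    then show ?case using assms(2) by (simp add: Q.proj_zero)
  next
    case (basis c s)
    then obtain a b where s: "s = (a, b)" "a \<in> carrier A" "b \<in> carrier B" by auto
    then show ?case using basis tensor[of "c \<odot> a" b] by (simp add: tensor_smult(1))
  next
    case (add f h)
    then show ?case using assms(4)[of "Q.proj f" "Q.proj h"] by (simp add: Q.proj_add)
  qed
  then show ?thesis using f by simp
qed

end

section \<open>Leavitt path algebras by generators and relations\<close>

locale leavitt_presentation = wf_digraph E + K: cring K
  for E :: "('v, 'e) pre_digraph" and K (structure) +
  assumes finite_out_arcs: "v \<in> verts E \<Longrightarrow> finite (out_arcs E v)"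
begin

abbreviation "X \<equiv> leavitt_gens E"

sublocale semigroup_over_cring K "free_semigroup X"
  by unfold_locales (auto simp: free_semigroup_def)

sublocale F: nonunital_algebra K "semigroup_algebra K (free_semigroup X)"
  by (rule nonunital_algebra_F)

lemma word_in_semigroup: "ms \<in> carrier (free_semigroup X) \<longleftrightarrow> set ms \<subseteq> X \<and> ms \<noteq> []"
  by (auto simp: free_semigroup_def)

lemma word_mult: "ms \<otimes>\<^bsub>free_semigroup X\<^esub> ms' = ms @ ms'"
  by (simp add: free_semigroup_def)

abbreviation "word ms \<equiv> \<delta> ms"
abbreviation "relations \<equiv> leavitt_relations K E"
abbreviation "I \<equiv> algebra_ideal_of K F relations"
abbreviation "L \<equiv> leavitt_path_algebra K E"

lemma generator_words [simp]:
  "v \<in> verts E \<Longrightarrow> word [Vertex v] \<in> carrier F"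
  "e \<in> arcs E \<Longrightarrow> word [Edge e] \<in> carrier F"
  "e \<in> arcs E \<Longrightarrow> word [Ghost e] \<in> carrier F"
  by (rule basis_closed, simp only: word_in_semigroup, simp add: leavitt_gens_def)+

lemma edge_ghost_sum_closed [simp]:
  "(\<Oplus>\<^bsub>F\<^esub>e\<in>out_arcs E v. word [Edge e] \<otimes>\<^bsub>F\<^esub> word [Ghost e]) \<in> carrier F"
  by (intro F.finsum_closed) auto

lemma relations_closed: "relations \<subseteq> carrier F"
  unfolding leavitt_relations_def free_algebra_def Let_def
  by (auto intro!: F.minus_closed)

lemma L_eq: "L = quotient_algebra F I"
  by (simp add: leavitt_path_algebra_def free_algebra_def Let_def)

lemma algebra_ideal_I: "algebra_ideal I K F"
  by (rule F.algebra_ideal_of_is_ideal[OF relations_closed])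

lemma nonunital_algebra_L: "nonunital_algebra K L"
  unfolding L_eq by (rule nonunital_algebra_quotient[OF F.nonunital_algebra_axioms algebra_ideal_I])

sublocale Q: ideal_quotient F I L
  unfolding L_eq using algebra_ideal_I
  by (intro ideal_quotient_quotient_algebra F.nonunital_ring_axioms) (simp add: algebra_ideal_def)

sublocale L: nonunital_algebra K L by (rule nonunital_algebra_L)

definition gen :: "('v, 'e) leavitt_gen \<Rightarrow> (('v, 'e) leavitt_gen list \<Rightarrow> 'a) set" where
  "gen x = Q.proj (word [x])"

lemma gen_closed: "x \<in> X \<Longrightarrow> gen x \<in> carrier L"
  by (simp add: gen_def word_in_semigroup)

lemma monomial_gen:
  "\<lbrakk>set ms \<subseteq> X; ms \<noteq> []\<rbrakk> \<Longrightarrow> monomial L gen ms = Q.proj (word ms)"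
proof (induction ms rule: induct_list012)
  case (3 x y ys)
  then show ?case
    by (simp add: gen_def Q.proj_mult word_in_semigroup basis_mult word_mult)
qed (simp_all add: gen_def)

lemma related_words:
  assumes "r \<ominus>\<^bsub>F\<^esub> r' \<in> relations" "r \<in> carrier F" "r' \<in> carrier F"
  shows "Q.proj r = Q.proj r'"
  using assms F.algebra_ideal_of_is_ideal(2)[OF relations_closed] by (auto simp: Q.proj_eq_iff)

lemma leavitt_relations_hold:
  "\<lbrakk>v \<in> verts E; w \<in> verts E\<rbrakk> \<Longrightarrow>
    gen (Vertex v) \<otimes>\<^bsub>L\<^esub> gen (Vertex w) = (if v = w then gen (Vertex v) else \<zero>\<^bsub>L\<^esub>)"
  "e \<in> arcs E \<Longrightarrow> gen (Vertex (tail E e)) \<otimes>\<^bsub>L\<^esub> gen (Edge e) = gen (Edge e)"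
  "e \<in> arcs E \<Longrightarrow> gen (Edge e) \<otimes>\<^bsub>L\<^esub> gen (Vertex (head E e)) = gen (Edge e)"
  "e \<in> arcs E \<Longrightarrow> gen (Vertex (head E e)) \<otimes>\<^bsub>L\<^esub> gen (Ghost e) = gen (Ghost e)"
  "e \<in> arcs E \<Longrightarrow> gen (Ghost e) \<otimes>\<^bsub>L\<^esub> gen (Vertex (tail E e)) = gen (Ghost e)"
  "\<lbrakk>e \<in> arcs E; f \<in> arcs E\<rbrakk> \<Longrightarrow>
    gen (Ghost e) \<otimes>\<^bsub>L\<^esub> gen (Edge f) = (if e = f then gen (Vertex (head E e)) else \<zero>\<^bsub>L\<^esub>)"
proof -
  note rel = leavitt_relations_def free_algebra_def Let_def
  show "gen (Vertex v) \<otimes>\<^bsub>L\<^esub> gen (Vertex w) = (if v = w then gen (Vertex v) else \<zero>\<^bsub>L\<^esub>)"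
    if "v \<in> verts E" "w \<in> verts E"
  proof -
    have "Q.proj (word [Vertex v] \<otimes>\<^bsub>F\<^esub> word [Vertex w]) = Q.proj (if v = w then word [Vertex v] else \<zero>\<^bsub>F\<^esub>)"
      using that by (intro related_words) (auto simp: rel)
    then show ?thesis using that by (simp add: gen_def Q.proj_mult Q.proj_zero split: if_splits)
  qed
  show "gen (Ghost e) \<otimes>\<^bsub>L\<^esub> gen (Edge f) = (if e = f then gen (Vertex (head E e)) else \<zero>\<^bsub>L\<^esub>)"
    if "e \<in> arcs E" "f \<in> arcs E"
  proof -
    have "Q.proj (word [Ghost e] \<otimes>\<^bsub>F\<^esub> word [Edge f]) = Q.proj (if e = f then word [Vertex (head E e)] else \<zero>\<^bsub>F\<^esub>)"
      using that by (intro related_words) (auto simp: rel)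
    then show ?thesis using that by (simp add: gen_def Q.proj_mult Q.proj_zero split: if_splits)
  qed
  assume e: "e \<in> arcs E"
  have "Q.proj (word [Vertex (tail E e)] \<otimes>\<^bsub>F\<^esub> word [Edge e]) = Q.proj (word [Edge e])"
    "Q.proj (word [Edge e] \<otimes>\<^bsub>F\<^esub> word [Vertex (head E e)]) = Q.proj (word [Edge e])"
    "Q.proj (word [Vertex (head E e)] \<otimes>\<^bsub>F\<^esub> word [Ghost e]) = Q.proj (word [Ghost e])"
    "Q.proj (word [Ghost e] \<otimes>\<^bsub>F\<^esub> word [Vertex (tail E e)]) = Q.proj (word [Ghost e])"
    by (rule related_words; use e in \<open>auto simp: rel\<close>)+
  then show "gen (Vertex (tail E e)) \<otimes>\<^bsub>L\<^esub> gen (Edge e) = gen (Edge e)"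
    "gen (Edge e) \<otimes>\<^bsub>L\<^esub> gen (Vertex (head E e)) = gen (Edge e)"
    "gen (Vertex (head E e)) \<otimes>\<^bsub>L\<^esub> gen (Ghost e) = gen (Ghost e)"
    "gen (Ghost e) \<otimes>\<^bsub>L\<^esub> gen (Vertex (tail E e)) = gen (Ghost e)"
    using e by (simp_all add: gen_def Q.proj_mult)
qed

lemma proj_finsum:
  assumes "finite S" "\<And>i. i \<in> S \<Longrightarrow> h i \<in> carrier F"
  shows "Q.proj (finsum F h S) = finsum L (\<lambda>i. Q.proj (h i)) S"
  using assms
proof (induction S rule: finite_induct)
  case empty
  then show ?case by (simp add: Q.proj_zero)
next
  case (insert i S)
  then show ?case by (simp add: F.finsum_insert L.finsum_insert Pi_def flip: Q.proj_add)
qed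

lemma vertex_sum:
  assumes "v \<in> verts E" "out_arcs E v \<noteq> {}"
  shows "gen (Vertex v) = (\<Oplus>\<^bsub>L\<^esub>e\<in>out_arcs E v. gen (Edge e) \<otimes>\<^bsub>L\<^esub> gen (Ghost e))"
proof -
  have "gen (Vertex v) = Q.proj (\<Oplus>\<^bsub>F\<^esub>e\<in>out_arcs E v. word [Edge e] \<otimes>\<^bsub>F\<^esub> word [Ghost e])"
    unfolding gen_def
    using assms by (intro related_words) (auto simp: leavitt_relations_def free_algebra_def Let_def)
  also have "\<dots> = (\<Oplus>\<^bsub>L\<^esub>e\<in>out_arcs E v. Q.proj (word [Edge e] \<otimes>\<^bsub>F\<^esub> word [Ghost e]))"
    using finite_out_arcs[OF assms(1)] by (intro proj_finsum) auto
  also have "\<dots> = (\<Oplus>\<^bsub>L\<^esub>e\<in>out_arcs E v. gen (Edge e) \<otimes>\<^bsub>L\<^esub> gen (Ghost e))"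
    by (intro L.finsum_cong') (auto simp: gen_def Q.proj_mult)
  finally show ?thesis .
qed

lemma L_induct:
  assumes x: "x \<in> carrier L" and zero: "P \<zero>\<^bsub>L\<^esub>"
    and monomial: "\<And>c ms. \<lbrakk>c \<in> carrier K; set ms \<subseteq> X; ms \<noteq> []\<rbrakk> \<Longrightarrow> P (c \<odot>\<^bsub>L\<^esub> monomial L gen ms)"
    and add: "\<And>x y. \<lbrakk>x \<in> carrier L; y \<in> carrier L; P x; P y\<rbrakk> \<Longrightarrow> P (x \<oplus>\<^bsub>L\<^esub> y)"
  shows "P x"
proof -
  obtain f where f: "f \<in> carrier F" "x = Q.proj f" using Q.proj_surj[OF x] by blast
  from f(1) have "P (Q.proj f)"
  proof (induction f rule: F_induct)
    case zero
    then show ?case using assms(2) by (simp add: Q.proj_zero)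
  next
    case (basis c s)
    then have "c \<odot>\<^bsub>L\<^esub> monomial L gen s = Q.proj (c \<odot>\<^bsub>F\<^esub> word s)"
      unfolding L_eq using quotient_algebra_smult[OF F.nonunital_algebra_axioms algebra_ideal_I]
      by (simp add: word_in_semigroup monomial_gen flip: L_eq)
    then show ?case using basis monomial[of c s] by (simp add: word_in_semigroup)
  next
    case (add f h)
    then show ?case using assms(4)[of "Q.proj f" "Q.proj h"] by (simp add: Q.proj_add)
  qed
  then show ?thesis using f by simp
qed

text \<open>For the induction principle, a tensor \<open>a \<otimes> l\<close> is expanded along the linear combination \<open>l\<close> of
  monomials, and the scalars are moved to the first factor.\<close>

lemma leavitt_tensor_tensor_algebra:
  assumes "nonunital_algebra K A"
  shows "leavitt_tensor E A L (tensor_algebra K A L) gen (tensor_of_algebras.tensor K A L)"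
proof -
  interpret A: nonunital_algebra K A by fact
  interpret T: tensor_of_algebras K A L by unfold_locales
  show ?thesis
  proof (intro leavitt_tensor.intro leavitt_tensor_axioms.intro wf_digraph_axioms
      A.nonunital_ring_axioms L.nonunital_ring_axioms T.Q.quotient_nonunital_ring)
    fix z and P :: "_ \<Rightarrow> bool"
    assume z: "z \<in> carrier (tensor_algebra K A L)" and zero: "P \<zero>\<^bsub>tensor_algebra K A L\<^esub>"
      and mon: "\<And>a ms. \<lbrakk>a \<in> carrier A; set ms \<subseteq> X; ms \<noteq> []\<rbrakk> \<Longrightarrow> P (T.tensor a (monomial L gen ms))"
      and add: "\<And>x y. \<lbrakk>x \<in> carrier (tensor_algebra K A L); y \<in> carrier (tensor_algebra K A L); P x; P y\<rbrakk>
        \<Longrightarrow> P (x \<oplus>\<^bsub>tensor_algebra K A L\<^esub> y)"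
    from z zero show "P z"
    proof (rule T.tensor_induct)
      fix a l assume a: "a \<in> carrier A" and l: "l \<in> carrier L"
      from l show "P (T.tensor a l)"
      proof (rule L_induct)
        interpret TR: nonunital_ring "tensor_algebra K A L" by (rule T.Q.quotient_nonunital_ring)
        have "T.tensor a \<zero>\<^bsub>L\<^esub> = \<zero>\<^bsub>tensor_algebra K A L\<^esub>"
          using T.tensor_add_right[of a "\<zero>\<^bsub>L\<^esub>" "\<zero>\<^bsub>L\<^esub>"] T.tensor_closed[of a "\<zero>\<^bsub>L\<^esub>"] a
            TR.add.l_cancel_one'[of "T.tensor a \<zero>\<^bsub>L\<^esub>" "T.tensor a \<zero>\<^bsub>L\<^esub>"] by simp
        then show "P (T.tensor a \<zero>\<^bsub>L\<^esub>)" using zero by simp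
      next
        fix c ms assume c: "c \<in> carrier K" and ms: "set ms \<subseteq> X" "ms \<noteq> []"
        have "monomial L gen ms \<in> carrier L" using ms by (simp add: monomial_gen word_in_semigroup)
        then have "T.tensor a (c \<odot>\<^bsub>L\<^esub> monomial L gen ms) = T.tensor (c \<odot>\<^bsub>A\<^esub> a) (monomial L gen ms)"
          using a c by (simp add: T.tensor_smult)
        then show "P (T.tensor a (c \<odot>\<^bsub>L\<^esub> monomial L gen ms))" using mon a c ms by simp
      next
        fix x y assume "x \<in> carrier L" "y \<in> carrier L" "P (T.tensor a x)" "P (T.tensor a y)"
        then show "P (T.tensor a (x \<oplus>\<^bsub>L\<^esub> y))"
          using a add by (simp add: T.tensor_add_right T.tensor_closed)
      qed
    qed (rule add)
  qed (rule gen_closed leavitt_relations_hold vertex_sum T.tensor_closed T.tensor_add_left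
      T.tensor_add_right T.tensor_mult; assumption)+
qed

end

section \<open>Tensor products with simple purely infinite Leavitt path algebras\<close>

theorem theorem7p9:
  fixes K :: "('k, 'm) ring_scheme"
    and A :: "('k, 'a, 'n) module_scheme"
    and E :: "('v, 'e) pre_digraph"
  assumes "field K"
    and "nonunital_algebra K A"
    and "s_unital A"
    and "wf_digraph E"
    and "countable (verts E)"
    and "countable (arcs E)"
    and "row_finite E"
    and "\<forall>I. two_sided_ideal I A \<longrightarrow> right_ideals_contain_idempotents (A Quot I)"
    and "\<forall>H. H \<subseteq> verts E \<and> hereditary E H \<and> saturated E H \<longrightarrow> H = {} \<or> H = verts E"
    and "\<forall>p. pre_digraph.cycle E p \<longrightarrow> (\<exists>e. is_exit E e p)"
    and "\<forall>v\<in>verts E. connects_to_cycle E v"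
  shows "properly_purely_infinite (tensor_algebra K A (leavitt_path_algebra K E))"
proof -
  interpret K: field K by fact
  interpret wf_digraph E by fact
  interpret leavitt_presentation E K
    by unfold_locales (use assms(7) in \<open>auto simp: row_finite_def\<close>)
  interpret T: leavitt_tensor E A L "tensor_algebra K A L" gen "tensor_of_algebras.tensor K A L"
    by (rule leavitt_tensor_tensor_algebra[OF assms(2)])
  show ?thesis
    unfolding properly_purely_infinite_def
  proof
    fix x assume x: "x \<in> carrier (tensor_algebra K A L) - {\<zero>\<^bsub>tensor_algebra K A L\<^esub>}"
    \<comment> \<open>The empty graph gives the zero algebra.\<close>
    have "verts E \<noteq> {}"
    proof
      assume empty: "verts E = {}"
      then have "arcs E = {}" using tail_in_verts by blast
      then have "X = {}" using empty by (simp add: leavitt_gens_def)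
      then have "x = \<zero>\<^bsub>tensor_algebra K A L\<^esub>"
        using x by (intro T.tensor_induct[of x "\<lambda>x. x = \<zero>\<^bsub>tensor_algebra K A L\<^esub>"]) auto
      then show False using x by simp
    qed
    then obtain w e f where "e \<in> out_arcs E w" "f \<in> out_arcs E w" "e \<noteq> f" "\<forall>v\<in>verts E. v \<rightarrow>\<^sup>*\<^bsub>E\<^esub> w"
      using branching_vertex_reached_from_everywhere[OF _ assms(9-11)] by blast
    then have "x \<in> absorbed (tensor_algebra K A L) x"
      using assms(3,8,9) x finite_out_arcs by (intro T.element_absorbs_itself[of e w f x]) auto
    then show "properly_infinite (tensor_algebra K A L) x"
      using x by (simp add: properly_infinite_iff)
  qed
qed

end
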